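(* Let $a$ and $b$ be positive square-free integers with $\gcd(a,b) \leq 2$. Then $g_{a,b}(2) = 3$.
   Context: For integers $a,b$, let $LQ_{a,b}$ denote the quaternion ring $\{\alpha_0 + \alpha_1 \mathbf{i} + \alpha_2 \mathbf{j} + \alpha_3 \mathbf{k} \mid \alpha_0,\alpha_1,\alpha_2,\alpha_3 \in \mathbb{Z}\}$ with $\mathbf{i}^2 = -a$, $\mathbf{j}^2 = -b$, $\mathbf{i}\mathbf{j} = -\mathbf{j}\mathbf{i} = \mathbf{k}$. For $k \geq 2$, let $LQ_{a,b}^k$ denote the additive group generated by all $k$-th powers of elements of $LQ_{a,b}$. The Waring number $g_{a,b}(k)$ is the least positive integer $g$ such that every element of $LQ_{a,b}^k$ can be written as a sum of at most $g$ $k$-th powers of elements of $LQ_{a,b}$. *)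

theory Defs
  imports
    "HOL-Algebra.Generated_Groups"
    "HOL-Algebra.Ring"
    "HOL-Computational_Algebra.Squarefree"
    "HOL-Library.Extended_Nat"
begin

datatype lquat = LQuat int int int int

fun lq_add :: "lquat \<Rightarrow> lquat \<Rightarrow> lquat" where
  "lq_add (LQuat p0 p1 p2 p3) (LQuat q0 q1 q2 q3) =
     LQuat (p0 + q0) (p1 + q1) (p2 + q2) (p3 + q3)"

text \<open>
  The product is the bilinear extension of the relations
  \<open>i\<^sup>2 = -a\<close>, \<open>j\<^sup>2 = -b\<close>, \<open>ij = -ji = k\<close>, from which
  \<open>k\<^sup>2 = -ab\<close>, \<open>jk = -kj = bi\<close> and \<open>ki = -ik = aj\<close> follow by associativity.
\<close>

fun lq_mult :: "int \<Rightarrow> int \<Rightarrow> lquat \<Rightarrow> lquat \<Rightarrow> lquat" where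
  "lq_mult a b (LQuat p0 p1 p2 p3) (LQuat q0 q1 q2 q3) =
     LQuat (p0 * q0 - a * p1 * q1 - b * p2 * q2 - a * b * p3 * q3)
           (p0 * q1 + p1 * q0 + b * p2 * q3 - b * p3 * q2)
           (p0 * q2 + p2 * q0 + a * p3 * q1 - a * p1 * q3)
           (p0 * q3 + p3 * q0 + p1 * q2 - p2 * q1)"

definition LQ :: "int \<Rightarrow> int \<Rightarrow> lquat ring" where
  "LQ a b = \<lparr>carrier = UNIV, monoid.mult = lq_mult a b, one = LQuat 1 0 0 0,
             zero = LQuat 0 0 0 0, add = lq_add\<rparr>"

lemma LQ_simps [simp]:
  "carrier (LQ a b) = UNIV"
  "x \<otimes>\<^bsub>LQ a b\<^esub> y = lq_mult a b x y"
  "\<one>\<^bsub>LQ a b\<^esub> = LQuat 1 0 0 0"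
  "\<zero>\<^bsub>LQ a b\<^esub> = LQuat 0 0 0 0"
  "x \<oplus>\<^bsub>LQ a b\<^esub> y = lq_add x y"
  by (simp_all add: LQ_def)

lemma LQ_ring: "ring (LQ a b)"
proof (rule ringI)
  show "abelian_group (LQ a b)"
  proof (rule abelian_groupI)
    fix x :: lquat
    obtain p0 p1 p2 p3 where "x = LQuat p0 p1 p2 p3" by (cases x)
    then have "LQuat (- p0) (- p1) (- p2) (- p3) \<oplus>\<^bsub>LQ a b\<^esub> x = \<zero>\<^bsub>LQ a b\<^esub>" by simp
    then show "\<exists>y \<in> carrier (LQ a b). y \<oplus>\<^bsub>LQ a b\<^esub> x = \<zero>\<^bsub>LQ a b\<^esub>"
      by (metis LQ_simps(1) UNIV_I)
  next
    fix x y z :: lquat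
    show "x \<oplus>\<^bsub>LQ a b\<^esub> y \<oplus>\<^bsub>LQ a b\<^esub> z = x \<oplus>\<^bsub>LQ a b\<^esub> (y \<oplus>\<^bsub>LQ a b\<^esub> z)"
      by (cases x; cases y; cases z) simp
    show "x \<oplus>\<^bsub>LQ a b\<^esub> y = y \<oplus>\<^bsub>LQ a b\<^esub> x" by (cases x; cases y) simp
    show "\<zero>\<^bsub>LQ a b\<^esub> \<oplus>\<^bsub>LQ a b\<^esub> x = x" by (cases x) simp
  qed simp_all
  show "monoid (LQ a b)"
  proof (rule monoidI)
    fix x y z :: lquat
    show "x \<otimes>\<^bsub>LQ a b\<^esub> y \<otimes>\<^bsub>LQ a b\<^esub> z = x \<otimes>\<^bsub>LQ a b\<^esub> (y \<otimes>\<^bsub>LQ a b\<^esub> z)"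
      by (cases x; cases y; cases z) (simp add: algebra_simps)
    show "\<one>\<^bsub>LQ a b\<^esub> \<otimes>\<^bsub>LQ a b\<^esub> x = x" by (cases x) simp
    show "x \<otimes>\<^bsub>LQ a b\<^esub> \<one>\<^bsub>LQ a b\<^esub> = x" by (cases x) simp
  qed simp_all
  fix x y z :: lquat
  show "(x \<oplus>\<^bsub>LQ a b\<^esub> y) \<otimes>\<^bsub>LQ a b\<^esub> z = x \<otimes>\<^bsub>LQ a b\<^esub> z \<oplus>\<^bsub>LQ a b\<^esub> y \<otimes>\<^bsub>LQ a b\<^esub> z"
    by (cases x; cases y; cases z) (simp add: algebra_simps)
  show "z \<otimes>\<^bsub>LQ a b\<^esub> (x \<oplus>\<^bsub>LQ a b\<^esub> y) = z \<otimes>\<^bsub>LQ a b\<^esub> x \<oplus>\<^bsub>LQ a b\<^esub> z \<otimes>\<^bsub>LQ a b\<^esub> y"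
    by (cases x; cases y; cases z) (simp add: algebra_simps)
qed

lemma LQ_relations:
  "LQuat 0 1 0 0 \<otimes>\<^bsub>LQ a b\<^esub> LQuat 0 1 0 0 = LQuat (- a) 0 0 0"
  "LQuat 0 0 1 0 \<otimes>\<^bsub>LQ a b\<^esub> LQuat 0 0 1 0 = LQuat (- b) 0 0 0"
  "LQuat 0 1 0 0 \<otimes>\<^bsub>LQ a b\<^esub> LQuat 0 0 1 0 = LQuat 0 0 0 1"
  "LQuat 0 0 1 0 \<otimes>\<^bsub>LQ a b\<^esub> LQuat 0 1 0 0 = LQuat 0 0 0 (- 1)"
  by simp_all

definition LQ_power_group :: "int \<Rightarrow> int \<Rightarrow> nat \<Rightarrow> lquat set" where
  "LQ_power_group a b k =
     generate (add_monoid (LQ a b)) {x [^]\<^bsub>LQ a b\<^esub> k | x. x \<in> carrier (LQ a b)}"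

definition sum_of_at_most_powers :: "int \<Rightarrow> int \<Rightarrow> nat \<Rightarrow> nat \<Rightarrow> lquat \<Rightarrow> bool" where
  "sum_of_at_most_powers a b k g x \<longleftrightarrow>
     (\<exists>m \<le> g. \<exists>f \<in> {..<m} \<rightarrow> carrier (LQ a b).
        x = (\<Oplus>\<^bsub>LQ a b\<^esub> i \<in> {..<m}. f i [^]\<^bsub>LQ a b\<^esub> k))"

text \<open>
  The infimum in \<^typ>\<open>enat\<close> is the least element whenever some such \<open>g\<close> exists, and
  \<open>\<infinity>\<close> otherwise.
\<close>

definition waring_number :: "int \<Rightarrow> int \<Rightarrow> nat \<Rightarrow> enat" where
  "waring_number a b k =
     Inf {enat g | g. 0 < g \<and> (\<forall>x \<in> LQ_power_group a b k. sum_of_at_most_powers a b k g x)}"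

end

theory Submission
  imports Defs "HOL-Number_Theory.Cong"
begin

text \<open>
  Squares of quaternions have even vector parts, so the elements to be represented are
  \<open>\<alpha>0 + 2 (\<alpha>1 i + \<alpha>2 j + \<alpha>3 k)\<close>. Three quaternions with real parts \<open>p \<in> \<int>\<^sup>3\<close> and coefficient vectors
  \<open>m\<^sub>1, m\<^sub>2, m\<^sub>3 \<in> \<int>\<^sup>3\<close> of \<open>i, j, k\<close> solve the problem iff \<open>p \<bullet> m\<^sub>i = \<alpha>\<^sub>i\<close> and
  \<open>|p|\<^sup>2 - a |m\<^sub>1|\<^sup>2 - b |m\<^sub>2|\<^sup>2 - a b |m\<^sub>3|\<^sup>2 = \<alpha>0\<close>. The quadratic form on the left is indefinite; moving a
  solution of the three linear equations along a suitable isotropic direction keeps them and changes the value of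
  the form by multiples of \<open>2 \<sigma>\<close> for a linear expression \<open>\<sigma>\<close>. If \<open>\<sigma> = 1\<close> (or \<open>2\<close>, after fixing residues) and the
  parity is right, every \<open>\<alpha>0\<close> is reached.

  An isotropic direction of this kind comes from an equation
  \<open>N(x, y) = a N(\<mu>\<^sub>1, w\<^sub>1) + b N(\<mu>\<^sub>2, w\<^sub>2) + a b N(\<mu>\<^sub>3, w\<^sub>3)\<close> between norms \<open>N(x, y) = x\<^sup>2 + d y\<^sup>2\<close>, with \<open>d = 1\<close> when
  \<open>gcd a b = 1\<close> and, after halving \<open>a\<close> and \<open>b\<close> (the last coefficient then becomes \<open>2 a b\<close>), \<open>d = 2\<close> when \<open>gcd a b = 2\<close>;
  that \<open>\<sigma>\<close> attains the value needed amounts to coprimality conditions on this solution. Legendre's descent solves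
  \<open>b m\<^sup>2 = N(X) + a' N(Y)\<close>, with \<open>a' = a\<close> or \<open>2 a\<close>; reflecting this solution along a vector chosen by local conditions
  makes \<open>m\<close> and \<open>X\<^sub>1\<close> prime to \<open>2 a\<close> (and to \<open>3\<close> if \<open>d = 2\<close>); and an explicit family built on it, with parameters
  chosen by the Chinese remainder theorem, yields the coprimality conditions.

  Two squares do not suffice for \<open>2 t + 2 i\<close>, where \<open>t = 2\<close> if \<open>a \<equiv> 3 (mod 4)\<close> and \<open>t = 1\<close> otherwise: a
  representation would force \<open>(a H + t)\<^sup>2 = t\<^sup>2 + a + a J\<^sup>2\<close> for integers \<open>H\<close> and \<open>J\<close>, which is impossible modulo \<open>8\<close>.
\<close>

subsection \<open>Congruences for norm forms\<close>

lemma odd_prime_not_dvd_two: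
  fixes p :: int
  assumes "prime p" "odd p"
  shows "\<not> p dvd 2"
proof
  assume "p dvd 2"
  then have "p \<le> 2" by (simp add: zdvd_imp_le)
  moreover have "p > 1" using assms(1) by (rule prime_gt_1_int)
  ultimately have "p = 2" by simp
  with assms(2) show False by simp
qed

lemma chinese_remainder_primes:
  fixes f :: "int \<Rightarrow> int" and e :: "int \<Rightarrow> nat"
  assumes "finite P" and "\<And>p. p \<in> P \<Longrightarrow> prime p"
  shows "\<exists>x. \<forall>p\<in>P. p ^ e p dvd x - f p"
  using assms
proof (induction P rule: finite_induct)
  case empty
  then show ?case by simp
next
  case (insert q P)
  then obtain x0 where x0: "\<forall>p\<in>P. p ^ e p dvd x0 - f p" by auto
  have "coprime (q ^ e q) (\<Prod>p\<in>P. p ^ e p)"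
  proof (rule prod_coprime_right)
    fix p assume "p \<in> P"
    with insert have "prime p" "prime q" "p \<noteq> q" by auto
    then show "coprime (q ^ e q) (p ^ e p)"
      by (metis coprime_power_left_iff coprime_power_right_iff primes_coprime)
  qed
  then obtain x where x: "[x = f q] (mod q ^ e q)" "[x = x0] (mod (\<Prod>p\<in>P. p ^ e p))"
    using binary_chinese_remainder_int by blast
  have "p ^ e p dvd x - f p" if "p \<in> P" for p
  proof -
    have "p ^ e p dvd (\<Prod>p\<in>P. p ^ e p)"
      using that insert.hyps by (intro dvd_prodI) auto
    with x(2) have "p ^ e p dvd x - x0"
      by (meson cong_iff_dvd_diff dvd_trans)
    with x0 that have "p ^ e p dvd (x - x0) + (x0 - f p)" by (intro dvd_add) auto
    then show ?thesis by simp
  qed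
  with x(1) show ?case by (auto simp: cong_iff_dvd_diff)
qed

text \<open>Newton's iteration for square roots: 2 and \<open>c\<close> are invertible modulo
  \<open>p\<close>, and each correction gains one power of \<open>p\<close>.\<close>

lemma square_root_mod_odd_prime_power:
  fixes p c t :: int
  assumes "prime p" "odd p" "\<not> p dvd c" "p dvd c\<^sup>2 - t"
  shows "\<exists>c'. p dvd c' - c \<and> p ^ n dvd c'\<^sup>2 - t"
proof -
  have "\<exists>c'. p dvd c' - c \<and> p ^ Suc k dvd c'\<^sup>2 - t" for k
  proof (induction k)
    case 0
    then show ?case using assms by (intro exI[of _ c]) auto
  next
    case (Suc k)
    then obtain d where "p dvd d - c" "p ^ Suc k dvd d\<^sup>2 - t" by blast
    then obtain q where d: "p dvd d - c" "d\<^sup>2 - t = p ^ Suc k * q" by (meson dvdE)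
    have "\<not> p dvd 2 * d"
    proof
      assume "p dvd 2 * d"
      then have "p dvd 2 \<or> p dvd d" using assms(1) prime_dvd_mult_iff by blast
      moreover have "\<not> p dvd 2"
        using assms(1,2) by (rule odd_prime_not_dvd_two)
      ultimately have "p dvd d" by simp
      then have "p dvd d - (d - c)" using d(1) by (rule dvd_diff)
      then show False using assms(3) by simp
    qed
    with assms(1) have "coprime p (2 * d)" by (rule prime_imp_coprime)
    then have "coprime (2 * d) p" by (subst coprime_commute)
    then obtain j where "[2 * d * j = 1] (mod p)" using cong_solve_coprime_int by blast
    then have j: "p dvd 2 * d * j - 1" by (simp add: cong_iff_dvd_diff)
    \<comment> \<open>Newton step \<open>d - (d^2 - t) / (2 d)\<close>, with \<open>j\<close> in
      place of the inverse of \<open>2 d\<close>.\<close>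
    define d' where "d' = d - p ^ Suc k * (q * j)"
    have "d'\<^sup>2 - t = p ^ Suc k * (q - 2 * d * j * q + p * (p ^ k * (q * j)\<^sup>2))"
      unfolding d'_def using d(2) by (simp add: power2_eq_square algebra_simps)
    moreover have "p dvd q - 2 * d * j * q + p * (p ^ k * (q * j)\<^sup>2)"
    proof -
      have "p dvd p * (p ^ k * (q * j)\<^sup>2) - (2 * d * j - 1) * q"
        by (rule dvd_diff[OF dvd_triv_left dvd_mult2[OF j]])
      then show ?thesis by (simp add: algebra_simps)
    qed
    ultimately have "p ^ Suc (Suc k) dvd d'\<^sup>2 - t"
      by (simp only: power_Suc2[of p "Suc k"] mult_dvd_mono[OF dvd_refl])
    moreover have "p dvd (d - c) - p * (p ^ k * (q * j))" by (rule dvd_diff[OF d(1)]) simp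
    then have "p dvd d' - c" by (simp add: d'_def algebra_simps)
    ultimately show ?case by blast
  qed
  then obtain c' where "p dvd c' - c" "p ^ Suc n dvd c'\<^sup>2 - t" by blast
  moreover have "p ^ n dvd p ^ Suc n" by simp
  ultimately show ?thesis using dvd_trans by blast
qed

text \<open>The derivative \<open>2 c\<close> costs one factor 2. So the lifting starts at modulus
  8, where every odd square is 1, and \<open>c\<close> is corrected by a multiple of
  \<open>2 ^ (k + 2)\<close> while the modulus is \<open>2 ^ (k + 3)\<close>.\<close>

lemma square_root_mod_power_of_two:
  fixes t :: int
  assumes "8 dvd t - 1"
  shows "\<exists>c. odd c \<and> 2 ^ n dvd c\<^sup>2 - t"
proof -
  have "\<exists>c. odd c \<and> 2 ^ (k + 3) dvd c\<^sup>2 - t" for k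
  proof (induction k)
    case 0
    have "8 dvd 1 - t" using assms by (simp add: dvd_diff_commute)
    then show ?case by (intro exI[of _ 1]) simp
  next
    case (Suc k)
    then obtain c where "odd c" "2 ^ (k + 3) dvd c\<^sup>2 - t" by blast
    then obtain q where c: "odd c" "c\<^sup>2 - t = 2 ^ (k + 3) * q" by (meson dvdE)
    define c' where "c' = c + 2 ^ (k + 2) * q"
    have "c'\<^sup>2 - t = 2 ^ (k + 3) * (q * (c + 1) + 2 * (2 ^ k * q\<^sup>2))"
      unfolding c'_def using c(2)
      by (simp add: power2_eq_square algebra_simps power_add)
    moreover have "2 dvd q * (c + 1) + 2 * (2 ^ k * q\<^sup>2)" using c(1) by simp
    ultimately have "2 ^ (k + 3) * 2 dvd c'\<^sup>2 - t"
      by (metis dvd_refl mult_dvd_mono)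
    moreover have "odd c'" using c(1) by (simp add: c'_def)
    moreover have eq: "(2::int) ^ (Suc k + 3) = 2 ^ (k + 3) * 2"
      by (simp only: add_Suc power_Suc2)
    ultimately show ?case unfolding eq by blast
  qed
  then obtain c where "odd c" "2 ^ (n + 3) dvd c\<^sup>2 - t" by blast
  moreover have "(2::int) ^ n dvd 2 ^ (n + 3)" by (simp add: le_imp_power_dvd)
  ultimately show ?thesis using dvd_trans by blast
qed

text \<open>Pigeonhole: the squares and the values \<open>t - d y^2\<close> each occupy
  \<open>(p + 1) div 2\<close> residues modulo \<open>p\<close>, so the two sets meet.\<close>

lemma norm_form_surj_mod_prime:
  fixes p t d :: int
  assumes "prime p" "odd p" "\<not> p dvd d"
  shows "\<exists>x y. p dvd x\<^sup>2 + d * y\<^sup>2 - t"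
proof -
  define h where "h = (p - 1) div 2"
  have p: "p = 2 * h + 1" "p > 1" using assms(1,2) prime_gt_1_int by (auto simp: h_def)
  have inj: "x = y" if "x \<in> {0..h}" "y \<in> {0..h}" "p dvd x\<^sup>2 - y\<^sup>2" for x y :: int
  proof -
    have "p dvd (x - y) * (x + y)" using that(3) by (simp add: power2_eq_square algebra_simps)
    then have "p dvd x - y \<or> p dvd x + y" using assms(1) prime_dvd_mult_iff by blast
    then show ?thesis
    proof
      assume "p dvd x - y"
      moreover have "\<bar>x - y\<bar> < p" using that p by auto
      ultimately show ?thesis using zdvd_not_zless[of "\<bar>x - y\<bar>" p] by auto
    next
      assume "p dvd x + y"
      moreover have "x + y < p" using that p by auto
      ultimately show ?thesis using that zdvd_not_zless[of "x + y" p] by force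
    qed
  qed
  define f where "f x = x\<^sup>2 mod p" for x
  define g where "g y = (t - d * y\<^sup>2) mod p" for y
  have "inj_on f {0..h}"
    using inj by (intro inj_onI) (auto simp: f_def mod_eq_dvd_iff)
  then have cf: "card (f ` {0..h}) = nat (h + 1)" by (simp add: card_image)
  have "inj_on g {0..h}"
  proof (rule inj_onI)
    fix x y assume xy: "x \<in> {0..h}" "y \<in> {0..h}" "g x = g y"
    then have "p dvd (t - d * y\<^sup>2) - (t - d * x\<^sup>2)" by (metis g_def mod_eq_dvd_iff)
    then have "p dvd d * (x\<^sup>2 - y\<^sup>2)" by (simp add: algebra_simps)
    then have "p dvd x\<^sup>2 - y\<^sup>2" using assms(1,3) prime_dvd_mult_iff by blast
    then show "x = y" using inj xy by blast
  qed
  then have cg: "card (g ` {0..h}) = nat (h + 1)" by (simp add: card_image)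
  have "f ` {0..h} \<inter> g ` {0..h} \<noteq> {}"
  proof
    assume "f ` {0..h} \<inter> g ` {0..h} = {}"
    then have "card (f ` {0..h} \<union> g ` {0..h}) = nat (h + 1) + nat (h + 1)"
      by (subst card_Un_disjoint) (auto simp: cf cg)
    moreover have "f ` {0..h} \<union> g ` {0..h} \<subseteq> {0..<p}" 
      using pos_mod_bound[of p] pos_mod_sign[of p] p(2) by (auto simp: f_def g_def)
    then have "card (f ` {0..h} \<union> g ` {0..h}) \<le> nat p"
      using card_mono[of "{0..<p}"] by fastforce
    ultimately show False using p by simp
  qed
  then obtain x y where "f x = g y" by blast
  then have "p dvd x\<^sup>2 - (t - d * y\<^sup>2)" by (simp add: f_def g_def mod_eq_dvd_iff)
  moreover have "x\<^sup>2 - (t - d * y\<^sup>2) = x\<^sup>2 + d * y\<^sup>2 - t" by simp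
  ultimately show ?thesis by metis
qed

text \<open>Once \<open>x\<close> is a unit, a solution modulo \<open>p\<close> is lifted by
  adjusting \<open>x\<close> alone. For \<open>d = 2\<close> the prime 3 is left out: modulo 3,
  \<open>x^2 + 2 y^2 = 2\<close> forces \<open>x = 0\<close>.\<close>

lemma norm_form_unit_mod_prime_power:
  fixes p t d :: int
  assumes p: "prime p" "odd p" and d: "d = 1 \<or> d = 2 \<and> p \<noteq> 3" and t: "\<not> p dvd t"
  shows "\<exists>x y. \<not> p dvd x \<and> \<not> p\<^sup>2 dvd y \<and> p ^ n dvd x\<^sup>2 + d * y\<^sup>2 - t"
proof -
  have np: "\<not> p dvd 2" using p by (rule odd_prime_not_dvd_two)
  have p1: "p > 1" using p(1) prime_gt_1_int by blast
  have pd: "\<not> p dvd d" using d np p1 by (auto simp: zdvd_not_zless)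
  obtain x0 y0 where xy: "p dvd x0\<^sup>2 + d * y0\<^sup>2 - t"
    using norm_form_surj_mod_prime[OF p pd] by blast
  have "\<exists>x y. \<not> p dvd x \<and> p dvd x\<^sup>2 + d * y\<^sup>2 - t"
  proof (cases "p dvd x0")
    case False
    then show ?thesis using xy by blast
  next
    case True
    then have px: "p dvd x0\<^sup>2" unfolding power2_eq_square by (rule dvd_mult2)
    have ny: "\<not> p dvd y0"
    proof
      assume "p dvd y0"
      then have "p dvd x0\<^sup>2 + d * y0\<^sup>2" using px by (simp add: power2_eq_square)
      then have "p dvd (x0\<^sup>2 + d * y0\<^sup>2) - (x0\<^sup>2 + d * y0\<^sup>2 - t)" using xy by (rule dvd_diff)
      then show False using t by simp
    qed
    show ?thesis
    proof (cases "d = 1")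
      case True
      then show ?thesis using ny xy by (intro exI[of _ y0] exI[of _ x0]) (simp add: add.commute)
    next
      case False
      then have d2: "d = 2" "p \<noteq> 3" using d by auto
      have "\<not> p dvd 3"
      proof
        assume "p dvd 3"
        moreover have "prime (3 :: int)" by simp
        ultimately show False using p(1) d2(2) primes_dvd_imp_eq by blast
      qed
      then have "coprime 3 p" using p(1) by (simp add: coprime_commute prime_imp_coprime)
      then obtain j where "[3 * j = 1] (mod p)" using cong_solve_coprime_int by blast
      then have j: "p dvd 3 * j - 1" by (simp add: cong_iff_dvd_diff)
      have nj: "\<not> p dvd j"
      proof
        assume "p dvd j"
        then have "p dvd 3 * j" by simp
        then have "p dvd 3 * j - (3 * j - 1)" using j by (rule dvd_diff)
        then show False using p1 by (simp add: zdvd_not_zless)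
      qed
      \<comment> \<open>The point \<open>(0, y0)\<close> is replaced by
        \<open>(4 j y0, j y0)\<close>: since \<open>4^2 + 2 = 2 * 3^2\<close> and \<open>j\<close>
        inverts 3, its value is again \<open>2 y0^2\<close>, now with a unit as first
        coordinate.\<close>
      have "\<not> p dvd 2 * (2 * (j * y0))"
        using np nj ny by (simp only: prime_dvd_mult_iff[OF p(1)]) blast
      moreover have "p dvd (x0\<^sup>2 + d * y0\<^sup>2 - t) + (3 * j - 1) * (2 * (3 * j + 1) * y0\<^sup>2) - x0\<^sup>2"
        by (rule dvd_diff[OF dvd_add[OF xy dvd_mult2[OF j]] px])
      then have "p dvd (2 * (2 * (j * y0)))\<^sup>2 + d * (j * y0)\<^sup>2 - t"
        unfolding d2 by (simp add: power2_eq_square algebra_simps)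
      ultimately show ?thesis by blast
    qed
  qed
  then obtain x y where xy: "\<not> p dvd x" "p dvd x\<^sup>2 + d * y\<^sup>2 - t" by blast
  \<comment> \<open>Putting \<open>p\<close> for a \<open>y\<close> divisible by \<open>p\<close>
    keeps the class modulo \<open>p\<close> and avoids divisibility by \<open>p^2\<close>.\<close>
  define z where "z = (if p dvd y then p else y)"
  have pz: "p dvd y - z" by (simp add: z_def)
  have "p dvd (y - z) * (y + z)" using pz by (rule dvd_mult2)
  then have pz2: "p dvd y\<^sup>2 - z\<^sup>2" by (simp add: power2_eq_square algebra_simps)
  have "\<not> p\<^sup>2 dvd z"
  proof
    assume a: "p\<^sup>2 dvd z"
    then have "p dvd z" unfolding power2_eq_square by (rule dvd_mult_left)
    then have "z = p" by (auto simp: z_def split: if_splits)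
    then have "p * p \<le> p" using a p1 by (auto simp: power2_eq_square dest: zdvd_imp_le)
    then show False using p1 by simp
  qed
  moreover have "p dvd x\<^sup>2 - (t - d * z\<^sup>2)"
  proof -
    have "p dvd (x\<^sup>2 + d * y\<^sup>2 - t) - d * (y\<^sup>2 - z\<^sup>2)"
      by (rule dvd_diff[OF xy(2) dvd_mult[OF pz2]])
    then show ?thesis by (simp add: algebra_simps)
  qed
  then obtain x' where x': "p dvd x' - x" "p ^ n dvd x'\<^sup>2 - (t - d * z\<^sup>2)"
    using square_root_mod_odd_prime_power[OF p xy(1)] by blast
  moreover have "\<not> p dvd x'"
  proof
    assume "p dvd x'"
    then have "p dvd x' - (x' - x)" using x'(1) by (rule dvd_diff)
    then show False using xy(1) by simp
  qed
  ultimately show ?thesis by (auto simp: algebra_simps)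
qed

subsection \<open>Descent\<close>

text \<open>Isotropy of the ternary Hermitian form with diagonal \<open>1, - A, - B\<close> over
  Z[sqrt(-d)], in integer coordinates.\<close>

definition hermitian_isotropic :: "int \<Rightarrow> int \<Rightarrow> int \<Rightarrow> bool" where
  "hermitian_isotropic d A B \<longleftrightarrow> (\<exists>x1 x2 y1 y2 z1 z2. (x1, x2, y1, y2, z1, z2) \<noteq> (0, 0, 0, 0, 0, 0) \<and>
     x1\<^sup>2 + d * x2\<^sup>2 = A * (z1\<^sup>2 + d * z2\<^sup>2) + B * (y1\<^sup>2 + d * y2\<^sup>2))"

lemma hermitian_isotropicI:
  assumes "(x1, x2, y1, y2, z1, z2) \<noteq> (0, 0, 0, 0, 0, 0)"
    and "x1\<^sup>2 + d * x2\<^sup>2 = A * (z1\<^sup>2 + d * z2\<^sup>2) + B * (y1\<^sup>2 + d * y2\<^sup>2)"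
  shows "hermitian_isotropic d A B"
  using assms unfolding hermitian_isotropic_def by blast

lemma hermitian_isotropic_commute: "hermitian_isotropic d A B \<longleftrightarrow> hermitian_isotropic d B A"
proof -
  have "hermitian_isotropic d B A" if "hermitian_isotropic d A B" for A B
  proof -
    from that obtain x1 x2 y1 y2 z1 z2 where
      "(x1, x2, y1, y2, z1, z2) \<noteq> (0, 0, 0, 0, 0, 0)"
      "x1\<^sup>2 + d * x2\<^sup>2 = A * (z1\<^sup>2 + d * z2\<^sup>2) + B * (y1\<^sup>2 + d * y2\<^sup>2)"
      unfolding hermitian_isotropic_def by blast
    then show ?thesis by (intro hermitian_isotropicI[of x1 x2 z1 z2 y1 y2]) auto
  qed
  then show ?thesis by blast
qed

text \<open>Scaling \<open>x\<close> and \<open>y\<close> by \<open>k\<close>, but not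
  \<open>z\<close>, absorbs the square; this reduces the descent to square-free
  \<open>A\<close>.\<close>

lemma hermitian_isotropic_square_mult:
  assumes "hermitian_isotropic d A B" and "k \<noteq> 0"
  shows "hermitian_isotropic d (k\<^sup>2 * A) B"
proof -
  from assms(1) obtain x1 x2 y1 y2 z1 z2 where *:
    "(x1, x2, y1, y2, z1, z2) \<noteq> (0, 0, 0, 0, 0, 0)"
    "x1\<^sup>2 + d * x2\<^sup>2 = A * (z1\<^sup>2 + d * z2\<^sup>2) + B * (y1\<^sup>2 + d * y2\<^sup>2)"
    unfolding hermitian_isotropic_def by blast
  have "(k * x1)\<^sup>2 + d * (k * x2)\<^sup>2 = k\<^sup>2 * (x1\<^sup>2 + d * x2\<^sup>2)"
    by (simp add: power_mult_distrib algebra_simps)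
  also have "\<dots> = k\<^sup>2 * A * (z1\<^sup>2 + d * z2\<^sup>2) + B * ((k * y1)\<^sup>2 + d * (k * y2)\<^sup>2)"
    by (simp add: *(2) power_mult_distrib algebra_simps)
  finally show ?thesis
    using * assms(2) by (intro hermitian_isotropicI[of "k * x1" "k * x2" "k * y1" "k * y2" z1 z2]) auto
qed

lemma squarefree_dvdI:
  fixes n v :: int
  assumes "squarefree n" and "\<And>p. prime p \<Longrightarrow> p dvd n \<Longrightarrow> p dvd v"
  shows "n dvd v"
proof (cases "v = 0")
  case False
  have "n \<noteq> 0" using assms(1) by auto
  then show ?thesis
  proof (rule multiplicity_le_imp_dvd)
    fix p :: int assume p: "prime p"
    show "multiplicity p n \<le> multiplicity p v"
    proof (cases "p dvd n")
      case True
      have "multiplicity p n \<le> 1"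
        using assms(1) p squarefree_factorial_semiring'[of n] \<open>n \<noteq> 0\<close>
        by (metis True in_prime_factors_iff order_refl)
      also have "\<dots> \<le> multiplicity p v"
        using assms(2)[OF p True] p False
        by (metis One_nat_def Suc_leI prime_multiplicity_gt_zero_iff prime_imp_prime_elem)
      finally show ?thesis .
    qed (simp add: not_dvd_imp_multiplicity_0)
  qed
qed auto

lemma balanced_residue:
  fixes c n :: int
  assumes "n \<noteq> 0"
  obtains c' where "n dvd c' - c" "2 * \<bar>c'\<bar> \<le> \<bar>n\<bar>"
proof -
  define h where "h = \<bar>n\<bar> div 2"
  define r where "r = (c + h) mod \<bar>n\<bar>"
  have "\<bar>n\<bar> dvd r - (c + h)" unfolding r_def using mod_eq_dvd_iff mod_mod_trivial by blast
  then have "n dvd (r - h) - c" by (simp add: algebra_simps)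
  moreover have "0 \<le> r" "r < \<bar>n\<bar>" using assms by (auto simp: r_def)
  then have "2 * \<bar>r - h\<bar> \<le> \<bar>n\<bar>" unfolding h_def by presburger
  ultimately show ?thesis using that by blast
qed

lemma norm_form_surj_mod_squarefree:
  fixes n t d :: int
  assumes "squarefree n" and "d = 1 \<or> d = 2"
  shows "\<exists>x y. n dvd x\<^sup>2 + d * y\<^sup>2 - t"
proof -
  have n0: "n \<noteq> 0" using assms(1) by auto
  have "\<exists>x y. p dvd x\<^sup>2 + d * y\<^sup>2 - t" if "prime p" for p
  proof (cases "odd p")
    case True
    have "p > 1" using that by (rule prime_gt_1_int)
    then have "\<not> p dvd d" using assms(2) odd_prime_not_dvd_two[OF that True]
      by (auto simp: zdvd_not_zless)
    then show ?thesis using norm_form_surj_mod_prime[OF that True] by blast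
  next
    case False
    then have "p = 2" using that primes_dvd_imp_eq[of 2 p] by simp
    then show ?thesis by (intro exI[of _ t] exI[of _ 0]) auto
  qed
  then obtain f g where fg: "\<And>p. prime p \<Longrightarrow> p dvd (f p)\<^sup>2 + d * (g p)\<^sup>2 - t" by metis
  define P where "P = prime_factors n"
  have P: "finite P" "\<And>p. p \<in> P \<Longrightarrow> prime p" by (auto simp: P_def)
  obtain x where x: "\<forall>p\<in>P. p ^ 1 dvd x - f p"
    using chinese_remainder_primes[OF P, of "\<lambda>_. 1"] by blast
  obtain y where y: "\<forall>p\<in>P. p ^ 1 dvd y - g p"
    using chinese_remainder_primes[OF P, of "\<lambda>_. 1"] by blast
  have "n dvd x\<^sup>2 + d * y\<^sup>2 - t"
  proof (rule squarefree_dvdI[OF assms(1)])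
    fix p assume p: "prime p" "p dvd n"
    then have "p \<in> P" using n0 by (simp add: P_def in_prime_factors_iff)
    with x y have "p dvd x - f p" "p dvd y - g p" by auto
    then have "p dvd (x - f p) * (x + f p) + d * ((y - g p) * (y + g p)) + ((f p)\<^sup>2 + d * (g p)\<^sup>2 - t)"
      using fg[OF p(1)] by (intro dvd_add) auto
    then show "p dvd x\<^sup>2 + d * y\<^sup>2 - t" by (simp add: power2_eq_square algebra_simps)
  qed
  then show ?thesis by blast
qed

text \<open>A value below \<open>n^2\<close> makes the cofactor in the descent smaller than
  \<open>n\<close> in absolute value. Balanced residues give
  \<open>x^2 + d y^2 \<le> 3 n^2 / 4\<close>, and \<open>|t| \<le> |n| < n^2 / 4\<close> once
  \<open>|n| > 4\<close>; 4 is not square-free, and 2 and 3 are treated separately.\<close>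

lemma norm_form_small_residue:
  fixes n t d :: int
  assumes n: "squarefree n" "\<bar>n\<bar> \<noteq> 1" and d: "d = 1 \<or> d = 2" and t: "\<bar>t\<bar> \<le> \<bar>n\<bar>"
  obtains x y where "n dvd x\<^sup>2 + d * y\<^sup>2 - t" "\<bar>x\<^sup>2 + d * y\<^sup>2 - t\<bar> < n\<^sup>2"
proof -
  have n0: "n \<noteq> 0" using n by auto
  obtain x0 y0 where xy0: "n dvd x0\<^sup>2 + d * y0\<^sup>2 - t"
    using norm_form_surj_mod_squarefree[OF n(1) d] by blast
  obtain x where x: "n dvd x - x0" "2 * \<bar>x\<bar> \<le> \<bar>n\<bar>" using balanced_residue[OF n0] by blast
  obtain y where y: "n dvd y - y0" "2 * \<bar>y\<bar> \<le> \<bar>n\<bar>" using balanced_residue[OF n0] by blast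
  have "n dvd (x - x0) * (x + x0) + d * ((y - y0) * (y + y0)) + (x0\<^sup>2 + d * y0\<^sup>2 - t)"
    using x y xy0 by (intro dvd_add) auto
  then have dv: "n dvd x\<^sup>2 + d * y\<^sup>2 - t" by (simp add: power2_eq_square algebra_simps)
  consider "\<bar>n\<bar> = 2" | "\<bar>n\<bar> = 3" | "\<bar>n\<bar> = 4" | "\<bar>n\<bar> > 4" using n0 n(2) by linarith
  then show ?thesis
  proof cases
    case 1
    define r where "r = t mod 2"
    have r: "r = 0 \<or> r = 1" by (auto simp: r_def)
    have "2 dvd r - t" by (simp add: r_def)
    then have "2 dvd r\<^sup>2 + d * 0\<^sup>2 - t" using r by auto
    then have "n dvd r\<^sup>2 + d * 0\<^sup>2 - t" using 1 by (metis abs_dvd_iff)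
    moreover have "n\<^sup>2 = 4" using 1 power2_abs[of n] by simp
    then have "\<bar>r\<^sup>2 + d * 0\<^sup>2 - t\<bar> < n\<^sup>2" using r t 1 by auto
    ultimately show ?thesis using that by blast
  next
    case 2
    then have "\<bar>x\<bar> \<le> 1" "\<bar>y\<bar> \<le> 1" using x y by auto
    then have "x\<^sup>2 \<le> 1" "y\<^sup>2 \<le> 1" by (auto simp: abs_square_le_1)
    moreover have "n\<^sup>2 = 9" using 2 power2_abs[of n] by simp
    moreover have "0 \<le> x\<^sup>2" "0 \<le> d * y\<^sup>2" "d * y\<^sup>2 \<le> 2 * y\<^sup>2" using d by auto
    ultimately have "\<bar>x\<^sup>2 + d * y\<^sup>2 - t\<bar> < n\<^sup>2" using t 2 by linarith
    then show ?thesis using that dv by blast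
  next
    case 3
    then have "n = 4 \<or> n = - 4" by linarith
    then have "2\<^sup>2 dvd n" by auto
    then show ?thesis using squarefreeD[OF n(1), of 2] by simp
  next
    case 4
    have "(2 * \<bar>x\<bar>)\<^sup>2 \<le> \<bar>n\<bar>\<^sup>2" "(2 * \<bar>y\<bar>)\<^sup>2 \<le> \<bar>n\<bar>\<^sup>2" using x y by (intro power_mono; simp)+
    then have "4 * x\<^sup>2 \<le> n\<^sup>2" "4 * y\<^sup>2 \<le> n\<^sup>2" by (auto simp: power_mult_distrib)
    moreover have "4 * \<bar>n\<bar> < n\<^sup>2" 
      using mult_strict_right_mono[OF 4, of "\<bar>n\<bar>"] n0 power2_abs[of n] by (simp add: power2_eq_square)
    moreover have "0 \<le> x\<^sup>2" "0 \<le> d * y\<^sup>2" "d * y\<^sup>2 \<le> 2 * y\<^sup>2" using d by auto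
    ultimately have "\<bar>x\<^sup>2 + d * y\<^sup>2 - t\<bar> < n\<^sup>2" using t by linarith
    then show ?thesis using that dv by blast
  qed
qed

text \<open>Legendre's descent. Over the norm form of \<open>\<int>[\<surd>-d]\<close> every unit is a norm residue, so no
  congruence conditions on the coefficients appear.\<close>

lemma hermitian_isotropic_if_not_negative:
  fixes A B d :: int
  assumes d: "d = 1 \<or> d = 2" and "A \<noteq> 0" "B \<noteq> 0" "\<not> (A < 0 \<and> B < 0)"
  shows "hermitian_isotropic d A B"
  using assms(2-)
proof (induction "nat (\<bar>A\<bar> + \<bar>B\<bar>)" arbitrary: A B rule: less_induct)
  case less
  \<comment> \<open>The coefficient of larger absolute value is reduced. The induction hypothesis is
    stated for the first coefficient only, so that \<open>main\<close> serves both orders.\<close>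
  have main: "hermitian_isotropic d A B"
    if le: "\<bar>B\<bar> \<le> \<bar>A\<bar>" and AB: "A \<noteq> 0" "B \<noteq> 0" "\<not> (A < 0 \<and> B < 0)"
      and IH: "\<And>A'. \<bar>A'\<bar> < \<bar>A\<bar> \<Longrightarrow> A' \<noteq> 0 \<Longrightarrow> \<not> (A' < 0 \<and> B < 0) \<Longrightarrow> hermitian_isotropic d A' B"
    for A B
  proof (cases "squarefree A")
    case False
    then obtain k where k: "k\<^sup>2 dvd A" "\<not> k dvd 1" unfolding squarefree_def by blast
    then obtain A' where A': "A = k\<^sup>2 * A'" by blast
    have "k \<noteq> 0" "A' \<noteq> 0" using A' AB by auto
    moreover have "\<bar>k\<bar> > 1" using k(2) \<open>k \<noteq> 0\<close> by (auto simp: zdvd1_eq)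
    then have "1 < k\<^sup>2" using one_less_power[of "\<bar>k\<bar>" 2] by simp
    then have "\<bar>A'\<bar> < \<bar>A\<bar>" using \<open>A' \<noteq> 0\<close> by (simp add: A' abs_mult)
    moreover have "\<not> (A' < 0 \<and> B < 0)" using AB(3) A' \<open>k \<noteq> 0\<close> by (auto simp: mult_pos_neg)
    ultimately show ?thesis using IH[of A'] hermitian_isotropic_square_mult[of d A' B k] A' by simp
  next
    case True
    show ?thesis
    proof (cases "\<bar>A\<bar> = 1")
      case A1: True
      then have "A = 1 \<or> B = 1" using le AB by linarith
      then show ?thesis
      proof
        assume "A = 1"
        then show ?thesis by (intro hermitian_isotropicI[of 1 0 0 0 1 0]) auto
      next
        assume "B = 1"
        then show ?thesis by (intro hermitian_isotropicI[of 1 0 1 0 0 0]) auto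
      qed
    next
      case A1: False
      obtain c1 c2 where c: "A dvd c1\<^sup>2 + d * c2\<^sup>2 - B" "\<bar>c1\<^sup>2 + d * c2\<^sup>2 - B\<bar> < A\<^sup>2"
        using norm_form_small_residue[OF True A1 d le] by blast
      then obtain A' where A': "c1\<^sup>2 + d * c2\<^sup>2 - B = A * A'" by blast
      show ?thesis
      proof (cases "A' = 0")
        case True
        then show ?thesis using A' by (intro hermitian_isotropicI[of c1 c2 1 0 0 0]) auto
      next
        case False
        have "\<bar>A\<bar> * \<bar>A'\<bar> < \<bar>A\<bar> * \<bar>A\<bar>"
          using c(2) A' by (simp add: abs_mult power2_eq_square)
        then have lt: "\<bar>A'\<bar> < \<bar>A\<bar>" 
          using mult_less_cancel_left_pos[of "\<bar>A\<bar>" "\<bar>A'\<bar>" "\<bar>A\<bar>"] AB by linarith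
        \<comment> \<open>Indefiniteness is inherited: if \<open>B < 0\<close>, then
          \<open>A > 0\<close> or \<open>A' > 0\<close> cannot hold alone, because
          \<open>A A' = N(c) - B\<close> is positive.\<close>
        have "\<not> (A' < 0 \<and> B < 0)"
        proof
          assume neg: "A' < 0 \<and> B < 0"
          then have "A > 0" using AB by linarith
          then have "A * A' < 0" using neg by (simp add: mult_pos_neg)
          moreover have "c1\<^sup>2 + d * c2\<^sup>2 \<ge> 0" using d by auto
          ultimately show False using A' neg by linarith
        qed
        then obtain x1 x2 y1 y2 z1 z2 where sol: "(x1, x2, y1, y2, z1, z2) \<noteq> (0, 0, 0, 0, 0, 0)"
          "x1\<^sup>2 + d * x2\<^sup>2 = A' * (z1\<^sup>2 + d * z2\<^sup>2) + B * (y1\<^sup>2 + d * y2\<^sup>2)"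
          using IH[OF lt False] unfolding hermitian_isotropic_def by blast
        show ?thesis
        proof (cases "z1 = 0 \<and> z2 = 0")
          case True
          then show ?thesis using sol by (intro hermitian_isotropicI[of x1 x2 y1 y2 0 0]) auto
        next
          case z: False
          \<comment> \<open>\<open>N(x) - B N(y)\<close> is a quaternion norm, hence multiplicative.
            Multiplying \<open>(x, y)\<close> by \<open>(c, 1)\<close> turns the solution for
            \<open>A'\<close> into one for \<open>A\<close>, since the value becomes
            \<open>A' N(z) * A A' = A N(A' z)\<close>.\<close>
          have "(x1 * c1 - d * x2 * c2 + B * y1)\<^sup>2 + d * (x1 * c2 + x2 * c1 + B * y2)\<^sup>2
              - B * ((x1 + y1 * c1 + d * y2 * c2)\<^sup>2 + d * (x2 + y2 * c1 - y1 * c2)\<^sup>2)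
              = (x1\<^sup>2 + d * x2\<^sup>2 - B * (y1\<^sup>2 + d * y2\<^sup>2)) * (c1\<^sup>2 + d * c2\<^sup>2 - B)"
            by Groebner_Basis.algebra
          also have "\<dots> = A * ((A' * z1)\<^sup>2 + d * (A' * z2)\<^sup>2)"
            unfolding A' sol(2) by Groebner_Basis.algebra
          finally show ?thesis
            using z False by (intro hermitian_isotropicI[of "x1 * c1 - d * x2 * c2 + B * y1"
              "x1 * c2 + x2 * c1 + B * y2" "x1 + y1 * c1 + d * y2 * c2" "x2 + y2 * c1 - y1 * c2"
              "A' * z1" "A' * z2"]) auto
        qed
      qed
    qed
  qed
  show ?case
  proof (cases "\<bar>B\<bar> \<le> \<bar>A\<bar>")
    case True
    show ?thesis
      by (rule main[OF True less.prems]) (use less in auto)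
  next
    case False
    have "hermitian_isotropic d B A"
    proof (rule main)
      show "hermitian_isotropic d A' A"
        if "\<bar>A'\<bar> < \<bar>B\<bar>" "A' \<noteq> 0" "\<not> (A' < 0 \<and> A < 0)" for A'
        using less.hyps[of A' A] that less.prems by auto
    qed (use False less.prems in auto)
    then show ?thesis by (simp add: hermitian_isotropic_commute)
  qed
qed

text \<open>Multiplying an isotropic vector by the conjugate of \<open>z\<close> turns the factor
  \<open>N(z)\<close> of \<open>b\<close> into the square of \<open>m = N(z)\<close>. It is nonzero
  because the norms on the other side have positive coefficients.\<close>

lemma norm_form_times_square:
  fixes a b d :: int
  assumes d: "d = 1 \<or> d = 2" and "a > 0" "b > 0"
  obtains m x1 x2 y1 y2 where "m > 0" "b * m\<^sup>2 = x1\<^sup>2 + d * x2\<^sup>2 + a * (y1\<^sup>2 + d * y2\<^sup>2)"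
proof -
  have "hermitian_isotropic d b (- a)"
    using hermitian_isotropic_if_not_negative[OF d, of b "- a"] assms by simp
  then obtain x1 x2 y1 y2 z1 z2 where sol: "(x1, x2, y1, y2, z1, z2) \<noteq> (0, 0, 0, 0, 0, 0)"
    "x1\<^sup>2 + d * x2\<^sup>2 = b * (z1\<^sup>2 + d * z2\<^sup>2) + - a * (y1\<^sup>2 + d * y2\<^sup>2)"
    unfolding hermitian_isotropic_def by blast
  define m where "m = z1\<^sup>2 + d * z2\<^sup>2"
  have nonneg: "u\<^sup>2 + d * v\<^sup>2 \<ge> 0" for u v using d by auto
  have zero: "u = 0 \<and> v = 0" if "u\<^sup>2 + d * v\<^sup>2 \<le> 0" for u v
  proof -
    have "u\<^sup>2 \<ge> 0" "v\<^sup>2 \<ge> 0" "v\<^sup>2 \<le> d * v\<^sup>2" using d by auto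
    then have "u\<^sup>2 = 0" "v\<^sup>2 = 0" using that by linarith+
    then show ?thesis by simp
  qed
  have "m \<noteq> 0"
  proof
    assume "m = 0"
    then have "z1 = 0 \<and> z2 = 0" using zero[of z1 z2] by (simp add: m_def)
    moreover have "x1\<^sup>2 + d * x2\<^sup>2 = b * m - a * (y1\<^sup>2 + d * y2\<^sup>2)"
      using sol(2) by (simp add: m_def)
    then have "x1\<^sup>2 + d * x2\<^sup>2 = - (a * (y1\<^sup>2 + d * y2\<^sup>2))" using \<open>m = 0\<close> by simp
    moreover have "a * (y1\<^sup>2 + d * y2\<^sup>2) \<ge> 0" using assms nonneg by simp
    ultimately have "x1 = 0 \<and> x2 = 0" "a * (y1\<^sup>2 + d * y2\<^sup>2) = 0"
      using zero[of x1 x2] nonneg[of x1 x2] by linarith+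
    then have "y1 = 0 \<and> y2 = 0" using zero[of y1 y2] assms by auto
    with \<open>z1 = 0 \<and> z2 = 0\<close> \<open>x1 = 0 \<and> x2 = 0\<close> sol(1) show False by simp
  qed
  then have "m > 0" using nonneg[of z1 z2] by (simp add: m_def)
  moreover have "b * m\<^sup>2 = (x1 * z1 + d * x2 * z2)\<^sup>2 + d * (x2 * z1 - x1 * z2)\<^sup>2
      + a * ((y1 * z1 + d * y2 * z2)\<^sup>2 + d * (y2 * z1 - y1 * z2)\<^sup>2)"
  proof -
    have "b * m = x1\<^sup>2 + d * x2\<^sup>2 + a * (y1\<^sup>2 + d * y2\<^sup>2)" using sol(2) by (simp add: m_def)
    then have "b * m\<^sup>2 = (x1\<^sup>2 + d * x2\<^sup>2 + a * (y1\<^sup>2 + d * y2\<^sup>2)) * (z1\<^sup>2 + d * z2\<^sup>2)"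
      by (simp add: power2_eq_square m_def)
    then show ?thesis by Groebner_Basis.algebra
  qed
  ultimately show ?thesis using that by blast
qed

subsection \<open>Reflection\<close>

lemma prime_power_dvd_mult_unit:
  fixes p u v :: int
  assumes "prime p" "\<not> p dvd u"
  shows "p ^ n dvd u * v \<longleftrightarrow> p ^ n dvd v"
proof -
  from assms have "coprime p u" by (rule prime_imp_coprime)
  then have "coprime (p ^ n) u" by simp
  then show ?thesis by (rule coprime_dvd_mult_right_iff)
qed

lemma primitive_part5:
  fixes v1 v2 v3 v4 v5 :: int
  assumes "v1 \<noteq> 0"
  obtains g w1 w2 w3 w4 w5 where "g \<noteq> 0"
    "v1 = g * w1" "v2 = g * w2" "v3 = g * w3" "v4 = g * w4" "v5 = g * w5"
    "\<And>p. prime p \<Longrightarrow> \<not> (p dvd w1 \<and> p dvd w2 \<and> p dvd w3 \<and> p dvd w4 \<and> p dvd w5)"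
proof -
  define g where "g = gcd v1 (gcd v2 (gcd v3 (gcd v4 v5)))"
  have g0: "g \<noteq> 0" using assms by (simp add: g_def)
  have "g dvd v1" "g dvd v2" "g dvd v3" "g dvd v4" "g dvd v5"
    unfolding g_def by (meson dvd_trans gcd_dvd1 gcd_dvd2)+
  then obtain w1 w2 w3 w4 w5 where w: "v1 = g * w1" "v2 = g * w2" "v3 = g * w3" "v4 = g * w4" "v5 = g * w5"
    by (meson dvdE)
  have "\<not> (p dvd w1 \<and> p dvd w2 \<and> p dvd w3 \<and> p dvd w4 \<and> p dvd w5)" if "prime p" for p
  proof
    assume "p dvd w1 \<and> p dvd w2 \<and> p dvd w3 \<and> p dvd w4 \<and> p dvd w5"
    then have "g * p dvd v1" "g * p dvd v2" "g * p dvd v3" "g * p dvd v4" "g * p dvd v5"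
      by (auto simp: w)
    then have "g * p dvd gcd v1 (gcd v2 (gcd v3 (gcd v4 v5)))" by (intro gcd_greatest)
    then have "g * p dvd g * 1" by (simp add: g_def[symmetric])
    then have "p dvd 1" using g0 by (metis dvd_mult_cancel_left)
    then show False using that not_prime_unit by blast
  qed
  with g0 w show ?thesis using that by blast
qed

text \<open>A \<open>p\<close>-adically approximate solution with first coordinate \<open>1\<close>, of enough precision that the
  reflection of any primitive solution along it (or along a sign change of it) is controlled at \<open>p\<close>.\<close>

definition approximable :: "int \<Rightarrow> int \<Rightarrow> int \<Rightarrow> int \<Rightarrow> bool" where
  "approximable d a b p \<longleftrightarrow> (\<exists>n x1 x2 y1 y2. p ^ n dvd b - (x1\<^sup>2 + d * x2\<^sup>2) - a * (y1\<^sup>2 + d * y2\<^sup>2) \<and>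
     \<not> p dvd x1 \<and> \<not> p ^ n dvd 4 * b \<and> \<not> p ^ n dvd 4 * x1 \<and> \<not> p ^ n dvd 4 * d * x2 \<and>
     \<not> p ^ n dvd 4 * a * y1 \<and> \<not> p ^ n dvd 4 * d * a * y2)"

text \<open>If every choice of signs failed, sums and differences of the bilinear values would show
  that \<open>p ^ n\<close> divides \<open>m * (4 * b)\<close>, \<open>x1 * (4 * c1)\<close> and so
  on. By the nondivisibility conditions in \<open>approximable\<close>, \<open>p\<close> would then
  divide all five coordinates, against primitivity.\<close>

lemma approximable_signs:
  fixes d a b p m x1 x2 y1 y2 :: int
  assumes "prime p" and "approximable d a b p"
    and prim: "\<not> (p dvd m \<and> p dvd x1 \<and> p dvd x2 \<and> p dvd y1 \<and> p dvd y2)"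
  shows "\<exists>n c1 c2 e1 e2. p ^ n dvd b - (c1\<^sup>2 + d * c2\<^sup>2) - a * (e1\<^sup>2 + d * e2\<^sup>2) \<and> \<not> p dvd c1 \<and>
     \<not> p ^ n dvd 2 * (b * m - x1 * c1 - d * x2 * c2 - a * y1 * e1 - d * a * y2 * e2)"
proof -
  obtain n c1 c2 e1 e2 where c: "p ^ n dvd b - (c1\<^sup>2 + d * c2\<^sup>2) - a * (e1\<^sup>2 + d * e2\<^sup>2)" "\<not> p dvd c1"
    and nd: "\<not> p ^ n dvd 4 * b" "\<not> p ^ n dvd 4 * c1" "\<not> p ^ n dvd 4 * d * c2"
      "\<not> p ^ n dvd 4 * a * e1" "\<not> p ^ n dvd 4 * d * a * e2"
    using assms(2) unfolding approximable_def by blast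
  define B where "B s1 s2 s3 s4 = 2 * (b * m - x1 * (s1 * c1) - d * x2 * (s2 * c2)
      - a * y1 * (s3 * e1) - d * a * y2 * (s4 * e2))" for s1 s2 s3 s4
  have B: "B 1 1 1 1 + B (-1) (-1) (-1) (-1) = m * (4 * b)"
    "B (-1) 1 1 1 - B 1 1 1 1 = x1 * (4 * c1)" "B 1 (-1) 1 1 - B 1 1 1 1 = x2 * (4 * d * c2)"
    "B 1 1 (-1) 1 - B 1 1 1 1 = y1 * (4 * a * e1)" "B 1 1 1 (-1) - B 1 1 1 1 = y2 * (4 * d * a * e2)"
    unfolding B_def by Groebner_Basis.algebra+
  have "\<exists>s1 s2 s3 s4. {s1, s2, s3, s4} \<subseteq> {1, -1} \<and> \<not> p ^ n dvd B s1 s2 s3 s4"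
  proof (rule ccontr)
    assume "\<nexists>s1 s2 s3 s4. {s1, s2, s3, s4} \<subseteq> {1, -1} \<and> \<not> p ^ n dvd B s1 s2 s3 s4"
    then have all: "p ^ n dvd B s1 s2 s3 s4" if "{s1, s2, s3, s4} \<subseteq> {1, -1}" for s1 s2 s3 s4
      using that by blast
    have "p ^ n dvd m * (4 * b)" "p ^ n dvd x1 * (4 * c1)" "p ^ n dvd x2 * (4 * d * c2)"
      "p ^ n dvd y1 * (4 * a * e1)" "p ^ n dvd y2 * (4 * d * a * e2)"
      unfolding B[symmetric] by (intro dvd_add dvd_diff all; simp)+
    then have "p dvd m" "p dvd x1" "p dvd x2" "p dvd y1" "p dvd y2"
      using nd prime_power_dvd_mult_unit[OF assms(1)] by blast+
    then show False using prim by simp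
  qed
  then obtain s1 s2 s3 s4 where s: "{s1, s2, s3, s4} \<subseteq> {1, -1}" "\<not> p ^ n dvd B s1 s2 s3 s4" by blast
  then have "s1\<^sup>2 = 1" "s2\<^sup>2 = 1" "s3\<^sup>2 = 1" "s4\<^sup>2 = 1" "\<not> p dvd s1 * c1"
    using c(2) by (auto split: if_splits)
  with c s show ?thesis
    by (intro exI[of _ n] exI[of _ "s1 * c1"] exI[of _ "s2 * c2"] exI[of _ "s3 * e1"] exI[of _ "s4 * e2"])
      (simp add: power_mult_distrib B_def)
qed

text \<open>A primitive solution is reflected, with respect to the form
  \<open>b m^2 - N(X) - a N(Y)\<close>, along a vector \<open>(1, c1, c2, e1, e2)\<close> glued from
  the local approximations by the Chinese remainder theorem. The form is so small there at each
  \<open>p\<close> in \<open>P\<close> that the image, freed of common powers of \<open>p\<close>,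
  is a unit multiple of this vector modulo \<open>p\<close>; its first two entries are
  units.\<close>

lemma norm_form_times_square_coprime:
  fixes a b d m x1 x2 y1 y2 :: int
  assumes sol: "b * m\<^sup>2 = x1\<^sup>2 + d * x2\<^sup>2 + a * (y1\<^sup>2 + d * y2\<^sup>2)" "m \<noteq> 0"
    and P: "finite P" "P \<noteq> {}" "\<And>p. p \<in> P \<Longrightarrow> prime p"
    and appr: "\<And>p. p \<in> P \<Longrightarrow> approximable d a b p"
  obtains m' x1' x2' y1' y2' where "b * m'\<^sup>2 = x1'\<^sup>2 + d * x2'\<^sup>2 + a * (y1'\<^sup>2 + d * y2'\<^sup>2)"
    "\<And>p. p \<in> P \<Longrightarrow> \<not> p dvd m'" "\<And>p. p \<in> P \<Longrightarrow> \<not> p dvd x1'"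
proof -
  obtain g m0 u1 u2 v1 v2 where g: "g \<noteq> 0" "m = g * m0" "x1 = g * u1" "x2 = g * u2" "y1 = g * v1" "y2 = g * v2"
    and prim: "\<And>p. prime p \<Longrightarrow> \<not> (p dvd m0 \<and> p dvd u1 \<and> p dvd u2 \<and> p dvd v1 \<and> p dvd v2)"
    using primitive_part5[OF sol(2), of x1 x2 y1 y2] by metis
  have "g\<^sup>2 * (b * m0\<^sup>2) = g\<^sup>2 * (u1\<^sup>2 + d * u2\<^sup>2 + a * (v1\<^sup>2 + d * v2\<^sup>2))"
    using sol(1) unfolding g(2-) by (simp add: power_mult_distrib algebra_simps)
  then have sol0: "b * m0\<^sup>2 = u1\<^sup>2 + d * u2\<^sup>2 + a * (v1\<^sup>2 + d * v2\<^sup>2)" using g(1) by simp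
  have "\<forall>p\<in>P. \<exists>n c1 c2 e1 e2. p ^ n dvd b - (c1\<^sup>2 + d * c2\<^sup>2) - a * (e1\<^sup>2 + d * e2\<^sup>2) \<and> \<not> p dvd c1 \<and>
     \<not> p ^ n dvd 2 * (b * m0 - u1 * c1 - d * u2 * c2 - a * v1 * e1 - d * a * v2 * e2)"
    using approximable_signs[OF P(3) appr prim[OF P(3)]] by blast
  then obtain n f1 f2 h1 h2 where loc: "\<And>p. p \<in> P \<Longrightarrow> p ^ n p dvd b - ((f1 p)\<^sup>2 + d * (f2 p)\<^sup>2)
      - a * ((h1 p)\<^sup>2 + d * (h2 p)\<^sup>2)" "\<And>p. p \<in> P \<Longrightarrow> \<not> p dvd f1 p"
    "\<And>p. p \<in> P \<Longrightarrow> \<not> p ^ n p dvd 2 * (b * m0 - u1 * f1 p - d * u2 * f2 p - a * v1 * h1 p - d * a * v2 * h2 p)"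
    by metis
  obtain c1 where c1: "\<And>p. p \<in> P \<Longrightarrow> p ^ n p dvd c1 - f1 p"
    using chinese_remainder_primes[OF P(1,3), of n f1] by blast
  obtain c2 where c2: "\<And>p. p \<in> P \<Longrightarrow> p ^ n p dvd c2 - f2 p"
    using chinese_remainder_primes[OF P(1,3), of n f2] by blast
  obtain e1 where e1: "\<And>p. p \<in> P \<Longrightarrow> p ^ n p dvd e1 - h1 p"
    using chinese_remainder_primes[OF P(1,3), of n h1] by blast
  obtain e2 where e2: "\<And>p. p \<in> P \<Longrightarrow> p ^ n p dvd e2 - h2 p"
    using chinese_remainder_primes[OF P(1,3), of n h2] by blast
  \<comment> \<open>\<open>h\<close> is the value of the form at the reflection vector and
    \<open>B\<close> the bilinear pairing with the solution; \<open>(m1, X1, X2, Y1, Y2)\<close> is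
    \<open>- h\<close> times the reflected solution.\<close>
  define h where "h = b - (c1\<^sup>2 + d * c2\<^sup>2) - a * (e1\<^sup>2 + d * e2\<^sup>2)"
  define B where "B = b * m0 - u1 * c1 - d * u2 * c2 - a * v1 * e1 - d * a * v2 * e2"
  define m1 where "m1 = 2 * B - h * m0"
  define X1 where "X1 = 2 * B * c1 - h * u1"
  define X2 where "X2 = 2 * B * c2 - h * u2"
  define Y1 where "Y1 = 2 * B * e1 - h * v1"
  define Y2 where "Y2 = 2 * B * e2 - h * v2"
  have sol1: "b * m1\<^sup>2 = X1\<^sup>2 + d * X2\<^sup>2 + a * (Y1\<^sup>2 + d * Y2\<^sup>2)"
  proof -
    have "b * m1\<^sup>2 - (X1\<^sup>2 + d * X2\<^sup>2 + a * (Y1\<^sup>2 + d * Y2\<^sup>2))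
      = 4 * B\<^sup>2 * (b - (c1\<^sup>2 + d * c2\<^sup>2) - a * (e1\<^sup>2 + d * e2\<^sup>2))
        - 4 * B * h * (b * m0 - u1 * c1 - d * u2 * c2 - a * v1 * e1 - d * a * v2 * e2)
        + h\<^sup>2 * (b * m0\<^sup>2 - (u1\<^sup>2 + d * u2\<^sup>2 + a * (v1\<^sup>2 + d * v2\<^sup>2)))"
      unfolding m1_def X1_def X2_def Y1_def Y2_def by Groebner_Basis.algebra
    also have "\<dots> = 0" unfolding h_def[symmetric] B_def[symmetric] sol0 by Groebner_Basis.algebra
    finally show ?thesis by simp
  qed
  have val: "\<exists>j. p ^ j dvd m1 \<and> p ^ j dvd X1 \<and> p ^ j dvd X2 \<and> p ^ j dvd Y1 \<and> p ^ j dvd Y2 \<and>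
      \<not> p ^ Suc j dvd m1 \<and> \<not> p ^ Suc j dvd X1" if "p \<in> P" for p
  proof -
    let ?q = "p ^ n p"
    note cg = c1[OF that] c2[OF that] e1[OF that] e2[OF that]
    have "?q dvd (b - ((f1 p)\<^sup>2 + d * (f2 p)\<^sup>2) - a * ((h1 p)\<^sup>2 + d * (h2 p)\<^sup>2))
        - ((c1 - f1 p) * (c1 + f1 p) + d * ((c2 - f2 p) * (c2 + f2 p))
          + a * ((e1 - h1 p) * (e1 + h1 p)) + a * d * ((e2 - h2 p) * (e2 + h2 p)))"
      using cg by (intro dvd_diff[OF loc(1)[OF that]] dvd_add) auto
    then have qh: "?q dvd h" unfolding h_def by (simp add: power2_eq_square algebra_simps)
    have nB: "\<not> ?q dvd 2 * B"
    proof
      assume "?q dvd 2 * B"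
      moreover have "?q dvd 2 * (u1 * (c1 - f1 p) + d * u2 * (c2 - f2 p) + a * v1 * (e1 - h1 p)
          + d * a * v2 * (e2 - h2 p))"
        using cg by (intro dvd_mult dvd_add) auto
      ultimately have "?q dvd 2 * B + 2 * (u1 * (c1 - f1 p) + d * u2 * (c2 - f2 p) + a * v1 * (e1 - h1 p)
          + d * a * v2 * (e2 - h2 p))" by (rule dvd_add)
      then show False using loc(3)[OF that] unfolding B_def by (simp add: algebra_simps)
    qed
    \<comment> \<open>\<open>p ^ j\<close> is the exact power of \<open>p\<close> in
      \<open>2 * B\<close>. As \<open>j < n p\<close>, \<open>h\<close> contains one more factor
      \<open>p\<close>, so the multiple of the reflection vector dominates.\<close>
    then obtain j where j: "j < n p" "\<And>i. i \<le> j \<Longrightarrow> p ^ i dvd 2 * B" "\<not> p ^ Suc j dvd 2 * B"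
      using ex_least_nat_less[of "\<lambda>i. \<not> p ^ i dvd 2 * B" "n p"] by auto
    have hj: "p ^ Suc j dvd h" using qh j(1) by (meson Suc_leI dvd_trans le_imp_power_dvd)
    then have hj': "p ^ j dvd h" by (meson dvd_trans le_imp_power_dvd lessI less_imp_le)
    have Bj: "p ^ j dvd 2 * B" using j(2) by simp
    have np: "\<not> p dvd c1"
    proof
      assume "p dvd c1"
      moreover have "p dvd ?q" using j(1) by (cases "n p") auto
      then have "p dvd c1 - f1 p" using c1[OF that] dvd_trans by blast
      ultimately have "p dvd c1 - (c1 - f1 p)" by (rule dvd_diff)
      then show False using loc(2)[OF that] by simp
    qed
    have "\<not> p ^ Suc j dvd m1"
    proof
      assume "p ^ Suc j dvd m1"
      then have "p ^ Suc j dvd m1 + h * m0" using hj by (simp add: dvd_mult2)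
      then show False using j(3) by (simp add: m1_def)
    qed
    moreover have "\<not> p ^ Suc j dvd X1"
    proof
      assume "p ^ Suc j dvd X1"
      then have "p ^ Suc j dvd X1 + h * u1" using hj by (simp add: dvd_mult2)
      then have "p ^ Suc j dvd c1 * (2 * B)" by (simp add: X1_def mult.commute)
      then show False using j(3) prime_power_dvd_mult_unit[OF P(3)[OF that] np] by blast
    qed
    moreover have "p ^ j dvd m1" "p ^ j dvd X1" "p ^ j dvd X2" "p ^ j dvd Y1" "p ^ j dvd Y2"
      unfolding m1_def X1_def X2_def Y1_def Y2_def by (intro dvd_diff dvd_mult2 Bj hj')+
    ultimately show ?thesis by blast
  qed
  obtain p0 where "p0 \<in> P" using P(2) by blast
  then have "m1 \<noteq> 0" using val by force
  then obtain k m' x1' x2' y1' y2' where k: "k \<noteq> 0" "m1 = k * m'" "X1 = k * x1'" "X2 = k * x2'"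
      "Y1 = k * y1'" "Y2 = k * y2'"
    and prim': "\<And>p. prime p \<Longrightarrow> \<not> (p dvd m' \<and> p dvd x1' \<and> p dvd x2' \<and> p dvd y1' \<and> p dvd y2')"
    using primitive_part5[of m1 X1 X2 Y1 Y2] by metis
  have "k\<^sup>2 * (b * m'\<^sup>2) = k\<^sup>2 * (x1'\<^sup>2 + d * x2'\<^sup>2 + a * (y1'\<^sup>2 + d * y2'\<^sup>2))"
    using sol1 unfolding k(2-) by (simp add: power_mult_distrib algebra_simps)
  then have sol': "b * m'\<^sup>2 = x1'\<^sup>2 + d * x2'\<^sup>2 + a * (y1'\<^sup>2 + d * y2'\<^sup>2)" using k(1) by simp
  have "\<not> p dvd m' \<and> \<not> p dvd x1'" if pP: "p \<in> P" for p
  proof -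
    obtain j where j: "p ^ j dvd k * m'" "p ^ j dvd k * x1'" "p ^ j dvd k * x2'" "p ^ j dvd k * y1'" "p ^ j dvd k * y2'"
      "\<not> p ^ Suc j dvd k * m'" "\<not> p ^ Suc j dvd k * x1'"
      using val[OF pP] unfolding k(2-) by blast
    \<comment> \<open>The common factor \<open>p ^ j\<close> of the five entries lies in
      \<open>k\<close>, the quotient vector being primitive; a further \<open>p\<close> in
      \<open>m'\<close> or \<open>x1'\<close> would exceed the exact power.\<close>
    have "p ^ j dvd k"
      using prim'[OF P(3)[OF pP]] j(1-5) prime_power_dvd_mult_unit[OF P(3)[OF pP]] mult.commute by metis
    then have "p ^ Suc j dvd k * z" if "p dvd z" for z
      using that unfolding power_Suc2 by (rule mult_dvd_mono)
    then show ?thesis using j(6,7) by blast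
  qed
  then show ?thesis using that sol' by blast
qed

section \<open>Approximate solutions at the individual primes\<close>

lemma approximable_odd_prime:
  fixes a b d k p :: int
  assumes p: "prime p" "odd p" and d: "d = 1 \<or> d = 2 \<and> p \<noteq> 3" and k: "k = 1 \<or> k = 2"
    and a: "squarefree a" "p dvd a" and b: "\<not> p dvd b"
  shows "approximable d (k * a) b p"
proof -
  note unit = prime_power_dvd_mult_unit[OF p(1)]
  have n2: "\<not> p dvd 2" by (rule odd_prime_not_dvd_two[OF p])
  have n4: "\<not> p dvd 4" using n2 prime_dvd_mult_iff[OF p(1), of 2 2] by simp
  have n1: "\<not> p dvd 1" using p(1) not_prime_unit by blast
  have nd: "\<not> p dvd d" "\<not> p dvd k" using d k n1 n2 by auto
  have pa: "\<not> p\<^sup>2 dvd a" using squarefreeD[OF a(1), of p] n1 by blast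
  \<comment> \<open>With \<open>y1 = y2 = 1\<close>, the value left for \<open>x1^2 + d x2^2\<close>
    is the unit \<open>b\<close> modulo \<open>p\<close>. Precision \<open>p^2\<close> suffices
    because \<open>a\<close> is square-free.\<close>
  have "\<not> p dvd b - k * a * (1 + d)"
  proof
    assume "p dvd b - k * a * (1 + d)"
    moreover have "p dvd k * a * (1 + d)" using a(2) by simp
    ultimately have "p dvd (b - k * a * (1 + d)) + k * a * (1 + d)" by (rule dvd_add)
    then show False using b by simp
  qed
  then obtain x y where xy: "\<not> p dvd x" "\<not> p\<^sup>2 dvd y" "p\<^sup>2 dvd x\<^sup>2 + d * y\<^sup>2 - (b - k * a * (1 + d))"
    using norm_form_unit_mod_prime_power[OF p d] by blast
  have unit_not: "\<not> p\<^sup>2 dvd z" if "\<not> p dvd z" for z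
    using that by (metis dvd_mult_left power2_eq_square)
  have "\<not> p\<^sup>2 dvd 4 * b" "\<not> p\<^sup>2 dvd 4 * x" using unit[OF n4, of 2] unit_not b xy(1) by blast+
  moreover have "\<not> p\<^sup>2 dvd 4 * d * y"
    using unit[OF n4, of 2 "d * y"] unit[OF nd(1), of 2 y] xy(2) by (simp add: mult.assoc)
  moreover have ka: "\<not> p\<^sup>2 dvd k * a" using unit[OF nd(2), of 2 a] pa by simp
  then have "\<not> p\<^sup>2 dvd 4 * (k * a) * 1" using unit[OF n4, of 2 "k * a"] by simp
  moreover have "\<not> p\<^sup>2 dvd 4 * d * (k * a) * 1"
    using unit[OF n4, of 2 "d * (k * a)"] unit[OF nd(1), of 2 "k * a"] ka by (simp add: mult.assoc)
  moreover have "p\<^sup>2 dvd b - (x\<^sup>2 + d * y\<^sup>2) - k * a * (1\<^sup>2 + d * 1\<^sup>2)"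
    using xy(3) by (subst dvd_diff_commute) (simp add: algebra_simps)
  ultimately show ?thesis using xy(1) unfolding approximable_def by blast
qed

text \<open>The entries \<open>x2\<close>, \<open>y1\<close>, \<open>y2\<close> are given;
  \<open>x1\<close> is found as a square root modulo \<open>2 ^ 7 = 128\<close>.\<close>

lemma approximable_twoI:
  fixes a b d x2 y1 y2 :: int
  assumes "odd b" "8 dvd (b - d * x2\<^sup>2 - a * (y1\<^sup>2 + d * y2\<^sup>2)) - 1"
    and "\<not> 128 dvd 4 * d * x2" "\<not> 128 dvd 4 * a * y1" "\<not> 128 dvd 4 * d * a * y2"
  shows "approximable d a b 2"
proof -
  obtain x1 where x1: "odd x1" "2 ^ 7 dvd x1\<^sup>2 - (b - d * x2\<^sup>2 - a * (y1\<^sup>2 + d * y2\<^sup>2))"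
    using square_root_mod_power_of_two[OF assms(2)] by blast
  have "2 ^ 7 dvd - (x1\<^sup>2 - (b - d * x2\<^sup>2 - a * (y1\<^sup>2 + d * y2\<^sup>2)))"
    using x1(2) by (simp only: dvd_minus_iff)
  then have "2 ^ 7 dvd b - (x1\<^sup>2 + d * x2\<^sup>2) - a * (y1\<^sup>2 + d * y2\<^sup>2)"
    by (simp add: algebra_simps)
  moreover have "\<not> 128 dvd 4 * b" "\<not> 128 dvd 4 * x1" using assms(1) x1(1) by presburger+
  ultimately show ?thesis using x1(1) assms(3-) unfolding approximable_def
    by (intro exI[of _ 7] exI[of _ x1] exI[of _ x2] exI[of _ y1] exI[of _ y2]) simp
qed

text \<open>Entries from 1, 2, 4 have small 2-adic valuation, as the nondivisibility conditions ask,
  and move \<open>b\<close> to 1 modulo 8. For \<open>d = 1\<close> the \<open>y\<close> entries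
  correct \<open>b\<close> modulo 4 and \<open>x2\<close> modulo 8; for \<open>d = 2\<close>,
  \<open>x2\<close> corrects it modulo 4 and \<open>y2\<close> modulo 8.\<close>

lemma approximable_two:
  fixes a b d :: int
  assumes b: "odd b" and a: "\<not> 4 dvd a" and d: "d = 1 \<or> d = 2 \<and> even a"
  shows "approximable d a b 2"
proof -
  have na: "\<not> 128 dvd 4 * a" "\<not> 128 dvd 8 * a" "\<not> 128 dvd 16 * a" "\<not> 128 dvd 32 * a"
    using a by presburger+
  have b8: "b mod 8 = 1 \<or> b mod 8 = 3 \<or> b mod 8 = 5 \<or> b mod 8 = 7" using b by presburger
  show ?thesis
  proof (cases "d = 1")
    case True
    have *: "approximable d a b 2" if "8 dvd (b - x2\<^sup>2 - a * (y1\<^sup>2 + y2\<^sup>2)) - 1"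
      "x2 = 2 \<or> x2 = 4" "y1 = 1 \<or> y1 = 4" "y2 = 1 \<or> y2 = 4" for x2 y1 y2
      by (rule approximable_twoI[OF b, of d x2 a y1 y2])
        (use True that na in \<open>auto simp: mult.commute[of a]\<close>)
    have "8 dvd (b - 4\<^sup>2 - a * (4\<^sup>2 + 4\<^sup>2)) - 1" if "b mod 8 = 1" using that by simp presburger
    moreover have "8 dvd (b - 2\<^sup>2 - a * (4\<^sup>2 + 4\<^sup>2)) - 1" if "b mod 8 = 5" using that by simp presburger
    moreover have "8 dvd (b - 4\<^sup>2 - a * (1\<^sup>2 + 1\<^sup>2)) - 1 \<or> 8 dvd (b - 2\<^sup>2 - a * (1\<^sup>2 + 1\<^sup>2)) - 1"
      if "b mod 8 = 3 \<or> b mod 8 = 7" "odd a" using that by simp presburger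
    moreover have "8 dvd (b - 4\<^sup>2 - a * (1\<^sup>2 + 4\<^sup>2)) - 1 \<or> 8 dvd (b - 2\<^sup>2 - a * (1\<^sup>2 + 4\<^sup>2)) - 1"
      if "b mod 8 = 3 \<or> b mod 8 = 7" "even a" using that a by simp presburger
    ultimately show ?thesis using b8 *[of 4 4 4] *[of 2 4 4] *[of 4 1 1] *[of 2 1 1] *[of 4 1 4] *[of 2 1 4]
      by argo
  next
    case False
    then have d2: "d = 2" "even a" using d by auto
    have *: "approximable d a b 2" if "8 dvd (b - 2 * x2\<^sup>2 - a * (2\<^sup>2 + 2 * y2\<^sup>2)) - 1"
      "x2 = 1 \<or> x2 = 2" "y2 = 1 \<or> y2 = 2" for x2 y2
      by (rule approximable_twoI[OF b, of d x2 a 2 y2])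
        (use d2 that na in \<open>auto simp: mult.commute[of a]\<close>)
    have "8 dvd (b - 2 * 2\<^sup>2 - a * (2\<^sup>2 + 2 * 2\<^sup>2)) - 1" if "b mod 8 = 1" using that d2(2) by simp presburger
    moreover have "8 dvd (b - 2 * 2\<^sup>2 - a * (2\<^sup>2 + 2 * 1\<^sup>2)) - 1" if "b mod 8 = 5" using that d2(2) a by simp presburger
    moreover have "8 dvd (b - 2 * 1\<^sup>2 - a * (2\<^sup>2 + 2 * 2\<^sup>2)) - 1" if "b mod 8 = 3" using that d2(2) by simp presburger
    moreover have "8 dvd (b - 2 * 1\<^sup>2 - a * (2\<^sup>2 + 2 * 1\<^sup>2)) - 1" if "b mod 8 = 7" using that d2(2) a by simp presburger
    ultimately show ?thesis using b8 *[of 2 2] *[of 2 1] *[of 1 2] *[of 1 1] by argo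
  qed
qed

text \<open>For \<open>d = 2\<close> the prime 3 is outside the reach of
  \<open>norm_form_unit_mod_prime_power\<close>. As 3 does not divide \<open>a\<close>, the choices
  \<open>(3, 3)\<close>, \<open>(1, 3)\<close>, \<open>(3, 1)\<close> of \<open>(y1, y2)\<close>
  shift by 0, \<open>a\<close>, \<open>2 a\<close>, all residues modulo 3, and one of them leaves 1
  for \<open>x1^2\<close>.\<close>

lemma approximable_three:
  fixes a b :: int
  assumes a: "\<not> 3 dvd a" and b: "\<not> 27 dvd b"
  shows "approximable 2 a b 3"
proof -
  have main: "approximable 2 a b 3" if y: "y1 = 1 \<or> y1 = 3" "y2 = 1 \<or> y2 = 3"
    and dv: "3 dvd (b - 2 * 3\<^sup>2 - a * (y1\<^sup>2 + 2 * y2\<^sup>2)) - 1" for y1 y2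
  proof -
    have "3 dvd 1\<^sup>2 - (b - 2 * 3\<^sup>2 - a * (y1\<^sup>2 + 2 * y2\<^sup>2))" using dv by (subst dvd_diff_commute) simp
    moreover have "prime (3::int)" "odd (3::int)" "\<not> (3::int) dvd 1" by simp_all
    ultimately obtain x where x: "3 dvd x - 1" "3 ^ 3 dvd x\<^sup>2 - (b - 2 * 3\<^sup>2 - a * (y1\<^sup>2 + 2 * y2\<^sup>2))"
      using square_root_mod_odd_prime_power[of 3 1] by blast
    have "3 ^ 3 dvd - (x\<^sup>2 - (b - 2 * 3\<^sup>2 - a * (y1\<^sup>2 + 2 * y2\<^sup>2)))"
      using x(2) by (simp only: dvd_minus_iff)
    then have "3 ^ 3 dvd b - (x\<^sup>2 + 2 * 3\<^sup>2) - a * (y1\<^sup>2 + 2 * y2\<^sup>2)" by (simp add: algebra_simps)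
    moreover have "\<not> 3 dvd x" "\<not> 27 dvd 4 * x" "\<not> 27 dvd 4 * b" using x(1) b by presburger+
    moreover have "\<not> 27 dvd 4 * a" "\<not> 27 dvd 12 * a" "\<not> 27 dvd 8 * a" "\<not> 27 dvd 24 * a"
      using a by presburger+
    then have "\<not> 27 dvd 4 * a * y1" "\<not> 27 dvd 4 * 2 * a * y2" using y by (auto simp: mult.commute[of a])
    ultimately show ?thesis unfolding approximable_def
      by (intro exI[of _ 3] exI[of _ x] exI[of _ 3] exI[of _ y1] exI[of _ y2]) simp
  qed
  have "3 dvd b - 1 \<or> 3 dvd b - 1 - a \<or> 3 dvd b - 1 - 2 * a" using a by presburger
  moreover have "3 dvd (b - 2 * 3\<^sup>2 - a * (3\<^sup>2 + 2 * 3\<^sup>2)) - 1" if "3 dvd b - 1"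
    using dvd_diff[OF that dvd_triv_left[of 3 "6 + 9 * a"]] by (simp add: algebra_simps)
  moreover have "3 dvd (b - 2 * 3\<^sup>2 - a * (1\<^sup>2 + 2 * 3\<^sup>2)) - 1" if "3 dvd b - 1 - a"
    using dvd_diff[OF that dvd_triv_left[of 3 "6 + 6 * a"]] by (simp add: algebra_simps)
  moreover have "3 dvd (b - 2 * 3\<^sup>2 - a * (3\<^sup>2 + 2 * 1\<^sup>2)) - 1" if "3 dvd b - 1 - 2 * a"
    using dvd_diff[OF that dvd_triv_left[of 3 "6 + 3 * a"]] by (simp add: algebra_simps)
  ultimately show ?thesis using main[of 3 3] main[of 1 3] main[of 3 1] by argo
qed

lemma base_solution_gaussian:
  fixes a b :: int
  assumes a: "squarefree a" "a > 0" and b: "b > 0" "odd b" and cop: "coprime a b"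
  obtains m x1 x2 y1 y2 where "b * m\<^sup>2 = x1\<^sup>2 + 1 * x2\<^sup>2 + a * (y1\<^sup>2 + 1 * y2\<^sup>2)"
    "\<And>p. prime p \<Longrightarrow> p dvd 2 * a \<Longrightarrow> \<not> p dvd m" "\<And>p. prime p \<Longrightarrow> p dvd 2 * a \<Longrightarrow> \<not> p dvd x1"
proof -
  obtain m x1 x2 y1 y2 where mpos: "m > 0" and sol: "b * m\<^sup>2 = x1\<^sup>2 + 1 * x2\<^sup>2 + a * (y1\<^sup>2 + 1 * y2\<^sup>2)"
    using norm_form_times_square[OF disjI1[OF refl] a(2) b(1)] .
  from mpos have m0: "m \<noteq> 0" by simp
  define P where "P = prime_factors (2 * a)"
  have P: "p \<in> P \<longleftrightarrow> prime p \<and> p dvd 2 * a" for p using a by (auto simp: P_def in_prime_factors_iff)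
  have fin: "finite P" by (simp add: P_def)
  have ne: "P \<noteq> {}" using P[of 2] by auto
  have appr: "approximable 1 a b p" if "p \<in> P" for p
  proof (cases "odd p")
    case True
    have pp: "prime p" "p dvd a" using that P odd_prime_not_dvd_two[of p] True prime_dvd_mult_iff by blast+
    have "\<not> p dvd b" using pp cop by (meson coprime_common_divisor not_prime_unit)
    then show ?thesis using approximable_odd_prime[of p 1 1 a b] pp True a by simp
  next
    case False
    then have "p = 2" using that P primes_dvd_imp_eq[of 2 p] by simp
    moreover have "\<not> 4 dvd a" using squarefreeD[OF a(1), of 2] by auto
    ultimately show ?thesis using approximable_two[of b a 1] b by simp
  qed
  have pr: "prime p" if "p \<in> P" for p using that P by blast
  show ?thesis
  proof (rule norm_form_times_square_coprime[OF sol m0 fin ne pr appr])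
    fix m' x1' x2' y1' y2'
    assume *: "b * m'\<^sup>2 = x1'\<^sup>2 + 1 * x2'\<^sup>2 + a * (y1'\<^sup>2 + 1 * y2'\<^sup>2)"
      "\<And>p. p \<in> P \<Longrightarrow> \<not> p dvd m'" "\<And>p. p \<in> P \<Longrightarrow> \<not> p dvd x1'"
    show thesis by (rule that[OF *(1)]) (use *(2,3) P in auto)
  qed
qed

text \<open>The prime 3 joins those of \<open>2 a\<close> so that, for \<open>D = b * m\<close>, 3
  divides \<open>D\<close> only if it divides \<open>b\<close>.\<close>

lemma base_solution_sqrt_minus_two:
  fixes a b :: int
  assumes a: "squarefree a" "a > 0" "odd a" "\<not> 3 dvd a" and b: "b > 0" "odd b" "squarefree b" and cop: "coprime a b"
  obtains m x1 x2 y1 y2 where "b * m\<^sup>2 = x1\<^sup>2 + 2 * x2\<^sup>2 + 2 * a * (y1\<^sup>2 + 2 * y2\<^sup>2)"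
    "\<And>p. prime p \<Longrightarrow> p dvd 6 * a \<Longrightarrow> \<not> p dvd m" "\<And>p. prime p \<Longrightarrow> p dvd 6 * a \<Longrightarrow> \<not> p dvd x1"
proof -
  have "2 * a > 0" using a(2) by simp
  from norm_form_times_square[OF disjI2[OF refl] this b(1)]
  obtain m x1 x2 y1 y2 where mpos: "m > 0" and sol: "b * m\<^sup>2 = x1\<^sup>2 + 2 * x2\<^sup>2 + 2 * a * (y1\<^sup>2 + 2 * y2\<^sup>2)" .
  from mpos have m0: "m \<noteq> 0" by simp
  define P where "P = prime_factors (6 * a)"
  have P: "p \<in> P \<longleftrightarrow> prime p \<and> p dvd 6 * a" for p using a by (auto simp: P_def in_prime_factors_iff)
  have fin: "finite P" by (simp add: P_def)
  have ne: "P \<noteq> {}" using P[of 2] by auto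
  have appr: "approximable 2 (2 * a) b p" if "p \<in> P" for p
  proof -
    have "prime p" using that P by blast
    consider "p = 2" | "p = 3" | "odd p" "p \<noteq> 3"
      using \<open>prime p\<close> primes_dvd_imp_eq[of 2 p] by fastforce
    then show ?thesis
    proof cases
      case 1
      have "\<not> 4 dvd 2 * a" using a(3) by presburger
      then show ?thesis using 1 approximable_two[of b "2 * a" 2] b by simp
    next
      case 2
      have "\<not> 3 dvd 2 * a" using a(4) by presburger
      moreover have "\<not> 3\<^sup>2 dvd b" using squarefreeD[OF b(3), of 3] by auto
      then have "\<not> 27 dvd b" by simp presburger
      ultimately show ?thesis using 2 approximable_three by blast
    next
      case 3
      have "\<not> p dvd 3" using 3 \<open>prime p\<close> primes_dvd_imp_eq[of p 3] by auto
      moreover have "p dvd 2 * (3 * a)" using that P by simp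
      ultimately have "p dvd a"
        using odd_prime_not_dvd_two[OF \<open>prime p\<close> 3(1)] prime_dvd_mult_iff[OF \<open>prime p\<close>] by blast
      moreover from this have "\<not> p dvd b" using cop \<open>prime p\<close> by (meson coprime_common_divisor not_prime_unit)
      ultimately show ?thesis using approximable_odd_prime[of p 2 2 a b] \<open>prime p\<close> 3 a by simp
    qed
  qed
  have pr: "prime p" if "p \<in> P" for p using that P by blast
  show ?thesis
  proof (rule norm_form_times_square_coprime[OF sol m0 fin ne pr appr])
    fix m' x1' x2' y1' y2'
    assume *: "b * m'\<^sup>2 = x1'\<^sup>2 + 2 * x2'\<^sup>2 + 2 * a * (y1'\<^sup>2 + 2 * y2'\<^sup>2)"
      "\<And>p. p \<in> P \<Longrightarrow> \<not> p dvd m'" "\<And>p. p \<in> P \<Longrightarrow> \<not> p dvd x1'"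
    show thesis by (rule that[OF *(1)]) (use *(2,3) P in auto)
  qed
qed

subsection \<open>The Hermitian family\<close>

lemma coprime_int_primeI:
  fixes x y :: int
  assumes "\<And>p. prime p \<Longrightarrow> p dvd x \<Longrightarrow> p dvd y \<Longrightarrow> False"
  shows "coprime x y"
proof (rule ccontr)
  assume "\<not> coprime x y"
  then have "\<bar>gcd x y\<bar> \<noteq> 1" by (simp add: coprime_iff_gcd_eq_1)
  then obtain p where "prime p" "p dvd gcd x y" using prime_factor_int by blast
  then show False using assms by auto
qed

text \<open>If \<open>p\<close> divides \<open>x\<^sup>2 + d y\<^sup>2\<close>, then \<open>\<surd>-d\<close> may be read as an integer \<open>\<iota>\<close> modulo \<open>p\<close>; the congruences then
  force \<open>p\<close> to divide a norm that does not depend on \<open>s\<close>.\<close>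

lemma hermitian_family_coprime:
  fixes a b d m X1 X2 Y1 Y2 a2 D \<beta> s \<mu> w p :: int
  defines "c \<equiv> \<mu>\<^sup>2 + d * w\<^sup>2" and "x \<equiv> D * \<beta> + a" and "y \<equiv> a * s"
    and "q1 \<equiv> b * (X1\<^sup>2 + a2 * Y1\<^sup>2)" and "q2 \<equiv> b * (X1 * X2 + a2 * (Y1 * Y2))" and "q3 \<equiv> b * (X2\<^sup>2 + a2 * Y2\<^sup>2)"
  assumes D: "D\<^sup>2 = q1 + d * q3" and beta: "c - a * (1 + d * s\<^sup>2) = 2 * (D * \<beta>)"
    and p: "prime p" "odd p" "\<not> p dvd d" "p dvd x\<^sup>2 + d * y\<^sup>2" "\<not> p dvd y"
    and nd: "\<not> p dvd a" "\<not> p dvd D" "\<not> p dvd c"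
      "\<not> p dvd (d * (q3 * \<mu> - q2 * w))\<^sup>2 + d * (q1 * w - q2 * \<mu>)\<^sup>2"
  shows "\<not> p dvd x * (a * \<mu>\<^sup>2 + \<beta>\<^sup>2 * q1) - d * y * (a * \<mu> * w + \<beta>\<^sup>2 * q2)"
proof
  define Q1 where "Q1 = a * \<mu>\<^sup>2 + \<beta>\<^sup>2 * q1"
  define Q2 where "Q2 = a * \<mu> * w + \<beta>\<^sup>2 * q2"
  assume "p dvd x * (a * \<mu>\<^sup>2 + \<beta>\<^sup>2 * q1) - d * y * (a * \<mu> * w + \<beta>\<^sup>2 * q2)"
  then have V: "p dvd x * Q1 - d * y * Q2" by (simp add: Q1_def Q2_def)
  have "coprime p y" using p(1,5) by (rule prime_imp_coprime)
  then have "coprime y p" by (subst coprime_commute)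
  then obtain y' where "[y * y' = 1] (mod p)" using cong_solve_coprime_int by blast
  then have y': "p dvd y * y' - 1" by (simp add: cong_iff_dvd_diff)
  define \<iota> where "\<iota> = x * y'"
  have e1: "p dvd x - \<iota> * y"
  proof -
    have "x - \<iota> * y = - x * (y * y' - 1)" unfolding \<iota>_def by Groebner_Basis.algebra
    then show ?thesis using dvd_mult[OF y'] by simp
  qed
  have e2: "p dvd \<iota>\<^sup>2 + d"
  proof -
    have "\<iota>\<^sup>2 + d = y'\<^sup>2 * (x\<^sup>2 + d * y\<^sup>2) - d * (y * y' + 1) * (y * y' - 1)" unfolding \<iota>_def by Groebner_Basis.algebra
    then show ?thesis using dvd_diff[OF dvd_mult[OF p(4)] dvd_mult[OF y']] by simp
  qed
  have ni: "\<not> p dvd \<iota>"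
  proof
    assume "p dvd \<iota>"
    then have "p dvd \<iota> * \<iota>" by simp
    with e2 have "p dvd (\<iota>\<^sup>2 + d) - \<iota> * \<iota>" by (rule dvd_diff)
    then show False using p(3) by (simp add: power2_eq_square)
  qed
  have "x * Q1 - d * y * Q2 = (x - \<iota> * y) * Q1 + \<iota> * y * (Q1 + \<iota> * Q2) - (\<iota>\<^sup>2 + d) * (y * Q2)" by Groebner_Basis.algebra
  then have "\<iota> * y * (Q1 + \<iota> * Q2) = (x * Q1 - d * y * Q2) - (x - \<iota> * y) * Q1 + (\<iota>\<^sup>2 + d) * (y * Q2)" by simp
  then have "p dvd \<iota> * y * (Q1 + \<iota> * Q2)"
    using dvd_add[OF dvd_diff[OF V dvd_mult2[OF e1]] dvd_mult2[OF e2]] by simp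
  then have Q: "p dvd Q1 + \<iota> * Q2" using p(1,5) ni prime_dvd_mult_iff by blast
  \<comment> \<open>With \<open>x = \<iota> y\<close>, the relation for \<open>\<beta>\<close>
    becomes \<open>D \<beta> = - a \<sigma>\<close> and \<open>c = - a \<sigma>^2\<close> modulo
    \<open>p\<close>.\<close>
  define \<sigma> where "\<sigma> = 1 - \<iota> * s"
  have s1: "x - \<iota> * y = D * \<beta> + a * \<sigma>" unfolding x_def y_def \<sigma>_def by Groebner_Basis.algebra
  have cs: "c = 2 * (D * \<beta>) + a * (1 + d * s\<^sup>2)" using beta by simp
  have "c + a * \<sigma>\<^sup>2 = 2 * (x - \<iota> * y) + (\<iota>\<^sup>2 + d) * (a * s\<^sup>2)"
    unfolding cs s1 \<sigma>_def by Groebner_Basis.algebra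
  then have c: "p dvd c + a * \<sigma>\<^sup>2" using dvd_add[OF dvd_mult[OF e1] dvd_mult2[OF e2]] by (simp only:)
  \<comment> \<open>\<open>A\<close> and \<open>B\<close> are conjugate factors of \<open>c\<close>
    modulo \<open>p\<close>. Multiplying \<open>Q1 + \<iota> Q2\<close> by \<open>D^2\<close> and
    inserting the congruences leaves \<open>a A (D^2 \<mu> - B q)\<close>. The last factor is linear
    in \<open>\<iota>\<close>, and its norm is the quantity assumed prime to
    \<open>p\<close>.\<close>
  define A where "A = \<mu> + \<iota> * w"
  define B where "B = \<mu> - \<iota> * w"
  define q where "q = q1 + \<iota> * q2"
  have AB: "A * B = c - (\<iota>\<^sup>2 + d) * w\<^sup>2" unfolding A_def B_def c_def by Groebner_Basis.algebra
  have "a * (A * (D\<^sup>2 * \<mu> - B * q)) = D\<^sup>2 * (Q1 + \<iota> * Q2) - (D * \<beta> + a * \<sigma>) * ((D * \<beta> - a * \<sigma>) * q)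
      - (c + a * \<sigma>\<^sup>2) * (a * q) + (c - A * B) * (a * q)"
    unfolding Q1_def Q2_def A_def q_def by Groebner_Basis.algebra
  also have "\<dots> = D\<^sup>2 * (Q1 + \<iota> * Q2) - (x - \<iota> * y) * ((D * \<beta> - a * \<sigma>) * q)
      - (c + a * \<sigma>\<^sup>2) * (a * q) + (\<iota>\<^sup>2 + d) * (w\<^sup>2 * (a * q))"
    unfolding s1 AB by Groebner_Basis.algebra
  finally have "p dvd a * (A * (D\<^sup>2 * \<mu> - B * q))"
    using dvd_add[OF dvd_diff[OF dvd_diff[OF dvd_mult[OF Q] dvd_mult2[OF e1]] dvd_mult2[OF c]] dvd_mult2[OF e2]] by simp
  moreover have "\<not> p dvd A"
  proof
    assume "p dvd A"
    then have "p dvd A * B + (\<iota>\<^sup>2 + d) * w\<^sup>2" using dvd_add[OF dvd_mult2 dvd_mult2[OF e2]] by blast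
    then show False using nd(3) AB by simp
  qed
  ultimately have "p dvd D\<^sup>2 * \<mu> - B * q" using nd(1) p(1) prime_dvd_mult_iff by blast
  then have "p dvd (D\<^sup>2 * \<mu> - B * q) - (\<iota>\<^sup>2 + d) * (w * q2)" by (rule dvd_diff[OF _ dvd_mult2[OF e2]])
  moreover have "(D\<^sup>2 * \<mu> - B * q) - (\<iota>\<^sup>2 + d) * (w * q2) = d * (q3 * \<mu> - q2 * w) + \<iota> * (q1 * w - q2 * \<mu>)"
    unfolding D B_def q_def by Groebner_Basis.algebra
  ultimately have RI: "p dvd d * (q3 * \<mu> - q2 * w) + \<iota> * (q1 * w - q2 * \<mu>)" by (simp only:)
  have "(d * (q3 * \<mu> - q2 * w))\<^sup>2 + d * (q1 * w - q2 * \<mu>)\<^sup>2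
    = (d * (q3 * \<mu> - q2 * w) + \<iota> * (q1 * w - q2 * \<mu>)) * (d * (q3 * \<mu> - q2 * w) - \<iota> * (q1 * w - q2 * \<mu>))
      + (\<iota>\<^sup>2 + d) * (q1 * w - q2 * \<mu>)\<^sup>2" by Groebner_Basis.algebra
  then show False using nd(4) dvd_add[OF dvd_mult2[OF RI] dvd_mult2[OF e2]] by simp
qed

text \<open>Expanding with the relation for \<open>\<beta>\<close> gives
  \<open>x^2 + d y^2 = a c + \<beta>^2 D^2\<close>, and \<open>D^2 = b (b m^2)\<close> is a
  combination of norms by the base solution. The other conclusions are the coprimality hypotheses of
  the lemmas on three squares.\<close>

lemma hermitian_family:
  fixes a b d m X1 X2 Y1 Y2 a2 D \<beta> s \<mu> w :: int
  defines "c \<equiv> \<mu>\<^sup>2 + d * w\<^sup>2" and "x \<equiv> D * \<beta> + a" and "y \<equiv> a * s"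
    and "q1 \<equiv> b * (X1\<^sup>2 + a2 * Y1\<^sup>2)" and "q2 \<equiv> b * (X1 * X2 + a2 * (Y1 * Y2))" and "q3 \<equiv> b * (X2\<^sup>2 + a2 * Y2\<^sup>2)"
  assumes d: "d = 1 \<or> d = 2"
    and D: "D = b * m" "b * m\<^sup>2 = X1\<^sup>2 + d * X2\<^sup>2 + a2 * (Y1\<^sup>2 + d * Y2\<^sup>2)"
    and beta: "c - a * (1 + d * s\<^sup>2) = 2 * (D * \<beta>)" and l: "odd (x\<^sup>2 + d * y\<^sup>2)"
    and pa: "\<And>p. prime p \<Longrightarrow> odd p \<Longrightarrow> p dvd a \<Longrightarrow> \<not> p dvd c \<and> \<not> p dvd D \<and> \<not> p dvd X1"
    and ps: "\<And>p. prime p \<Longrightarrow> odd p \<Longrightarrow> p dvd c + a \<Longrightarrow> \<not> p dvd s"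
    and pl: "\<And>p. prime p \<Longrightarrow> odd p \<Longrightarrow> p dvd x\<^sup>2 + d * y\<^sup>2 \<Longrightarrow> \<not> (d = 2 \<and> p = 3 \<and> 3 dvd b) \<Longrightarrow>
        \<not> p dvd D \<and> \<not> p dvd c \<and> \<not> p dvd (d * (q3 * \<mu> - q2 * w))\<^sup>2 + d * (q1 * w - q2 * \<mu>)\<^sup>2"
    and p3: "d = 2 \<Longrightarrow> 3 dvd b \<Longrightarrow> 3 dvd \<mu> - 1 \<and> 3 dvd w - 1 \<and> 3 dvd s - 1"
    and pm: "\<And>p. prime p \<Longrightarrow> odd p \<Longrightarrow> p dvd \<mu> \<Longrightarrow> \<not> p dvd b * (\<beta> * X1)"
  shows "x\<^sup>2 + d * y\<^sup>2 = a * (\<mu>\<^sup>2 + d * w\<^sup>2) + b * ((\<beta> * X1)\<^sup>2 + d * (\<beta> * X2)\<^sup>2) + b * a2 * ((\<beta> * Y1)\<^sup>2 + d * (\<beta> * Y2)\<^sup>2)"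
    and "coprime x (d * y)"
    and "\<And>p. prime p \<Longrightarrow> p dvd x\<^sup>2 + d * y\<^sup>2 \<Longrightarrow>
      \<not> p dvd x * (a * \<mu>\<^sup>2 + b * (\<beta> * X1)\<^sup>2 + b * a2 * (\<beta> * Y1)\<^sup>2)
        - d * y * (a * (\<mu> * w) + b * ((\<beta> * X1) * (\<beta> * X2)) + b * a2 * ((\<beta> * Y1) * (\<beta> * Y2)))"
    and "\<And>p. prime p \<Longrightarrow> odd p \<Longrightarrow> \<not> (p dvd a * \<mu> \<and> p dvd b * (\<beta> * X1))"
proof -
  have D2: "D\<^sup>2 = q1 + d * q3"
  proof -
    have "D\<^sup>2 = b * (b * m\<^sup>2)" unfolding D(1) by Groebner_Basis.algebra
    also have "\<dots> = q1 + d * q3" unfolding D(2) q1_def q3_def by Groebner_Basis.algebra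
    finally show ?thesis .
  qed
  have cs: "c = 2 * (D * \<beta>) + a * (1 + d * s\<^sup>2)" using beta by simp
  have "x\<^sup>2 + d * y\<^sup>2 = a * c + \<beta>\<^sup>2 * D\<^sup>2" unfolding cs x_def y_def by Groebner_Basis.algebra
  also have "\<dots> = a * c + b * ((\<beta> * X1)\<^sup>2 + d * (\<beta> * X2)\<^sup>2) + b * a2 * ((\<beta> * Y1)\<^sup>2 + d * (\<beta> * Y2)\<^sup>2)"
    unfolding D2 q1_def q3_def by Groebner_Basis.algebra
  finally show "x\<^sup>2 + d * y\<^sup>2 = a * (\<mu>\<^sup>2 + d * w\<^sup>2) + b * ((\<beta> * X1)\<^sup>2 + d * (\<beta> * X2)\<^sup>2) + b * a2 * ((\<beta> * Y1)\<^sup>2 + d * (\<beta> * Y2)\<^sup>2)"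
    unfolding c_def .
  \<comment> \<open>Prime factors of \<open>x\<close> are tested on this form: modulo a prime of
    \<open>a\<close> it is \<open>c\<close>, modulo a prime of \<open>s\<close> it is
    \<open>c + a\<close>.\<close>
  have x2: "2 * x = c + a - a * d * s\<^sup>2" unfolding cs x_def by Groebner_Basis.algebra
  have ndd: "\<not> p dvd d" if "prime p" "odd p" for p
    using d odd_prime_not_dvd_two[OF that] not_prime_unit[of p] that by auto
  have nxy: False if p: "prime p" and px: "p dvd x" "p dvd d * y" for p
  proof (cases "odd p")
    case True
    have "p dvd a \<or> p dvd s" using px(2) ndd[OF p True] p prime_dvd_mult_iff unfolding y_def by blast
    then show False
    proof
      assume a: "p dvd a"
      have "p dvd 2 * x - a * (1 - d * s\<^sup>2)" using px(1) a by (intro dvd_diff) auto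
      then have "p dvd c" unfolding x2 by (simp add: algebra_simps)
      then show False using pa[OF p True a] by simp
    next
      assume s: "p dvd s"
      then have "p dvd a * d * s\<^sup>2" by (simp add: power2_eq_square)
      then have "p dvd 2 * x + a * d * s\<^sup>2" using px(1) by simp
      then have "p dvd c + a" unfolding x2 by simp
      then show False using ps[OF p True] s by simp
    qed
  next
    case False
    then have "p = 2" using p primes_dvd_imp_eq[of 2 p] by simp
    then have "even x" "even (d * y)" using px by auto
    then have "even (x\<^sup>2 + d * y\<^sup>2)" by (auto simp: power2_eq_square)
    then show False using l by simp
  qed
  then show cop: "coprime x (d * y)"
    by (rule coprime_int_primeI)
  show "\<not> p dvd x * (a * \<mu>\<^sup>2 + b * (\<beta> * X1)\<^sup>2 + b * a2 * (\<beta> * Y1)\<^sup>2)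
        - d * y * (a * (\<mu> * w) + b * ((\<beta> * X1) * (\<beta> * X2)) + b * a2 * ((\<beta> * Y1) * (\<beta> * Y2)))"
    (is "\<not> p dvd ?V") if p: "prime p" "p dvd x\<^sup>2 + d * y\<^sup>2" for p
  proof -
    have odd: "odd p" using p(2) l dvd_trans by blast
    have na: "\<not> p dvd a"
    proof
      assume a: "p dvd a"
      then have "p dvd d * y\<^sup>2" by (simp add: y_def power2_eq_square)
      then have "p dvd (x\<^sup>2 + d * y\<^sup>2) - d * y\<^sup>2" using p(2) by (intro dvd_diff)
      then have "p dvd x" using p(1) prime_dvd_power by auto
      moreover have "p dvd d * y" using a by (simp add: y_def)
      ultimately show False using nxy p(1) by blast
    qed
    show ?thesis
    proof (cases "d = 2 \<and> p = 3 \<and> 3 dvd b")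
      case False
      note pl' = pl[OF p(1) odd p(2) False]
      have "\<not> p dvd y"
      proof
        assume y: "p dvd y"
        then have "p dvd d * y\<^sup>2" by (simp add: power2_eq_square)
        then have "p dvd (x\<^sup>2 + d * y\<^sup>2) - d * y\<^sup>2" using p(2) by (intro dvd_diff)
        then have "p dvd x" using p(1) prime_dvd_power by auto
        moreover have "p dvd d * y" using y by simp
        ultimately show False using nxy p(1) by blast
      qed
      then have "\<not> p dvd x * (a * \<mu>\<^sup>2 + \<beta>\<^sup>2 * q1) - d * y * (a * \<mu> * w + \<beta>\<^sup>2 * q2)"
        using hermitian_family_coprime[of D b X1 a2 Y1 d X2 Y2 \<mu> w a s \<beta> p] p odd ndd na pl' D2 beta
        unfolding c_def x_def y_def q1_def q2_def q3_def by blast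
      moreover have "x * (a * \<mu>\<^sup>2 + \<beta>\<^sup>2 * q1) - d * y * (a * \<mu> * w + \<beta>\<^sup>2 * q2) = ?V"
        unfolding q1_def q2_def by Groebner_Basis.algebra
      ultimately show ?thesis by simp
    next
      case True
      \<comment> \<open>Here 3 divides \<open>D\<close>, so \<open>hermitian_family_coprime\<close>
        does not apply. The prescribed residues make twice the expression \<open>3 a - 5 a^2\<close>
        modulo 3, which is nonzero as 3 does not divide \<open>a\<close>.\<close>
      then have *: "[\<mu> = 1] (mod 3)" "[w = 1] (mod 3)" "[s = 1] (mod 3)" "[b = 0] (mod 3)"
        using p3 by (auto simp: cong_iff_dvd_diff)
      have V2: "2 * ?V = ((\<mu>\<^sup>2 + 2 * w\<^sup>2) + a - a * 2 * s\<^sup>2) * (a * \<mu>\<^sup>2 + b * (\<beta> * X1)\<^sup>2 + b * a2 * (\<beta> * Y1)\<^sup>2)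
          - 2 * (2 * (a * s) * (a * (\<mu> * w) + b * ((\<beta> * X1) * (\<beta> * X2)) + b * a2 * ((\<beta> * Y1) * (\<beta> * Y2))))"
        using x2 True unfolding c_def y_def by Groebner_Basis.algebra
      have "[2 * ?V = ((1\<^sup>2 + 2 * 1\<^sup>2) + a - a * 2 * 1\<^sup>2) * (a * 1\<^sup>2 + 0 * (\<beta> * X1)\<^sup>2 + 0 * a2 * (\<beta> * Y1)\<^sup>2)
          - 2 * (2 * (a * 1) * (a * (1 * 1) + 0 * ((\<beta> * X1) * (\<beta> * X2)) + 0 * a2 * ((\<beta> * Y1) * (\<beta> * Y2))))] (mod 3)"
        unfolding V2 by (intro cong_add cong_diff cong_mult cong_pow cong_refl *)
      then have "[2 * ?V = 3 * a - 5 * a\<^sup>2] (mod 3)" by (simp add: algebra_simps power2_eq_square)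
      then have "3 dvd 2 * ?V - (3 * a - 5 * a\<^sup>2)" by (simp add: cong_iff_dvd_diff)
      then have "3 dvd ?V \<longrightarrow> 3 dvd a\<^sup>2"
        by presburger
      then show ?thesis using True na p(1) prime_dvd_power by blast
    qed
  qed
  show "\<not> (p dvd a * \<mu> \<and> p dvd b * (\<beta> * X1))" if p: "prime p" "odd p" for p
  proof
    assume *: "p dvd a * \<mu> \<and> p dvd b * (\<beta> * X1)"
    then have "p dvd a" using pm[OF p] p(1) prime_dvd_mult_iff by blast
    note pa' = pa[OF p this]
    have "\<not> p dvd b" using pa' unfolding D(1) by auto
    moreover have "\<not> p dvd \<beta>"
    proof
      assume "p dvd \<beta>"
      then have "p dvd 2 * (D * \<beta>) + a * (1 + d * s\<^sup>2)" using \<open>p dvd a\<close> by (intro dvd_add) auto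
      then show False using pa' cs by simp
    qed
    ultimately show False using * pa' p(1) prime_dvd_mult_iff by blast
  qed
qed

section \<open>Choice of the parameters of the family\<close>

lemma dvd_if_prime_powers_dvd:
  fixes n v :: int
  assumes "n \<noteq> 0" and "\<And>p. prime p \<Longrightarrow> p dvd n \<Longrightarrow> p ^ multiplicity p n dvd v"
  shows "n dvd v"
proof (cases "v = 0")
  case False
  from assms(1) show ?thesis
  proof (rule multiplicity_le_imp_dvd)
    fix p :: int assume p: "prime p"
    then have "\<not> is_unit p" using not_prime_unit by blast
    show "multiplicity p n \<le> multiplicity p v"
    proof (cases "p dvd n")
      case True
      show ?thesis by (rule multiplicity_geI) (use assms(2)[OF p True] False \<open>\<not> is_unit p\<close> in auto)
    qed (simp add: not_dvd_imp_multiplicity_0)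
  qed
qed simp

text \<open>If \<open>t\<close> = 1, 2, 3 all failed, two of them would fail with the same sign, and
  \<open>p\<close> would divide a difference \<open>3 d\<close>, \<open>5 d\<close> or
  \<open>8 d\<close>.\<close>

lemma exists_square_avoiding:
  fixes p d a :: int
  assumes "prime p" "\<not> p dvd 2" "\<not> p dvd 3" "\<not> p dvd 5" "\<not> p dvd d"
  shows "\<exists>t. \<not> p dvd d * t\<^sup>2 - a \<and> \<not> p dvd d * t\<^sup>2 + a"
proof (rule ccontr)
  assume "\<nexists>t. \<not> p dvd d * t\<^sup>2 - a \<and> \<not> p dvd d * t\<^sup>2 + a"
  then have t: "p dvd d * t\<^sup>2 - a \<or> p dvd d * t\<^sup>2 + a" for t by blast
  have "\<not> p dvd d * 3" "\<not> p dvd d * 5" "\<not> p dvd d * (2 * (2 * 2))"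
    using assms by (simp_all only: prime_dvd_mult_iff[OF assms(1)] simp_thms)
  moreover have "p dvd d * 3 \<or> p dvd d * 5 \<or> p dvd d * (2 * (2 * 2))"
  proof -
    have 1: "p dvd d * 1\<^sup>2 - a \<or> p dvd d * 1\<^sup>2 + a" by (rule t)
    have 2: "p dvd d * 2\<^sup>2 - a \<or> p dvd d * 2\<^sup>2 + a" by (rule t)
    have 3: "p dvd d * 3\<^sup>2 - a \<or> p dvd d * 3\<^sup>2 + a" by (rule t)
    have d12: "p dvd d * 3" if "p dvd d * 1\<^sup>2 + z" "p dvd d * 2\<^sup>2 + z" for z
      using dvd_diff[OF that(2,1)] by (simp add: algebra_simps)
    have d23: "p dvd d * 5" if "p dvd d * 2\<^sup>2 + z" "p dvd d * 3\<^sup>2 + z" for z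
      using dvd_diff[OF that(2,1)] by (simp add: algebra_simps)
    have d13: "p dvd d * (2 * (2 * 2))" if "p dvd d * 1\<^sup>2 + z" "p dvd d * 3\<^sup>2 + z" for z
      using dvd_diff[OF that(2,1)] by (simp add: algebra_simps)
    show ?thesis
      using 1 2 3 d12[of a] d12[of "- a"] d23[of a] d23[of "- a"] d13[of a] d13[of "- a"]
      by (simp only: diff_conv_add_uminus) argo
  qed
  ultimately show False by blast
qed

text \<open>The parameters are fixed in the order \<open>\<mu>\<close>, \<open>w\<close>,
  \<open>s\<close>, each by residues at the primes of quantities already known; then
  \<open>\<beta>\<close> is determined. \<open>r\<close> prescribes the parity of \<open>y\<close>
  when \<open>d = 2\<close>.\<close>

lemma hermitian_good_vector:
  fixes a b d a2 m X1 X2 Y1 Y2 r :: int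
  assumes d: "d = 1 \<or> d = 2" and a: "a > 0" "\<not> 4 dvd a" "d = 2 \<Longrightarrow> odd a \<and> \<not> 3 dvd a"
    and b: "b > 0" "odd b" and cop: "coprime a b" and a2: "a2 > 0"
    and sol: "b * m\<^sup>2 = X1\<^sup>2 + d * X2\<^sup>2 + a2 * (Y1\<^sup>2 + d * Y2\<^sup>2)"
    and Pm: "\<And>p. prime p \<Longrightarrow> p dvd 2 * a \<Longrightarrow> \<not> p dvd m" and PX: "\<And>p. prime p \<Longrightarrow> p dvd 2 * a \<Longrightarrow> \<not> p dvd X1"
    and P3: "d = 2 \<Longrightarrow> \<not> 3 dvd m"
  obtains x y \<mu> w \<beta> where
    "x\<^sup>2 + d * y\<^sup>2 = a * (\<mu>\<^sup>2 + d * w\<^sup>2) + b * ((\<beta> * X1)\<^sup>2 + d * (\<beta> * X2)\<^sup>2) + b * a2 * ((\<beta> * Y1)\<^sup>2 + d * (\<beta> * Y2)\<^sup>2)"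
    "coprime x (d * y)" "odd (x\<^sup>2 + d * y\<^sup>2)"
    "\<And>p. prime p \<Longrightarrow> p dvd x\<^sup>2 + d * y\<^sup>2 \<Longrightarrow>
      \<not> p dvd x * (a * \<mu>\<^sup>2 + b * (\<beta> * X1)\<^sup>2 + b * a2 * (\<beta> * Y1)\<^sup>2)
        - d * y * (a * (\<mu> * w) + b * ((\<beta> * X1) * (\<beta> * X2)) + b * a2 * ((\<beta> * Y1) * (\<beta> * Y2)))"
    "\<And>p. prime p \<Longrightarrow> odd p \<Longrightarrow> \<not> (p dvd a * \<mu> \<and> p dvd b * (\<beta> * X1))"
    "d = 1 \<Longrightarrow> even \<mu> \<and> odd (\<beta> * X1)" "d = 2 \<Longrightarrow> even (y - r)"
proof -
  define D where "D = b * m"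
  have two: "prime (2::int)" by simp
  have "odd m" "odd X1" using Pm[OF two] PX[OF two] by simp_all
  then have D0: "D \<noteq> 0" and Dodd: "odd D" using b by (auto simp: D_def)
  have paD: "\<not> p dvd D" if "prime p" "p dvd a" for p
  proof -
    have "\<not> p dvd m" using Pm[of p] that by simp
    moreover have "\<not> p dvd b" using that cop by (meson coprime_common_divisor not_prime_unit)
    ultimately show ?thesis unfolding D_def using that(1) prime_dvd_mult_iff by blast
  qed
  have pd: "\<not> p dvd d" if "prime p" "odd p" for p
    using d odd_prime_not_dvd_two[OF that] not_prime_unit[of p] that by auto
  have D3: "d = 2 \<Longrightarrow> 3 dvd D \<longleftrightarrow> 3 dvd b" unfolding D_def using P3 by (simp add: prime_dvd_mult_iff)
  \<comment> \<open>Full multiplicity at the primes of \<open>D\<close>, by which one will have to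
    divide; elsewhere residues modulo \<open>p\<close> suffice.\<close>
  define e where "e p = (if p dvd D then multiplicity p D else 1)" for p
  have edvd: "p dvd z" if "prime p" "p ^ e p dvd z" for p z
  proof -
    have "e p > 0" using prime_multiplicity_gt_zero_iff[OF prime_imp_prime_elem[OF that(1)] D0] by (simp add: e_def)
    then have "p dvd p ^ e p" by simp
    then show ?thesis using that(2) dvd_trans by blast
  qed
  have oddpow: "odd p" if "p dvd D" for p using that Dodd dvd_trans by blast

  \<comment> \<open>Residues for \<open>(\<mu>, w)\<close> at the primes of \<open>D\<close>. They
    make \<open>c = a\<close>, so that \<open>s = 0\<close> yields \<open>c = a (1 + d s^2)\<close>.
    At 3 with \<open>d = 2\<close> the value \<open>a\<close> may not be attained with a unit first
    entry; there \<open>c = 3 a\<close> goes with \<open>s = 1\<close>.\<close>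
  have "\<exists>c1 c2. \<not> p dvd c1 \<and> (if d = 2 \<and> p = 3 then 3 dvd c1 - 1 \<and> 3 dvd c2 - 1 \<and> p ^ e p dvd c1\<^sup>2 + d * c2\<^sup>2 - 3 * a
      else p ^ e p dvd c1\<^sup>2 + d * c2\<^sup>2 - a)" if p: "prime p" "p dvd D" for p
  proof (cases "d = 2 \<and> p = 3")
    case True
    define t where "t = (3 * a - 1) div 2"
    have "2 * t = 3 * a - 1" unfolding t_def using a(3) True by simp
    then have "3 dvd 1 - t" "3 * a = 1 + 2 * t" by presburger+
    then have t: "3 dvd 1\<^sup>2 - t" "3 * a = 1 + 2 * t" by simp_all
    obtain c2 where c2: "3 dvd c2 - 1" "3 ^ e 3 dvd c2\<^sup>2 - t"
      using square_root_mod_odd_prime_power[of 3 1 t "e 3"] t(1) by auto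
    have "3 ^ e 3 dvd 2 * (c2\<^sup>2 - t)" using c2(2) by (rule dvd_mult)
    then have "3 ^ e 3 dvd 1\<^sup>2 + 2 * c2\<^sup>2 - 3 * a" unfolding t(2) by (simp add: algebra_simps)
    then show ?thesis using True c2(1) by (intro exI[of _ 1] exI[of _ c2]) auto
  next
    case False
    have "\<not> p dvd a" using paD p by blast
    then show ?thesis
      using norm_form_unit_mod_prime_power[of p d a "e p"] p oddpow d False by auto
  qed
  then obtain k1 k2 where k: "\<And>p. prime p \<Longrightarrow> p dvd D \<Longrightarrow> \<not> p dvd k1 p"
    "\<And>p. prime p \<Longrightarrow> p dvd D \<Longrightarrow> \<not> (d = 2 \<and> p = 3) \<Longrightarrow> p ^ e p dvd (k1 p)\<^sup>2 + d * (k2 p)\<^sup>2 - a"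
    "\<And>p. prime p \<Longrightarrow> p dvd D \<Longrightarrow> d = 2 \<and> p = 3 \<Longrightarrow> 3 dvd k1 p - 1 \<and> 3 dvd k2 p - 1 \<and> p ^ e p dvd (k1 p)\<^sup>2 + d * (k2 p)\<^sup>2 - 3 * a"
    by metis

  have crt: "\<exists>z. \<forall>p. prime p \<longrightarrow> p dvd n \<longrightarrow> p ^ e p dvd z - f p" if "n \<noteq> 0" for n f
  proof -
    have "\<exists>z. \<forall>p\<in>prime_factors n. p ^ e p dvd z - f p"
      by (rule chinese_remainder_primes) auto
    then obtain z where "\<forall>p\<in>prime_factors n. p ^ e p dvd z - f p" by blast
    then show ?thesis using that by (intro exI[of _ z]) (auto simp: in_prime_factors_iff)
  qed

  have X10: "X1 \<noteq> 0" using \<open>odd X1\<close> by auto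
  \<comment> \<open>Odd primes of \<open>\<mu>\<close> are kept away from \<open>D\<close>,
    \<open>a\<close>, \<open>X1\<close>, and from 3 and 5 for \<open>exists_square_avoiding\<close>;
    the residue \<open>d - 1\<close> at 2 sets the parity.\<close>
  have "30 * D * a * X1 \<noteq> 0" using D0 X10 a by simp
  from crt[OF this, of "\<lambda>p. if p = 2 then d - 1 else if p dvd D then k1 p else 1"] obtain \<mu> where \<mu>: "\<And>p. prime p \<Longrightarrow> p dvd 30 * D * a * X1 \<Longrightarrow>
      p ^ e p dvd \<mu> - (if p = 2 then d - 1 else if p dvd D then k1 p else 1)" by blast
  have \<mu>2: "even (\<mu> - (d - 1))" using edvd[OF two \<mu>[OF two]] by simp
  have \<mu>D: "p ^ e p dvd \<mu> - k1 p" "\<not> p dvd \<mu>" if "prime p" "p dvd D" for p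
  proof -
    have "p \<noteq> 2" using oddpow that by auto
    then show *: "p ^ e p dvd \<mu> - k1 p" using \<mu>[of p] that by simp
    show "\<not> p dvd \<mu>"
    proof
      assume "p dvd \<mu>"
      then have "p dvd \<mu> - (\<mu> - k1 p)" using edvd[OF that(1) *] by (rule dvd_diff)
      then show False using k(1)[OF that] by simp
    qed
  qed
  have \<mu>1: "p dvd \<mu> - 1" if "prime p" "odd p" "p dvd 15 * a * X1" "\<not> p dvd D" for p
  proof -
    have "p dvd 2 * D * (15 * a * X1)" using that(3) by (rule dvd_mult)
    then have "p dvd 30 * D * a * X1" by (simp add: ac_simps)
    moreover have "p \<noteq> 2" using that(2) by auto
    ultimately show ?thesis using edvd[OF that(1) \<mu>[OF that(1)]] that(4) by simp
  qed
  have \<mu>n: "\<not> p dvd \<mu>" if "prime p" "odd p" "p dvd 15 * a * X1" for p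
  proof (cases "p dvd D")
    case False
    show ?thesis
    proof
      assume "p dvd \<mu>"
      then have "p dvd \<mu> - (\<mu> - 1)" using \<mu>1[OF that False] by (rule dvd_diff)
      then show False using that(1) not_prime_unit[of p] by simp
    qed
  qed (use \<mu>D that in blast)
  have \<mu>0: "\<mu> \<noteq> 0" using \<mu>n[of 5] by auto
  have \<mu>big: "\<not> p dvd 2 \<and> \<not> p dvd 3 \<and> \<not> p dvd 5 \<and> \<not> p dvd a \<and> \<not> p dvd X1 \<and> \<not> p dvd D"
    if p: "prime p" "odd p" "p dvd \<mu>" for p
  proof -
    have "\<not> p dvd 3 * (5 * (a * X1))" using \<mu>n[OF p(1,2)] p(3) by (auto simp: ac_simps)
    then have "\<not> p dvd 3" "\<not> p dvd 5" "\<not> p dvd a" "\<not> p dvd X1" by (meson dvd_mult dvd_mult2)+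
    then show ?thesis using \<mu>D(2) p odd_prime_not_dvd_two by blast
  qed

  have "\<exists>t. \<not> p dvd d * t\<^sup>2 - a \<and> \<not> p dvd d * t\<^sup>2 + a" if "prime p" "odd p" "p dvd \<mu>" for p
    using exists_square_avoiding[of p d a] \<mu>big[OF that] pd[OF that(1,2)] that(1) by blast
  then obtain T where T: "\<And>p. prime p \<Longrightarrow> odd p \<Longrightarrow> p dvd \<mu> \<Longrightarrow> \<not> p dvd d * (T p)\<^sup>2 - a \<and> \<not> p dvd d * (T p)\<^sup>2 + a"
    by metis
  \<comment> \<open>Parity of \<open>w\<close>: even for \<open>d = 1\<close>. For
    \<open>d = 2\<close>, \<open>c - a (1 + 2 s^2)\<close> is \<open>1 + 2 w - a - 2 s\<close>
    modulo 4, which this choice makes vanish when \<open>s\<close> has the parity of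
    \<open>r\<close>.\<close>
  define \<omega> where "\<omega> = (r + (a - 1) div 2) * (d - 1)"
  define K where "K = 6 * D * a * \<mu>"
  have K0: "K \<noteq> 0" using D0 \<mu>0 a by (simp add: K_def)
  from crt[OF this, of "\<lambda>p. if p = 2 then \<omega> else if p dvd D then k2 p else if p dvd a then 0 else if d = 2 \<and> p = 3 then 1 else T p"]
  obtain w0 where w0: "\<And>p. prime p \<Longrightarrow> p dvd K \<Longrightarrow> p ^ e p dvd w0 -
      (if p = 2 then \<omega> else if p dvd D then k2 p else if p dvd a then 0 else if d = 2 \<and> p = 3 then 1 else T p)" by blast
  define q1 where "q1 = b * (X1\<^sup>2 + a2 * Y1\<^sup>2)"
  define q2 where "q2 = b * (X1 * X2 + a2 * (Y1 * Y2))"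
  define q3 where "q3 = b * (X2\<^sup>2 + a2 * Y2\<^sup>2)"
  have "X1\<^sup>2 + a2 * Y1\<^sup>2 > 0" using X10 a2 by (simp add: add_pos_nonneg)
  then have q10: "q1 > 0" using b by (simp add: q1_def)
  have KpD: "p ^ e p dvd K" if "prime p" "p dvd K" for p
  proof (cases "p dvd D")
    case True
    then have "p ^ e p dvd D" by (simp add: e_def multiplicity_dvd)
    then show ?thesis by (simp add: K_def)
  qed (use that in \<open>simp add: e_def\<close>)
  \<comment> \<open>A shift by \<open>K\<close> respects all residues and makes
    \<open>q1 * w - q2 * \<mu>\<close> nonzero, hence \<open>E\<close> too; the primes of
    \<open>E\<close> can then be treated in the choice of \<open>s\<close>.\<close>
  obtain w where w: "\<And>p. prime p \<Longrightarrow> p dvd K \<Longrightarrow> p ^ e p dvd w -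
      (if p = 2 then \<omega> else if p dvd D then k2 p else if p dvd a then 0 else if d = 2 \<and> p = 3 then 1 else T p)"
    and I0: "q1 * w - q2 * \<mu> \<noteq> 0"
  proof (cases "q1 * w0 - q2 * \<mu> = 0")
    case False
    then show ?thesis using that w0 by blast
  next
    case True
    have "q1 * (w0 + K) - q2 * \<mu> = q1 * K" using True by (simp add: algebra_simps)
    then have "q1 * (w0 + K) - q2 * \<mu> \<noteq> 0" using q10 K0 by simp
    moreover have "p ^ e p dvd (w0 + K) - (if p = 2 then \<omega> else if p dvd D then k2 p else if p dvd a then 0
        else if d = 2 \<and> p = 3 then 1 else T p)" if "prime p" "p dvd K" for p
      using dvd_add[OF w0[OF that] KpD[OF that]] by (simp only: algebra_simps)
    ultimately show ?thesis using that by blast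
  qed
  define c where "c = \<mu>\<^sup>2 + d * w\<^sup>2"
  define E where "E = (d * (q3 * \<mu> - q2 * w))\<^sup>2 + d * (q1 * w - q2 * \<mu>)\<^sup>2"
  have c0: "c > 0" using \<mu>0 d by (auto simp: c_def add_pos_nonneg)
  have E0: "E > 0" using I0 d by (auto simp: E_def add_nonneg_pos)
  have w2: "even (w - \<omega>)" using edvd[OF two w[OF two]] by (simp add: K_def)
  have wD: "p ^ e p dvd w - k2 p" if "prime p" "p dvd D" for p
  proof -
    have "p \<noteq> 2" using oddpow that by auto
    then show ?thesis using w[of p] that by (simp add: K_def)
  qed
  have cdiff: "z dvd c - (\<mu>'\<^sup>2 + d * w'\<^sup>2)" if "z dvd \<mu> - \<mu>'" "z dvd w - w'" for z \<mu>' w'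
  proof -
    have "c - (\<mu>'\<^sup>2 + d * w'\<^sup>2) = (\<mu> - \<mu>') * (\<mu> + \<mu>') + (w - w') * (d * (w + w'))"
      unfolding c_def by Groebner_Basis.algebra
    then show ?thesis using dvd_add[OF dvd_mult2[OF that(1)] dvd_mult2[OF that(2)]] by simp
  qed
  have cD: "p ^ e p dvd c - (if d = 2 \<and> p = 3 then 3 * a else a)" if p: "prime p" "p dvd D" for p
  proof -
    have "p ^ e p dvd c - ((k1 p)\<^sup>2 + d * (k2 p)\<^sup>2)" using cdiff \<mu>D(1) wD p by blast
    moreover have "p ^ e p dvd (k1 p)\<^sup>2 + d * (k2 p)\<^sup>2 - (if d = 2 \<and> p = 3 then 3 * a else a)"
      using k(2,3)[OF p] by simp
    ultimately have "p ^ e p dvd (c - ((k1 p)\<^sup>2 + d * (k2 p)\<^sup>2)) + ((k1 p)\<^sup>2 + d * (k2 p)\<^sup>2 - (if d = 2 \<and> p = 3 then 3 * a else a))"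
      by (rule dvd_add)
    then show ?thesis by simp
  qed
  have ca: "p dvd c - 1" if p: "prime p" "odd p" "p dvd a" for p
  proof -
    have "\<not> p dvd D" using paD p by blast
    moreover have "p dvd K" using p by (simp add: K_def)
    moreover have "p \<noteq> 2" using p by auto
    ultimately have "p dvd w - 0" using edvd[OF p(1) w[OF p(1)]] p by auto
    moreover have "p dvd \<mu> - 1" using \<mu>1[OF p(1,2)] p(3) \<open>\<not> p dvd D\<close> by simp
    ultimately have "p dvd c - (1\<^sup>2 + d * 0\<^sup>2)" using cdiff by blast
    then show ?thesis by simp
  qed
  have mod3: "3 dvd \<mu> - 1" "3 dvd w - 1" if "d = 2"
  proof -
    have three: "prime (3::int)" by simp
    have "3 dvd \<mu> - 1 \<and> 3 dvd w - 1"
    proof (cases "3 dvd D")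
      case True
      have u: "3 dvd \<mu> - k1 3" "3 dvd w - k2 3" using edvd[OF three] \<mu>D(1)[OF three True] wD[OF three True] by blast+
      have v: "3 dvd k1 3 - 1" "3 dvd k2 3 - 1" using k(3)[OF three True] that by auto
      show ?thesis using dvd_add[OF u(1) v(1)] dvd_add[OF u(2) v(2)] by simp
    next
      case False
      have "3 dvd \<mu> - 1" using \<mu>1[OF three _ _ False] by simp
      moreover have "3 dvd K" by (simp add: K_def)
      then have "3 dvd w - 1" using edvd[OF three w[OF three]] False a(3) that by simp
      ultimately show ?thesis ..
    qed
    then show "3 dvd \<mu> - 1" "3 dvd w - 1" by auto
  qed
  have c3: "3 dvd c" "\<not> 3 dvd c + a" if "d = 2"
  proof -
    have "3 dvd c - (1\<^sup>2 + d * 1\<^sup>2)" using cdiff mod3 that by blast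
    then show "3 dvd c" unfolding that by simp presburger
    then show "\<not> 3 dvd c + a" using a(3) that by (simp add: dvd_add_right_iff)
  qed
  have cDa: "\<not> p dvd c + a" if p: "prime p" "p dvd D" for p
  proof (cases "d = 2 \<and> p = 3")
    case False
    then have "p dvd c - a" using edvd[OF p(1) cD[OF p]] by (simp only: if_False)
    moreover have "\<not> p dvd 2 * a"
      using p paD oddpow odd_prime_not_dvd_two prime_dvd_mult_iff by blast
    ultimately show ?thesis using dvd_diff[of p "c + a" "c - a"] by auto
  qed (use c3 in auto)
  have c\<mu>: "\<not> p dvd c - a" "\<not> p dvd c + a" if p: "prime p" "odd p" "p dvd \<mu>" for p
  proof -
    have "p dvd K" using p by (simp add: K_def)
    moreover have "p \<noteq> 2" "p \<noteq> 3" using p \<mu>big[OF p] by auto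
    ultimately have "p dvd w - T p" using edvd[OF p(1) w[OF p(1)]] \<mu>big[OF p] by simp
    then have *: "p dvd c - (0\<^sup>2 + d * (T p)\<^sup>2)" using cdiff[of p 0] p by simp
    show "\<not> p dvd c - a"
    proof
      assume "p dvd c - a"
      from dvd_diff[OF this *] show False using T[OF p] by simp
    qed
    show "\<not> p dvd c + a"
    proof
      assume "p dvd c + a"
      from dvd_diff[OF this *] show False using T[OF p] by (simp add: add.commute)
    qed
  qed
  \<comment> \<open>By default \<open>s = 0\<close> modulo \<open>p\<close>: then
    \<open>2 x = c + a\<close> is a unit and \<open>p\<close> cannot divide
    \<open>x^2 + d y^2\<close>. At primes of \<open>c + a\<close> this would put \<open>p\<close>
    into both \<open>x\<close> and \<open>y\<close>, so \<open>s = 2\<close> there. The residue 1 at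
    3 matches \<open>c = 3 a\<close>.\<close>
  define S where "S = 2 * D * a * c * E * \<mu> * (c + a)"
  have "S \<noteq> 0" using D0 a c0 E0 \<mu>0 by (simp add: S_def)
  from crt[OF this, of "\<lambda>p. if p = 2 then (if d = 1 then a else r) else if d = 2 \<and> p = 3 \<and> 3 dvd D then 1 else if p dvd c + a then 2 else 0"]
  obtain s where s: "\<And>p. prime p \<Longrightarrow> p dvd S \<Longrightarrow> p ^ e p dvd s -
      (if p = 2 then (if d = 1 then a else r) else if d = 2 \<and> p = 3 \<and> 3 dvd D then 1 else if p dvd c + a then 2 else 0)" by blast
  have s2: "even (s - (if d = 1 then a else r))" using edvd[OF two s[OF two]] by (simp add: S_def)
  have s3: "3 dvd s - 1" "3 ^ e 3 dvd s - 1" if "d = 2" "3 dvd D"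
  proof -
    have "3 dvd S" using that by (simp add: S_def)
    then show "3 ^ e 3 dvd s - 1" using s[of 3] that by simp
    then show "3 dvd s - 1" using edvd[of 3] by simp
  qed
  have sca: "p dvd s - 2" if "prime p" "odd p" "p dvd c + a" for p
  proof -
    have n: "p dvd S" "p \<noteq> 2" "\<not> (d = 2 \<and> p = 3 \<and> 3 dvd D)" using that c3 by (auto simp: S_def)
    show ?thesis
      using edvd[OF that(1) s[OF that(1) n(1)]] by (simp only: if_not_P[OF n(2)] if_not_P[OF n(3)] if_P[OF that(3)])
  qed
  have s0: "p ^ e p dvd s" if "prime p" "odd p" "\<not> p dvd c + a" "\<not> (d = 2 \<and> p = 3 \<and> 3 dvd D)"
    "p dvd D \<or> p dvd a \<or> p dvd c \<or> p dvd E \<or> p dvd \<mu>" for p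
  proof -
    have "p dvd S" "p \<noteq> 2" using that by (auto simp: S_def)
    then show ?thesis using s[OF that(1)] that(3,4) by simp
  qed
  have "D dvd c - a * (1 + d * s\<^sup>2)"
  proof (rule dvd_if_prime_powers_dvd[OF D0])
    fix p assume p: "prime p" "p dvd D"
    have "p ^ e p dvd c - a * (1 + d * s\<^sup>2)"
    proof (cases "d = 2 \<and> p = 3")
      case True
      then have "p ^ e p dvd s - 1" using s3(2) p by simp
      then have "p ^ e p dvd (c - 3 * a) - (s - 1) * (2 * a * (s + 1))"
        by (rule dvd_diff[OF cD[OF p, unfolded if_P[OF True]] dvd_mult2])
      moreover have "(c - 3 * a) - (s - 1) * (2 * a * (s + 1)) = c - a * (1 + d * s\<^sup>2)"
        using True by (simp add: power2_eq_square algebra_simps)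
      ultimately show ?thesis by simp
    next
      case False
      have "p ^ e p dvd s" using s0[OF p(1) oddpow[OF p(2)] cDa[OF p]] False p by blast
      then have "p ^ e p dvd (c - a) - s * (a * d * s)" 
        by (rule dvd_diff[OF cD[OF p, unfolded if_not_P[OF False]] dvd_mult2])
      moreover have "(c - a) - s * (a * d * s) = c - a * (1 + d * s\<^sup>2)"
        by (simp add: power2_eq_square algebra_simps)
      ultimately show ?thesis by simp
    qed
    then show "p ^ multiplicity p D dvd c - a * (1 + d * s\<^sup>2)" using p by (simp add: e_def)
  qed
  then obtain B where B: "c - a * (1 + d * s\<^sup>2) = D * B" by blast
  \<comment> \<open>This makes \<open>\<beta>\<close> odd for \<open>d = 1\<close> and even for
    \<open>d = 2\<close>, from which \<open>x^2 + d y^2\<close> is odd.\<close>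
  have par: "4 dvd D * B - (if d = 1 then 2 else 0)"
  proof (cases "d = 1")
    case True
    have "even \<mu>" "even w" using \<mu>2 w2 True by (simp_all add: \<omega>_def)
    then obtain \<mu>' w' where "\<mu> = 2 * \<mu>'" "w = 2 * w'" by (meson evenE)
    then have "c = 4 * (\<mu>'\<^sup>2 + w'\<^sup>2)" unfolding c_def True by (simp add: power_mult_distrib)
    then have "4 dvd c" by simp
    moreover have "4 dvd a * (1 + s\<^sup>2) - 2"
    proof (cases "even a")
      case False
      then have "odd s" using s2 True by simp
      then obtain j where "s = 2 * j + 1" by (rule oddE)
      then have "a * (1 + s\<^sup>2) - 2 = 2 * (a - 1) + 4 * (a * (j\<^sup>2 + j))"
        by (simp add: power2_eq_square algebra_simps)
      moreover have "4 dvd 2 * (a - 1)" using False by presburger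
      ultimately show ?thesis by (metis dvd_add dvd_triv_left)
    next
      case True
      then have "even s" using s2 \<open>d = 1\<close> by simp
      then obtain j where "s = 2 * j" by (rule evenE)
      then have "a * (1 + s\<^sup>2) - 2 = (a - 2) + 4 * (a * j\<^sup>2)" by (simp add: power2_eq_square algebra_simps)
      moreover have "4 dvd a - 2" using True a(2) by presburger
      ultimately show ?thesis by (metis dvd_add dvd_triv_left)
    qed
    ultimately have "4 dvd c - (a * (1 + s\<^sup>2) - 2) - 4" by (rule dvd_diff[OF dvd_diff dvd_refl])
    then show ?thesis using B True by (simp add: algebra_simps)
  next
    case False
    then have d2: "d = 2" using d by simp
    then have ao: "odd a" using a(3) by simp
    have "odd \<mu>" using \<mu>2 d2 by simp
    then obtain i where i: "\<mu> = 2 * i + 1" by (rule oddE)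
    have "even (w\<^sup>2 - w)" "even (a * s\<^sup>2 - s)" using ao by auto
    then obtain j k where jk: "w\<^sup>2 = w + 2 * j" "a * s\<^sup>2 = s + 2 * k" by (metis evenE diff_eq_eq add.commute)
    have "D * B = c - a - 2 * (a * s\<^sup>2)" using B d2 by (simp add: algebra_simps)
    also have "\<dots> = 1 + 2 * w - a - 2 * s + 4 * (i\<^sup>2 + i + j - k)"
      unfolding c_def d2 jk i by (simp add: power2_eq_square algebra_simps)
    finally have "D * B = (1 + 2 * w - a - 2 * s) + 4 * (i\<^sup>2 + i + j - k)" .
    moreover have "4 dvd 1 + 2 * w - a - 2 * s"
    proof -
      have "even (w - (r + (a - 1) div 2))" "even (s - r)" using w2 s2 d2 by (simp_all add: \<omega>_def)
      then show ?thesis using ao by presburger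
    qed
    ultimately show ?thesis using False by simp
  qed
  have "even (D * B)"
  proof -
    have "even (D * B - (if d = 1 then 2 else 0))" using par by (meson dvd_trans even_numeral)
    then show ?thesis by (auto split: if_splits)
  qed
  then have "even B" using Dodd by simp
  then obtain \<beta> where \<beta>: "B = 2 * \<beta>" by (rule evenE)
  have beta: "c - a * (1 + d * s\<^sup>2) = 2 * (D * \<beta>)" using B \<beta> by simp
  have bpar: "odd \<beta> \<longleftrightarrow> d = 1"
  proof -
    have "4 dvd 2 * (D * \<beta>) - (if d = 1 then 2 else 0)" using par \<beta> by (simp add: mult.left_commute)
    moreover have "odd z" if "4 dvd 2 * z - 2" for z :: int using that by presburger
    moreover have "even z" if "4 dvd 2 * z - 0" for z :: int using that by presburger
    ultimately have "odd (D * \<beta>) \<longleftrightarrow> d = 1" by (cases "d = 1") (metis (full_types))+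
    then show ?thesis using Dodd by simp
  qed
  define x where "x = D * \<beta> + a"
  define y where "y = a * s"
  have lodd: "odd (x\<^sup>2 + d * y\<^sup>2)"
  proof (cases "d = 1")
    case True
    then show ?thesis using bpar Dodd s2 by (auto simp: x_def y_def)
  next
    case False
    then show ?thesis using bpar d a(3) by (auto simp: x_def)
  qed
  have x2: "2 * x = c + a - a * d * s\<^sup>2" using beta by (simp add: x_def algebra_simps)
  have pl: "\<not> p dvd D \<and> \<not> p dvd c \<and> \<not> p dvd E"
    if p: "prime p" "odd p" "p dvd x\<^sup>2 + d * y\<^sup>2" "\<not> (d = 2 \<and> p = 3 \<and> 3 dvd b)" for p
  proof (rule ccontr)
    assume "\<not> (\<not> p dvd D \<and> \<not> p dvd c \<and> \<not> p dvd E)"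
    then have pD: "p dvd D \<or> p dvd a \<or> p dvd c \<or> p dvd E \<or> p dvd \<mu>" by blast
    have sp: "\<not> (d = 2 \<and> p = 3 \<and> 3 dvd D)" using p(4) D3 by blast
    show False
    proof (cases "p dvd c + a")
      case False
      then have ps: "p dvd s" using s0[OF p(1,2) False sp pD] edvd p(1) by blast
      then have "p dvd d * y\<^sup>2" by (simp add: y_def power2_eq_square)
      with p(3) have "p dvd (x\<^sup>2 + d * y\<^sup>2) - d * y\<^sup>2" by (rule dvd_diff)
      then have "p dvd x" using p(1) prime_dvd_power by auto
      then have "p dvd 2 * x + a * d * s\<^sup>2" using ps by (intro dvd_add) (auto simp: power2_eq_square)
      then show False using x2 False by simp
    next
      case True
      have ps: "p dvd s - 2" by (rule sca[OF p(1,2) True])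
      \<comment> \<open>For \<open>s = 2\<close> and \<open>c = - a\<close> modulo \<open>p\<close>,
        the value \<open>4 (x^2 + d y^2)\<close> reduces to \<open>16 a^2 d (d + 1)\<close>.\<close>
      have "4 * (x\<^sup>2 + d * y\<^sup>2) = (2 * x)\<^sup>2 + 4 * d * y\<^sup>2" by Groebner_Basis.algebra
      also have "\<dots> = (c + a) * (c + a - 2 * a * d * s\<^sup>2) + a\<^sup>2 * d * (s\<^sup>2 * (d * s\<^sup>2 + 4))"
        unfolding x2 y_def by Groebner_Basis.algebra
      also have "\<dots> = (c + a) * (c + a - 2 * a * d * s\<^sup>2) + (s - 2) * (a\<^sup>2 * d * (s + 2) * (d * (s\<^sup>2 + 4) + 4))
          + a * (a * (d * (2 * (2 * (2 * (2 * (d + 1)))))))"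
        by Groebner_Basis.algebra
      finally have eq: "a * (a * (d * (2 * (2 * (2 * (2 * (d + 1))))))) = 4 * (x\<^sup>2 + d * y\<^sup>2)
          - (c + a) * (c + a - 2 * a * d * s\<^sup>2) - (s - 2) * (a\<^sup>2 * d * (s + 2) * (d * (s\<^sup>2 + 4) + 4))" by simp
      have "p dvd a * (a * (d * (2 * (2 * (2 * (2 * (d + 1)))))))"
        unfolding eq by (rule dvd_diff[OF dvd_diff[OF dvd_mult[OF p(3)] dvd_mult2[OF True]] dvd_mult2[OF ps]])
      then have "p dvd a \<or> p dvd d + 1"
        using pd[OF p(1,2)] odd_prime_not_dvd_two[OF p(1,2)] by (simp only: prime_dvd_mult_iff[OF p(1)]) blast
      then show False
      proof
        assume pa: "p dvd a"
        have "p dvd (c + a) - a - (c - 1)" by (rule dvd_diff[OF dvd_diff[OF True pa] ca[OF p(1,2) pa]])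
        then show False using p(1) not_prime_unit[of p] by simp
      next
        assume *: "p dvd d + 1"
        show False
        proof (cases "d = 1")
          case True
          then show False using * odd_prime_not_dvd_two[OF p(1,2)] by simp
        next
          case False
          then have "d = 2" using d by simp
          then have "p = 3" using * p(1) primes_dvd_imp_eq[of p 3] by simp
          then show False using c3 \<open>d = 2\<close> True by simp
        qed
      qed
    qed
  qed
  have pa: "\<not> p dvd c \<and> \<not> p dvd D \<and> \<not> p dvd X1" if p: "prime p" "odd p" "p dvd a" for p
  proof -
    have "\<not> p dvd c"
    proof
      assume "p dvd c"
      then have "p dvd c - (c - 1)" using ca[OF p] by (rule dvd_diff)
      then show False using p(1) not_prime_unit[of p] by simp
    qed
    then show ?thesis using paD[OF p(1,3)] PX[OF p(1)] p(3) by simp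
  qed
  have ps: "\<not> p dvd s" if p: "prime p" "odd p" "p dvd c + a" for p
  proof
    assume "p dvd s"
    then have "p dvd s - (s - 2)" using sca[OF p] by (rule dvd_diff)
    then show False using odd_prime_not_dvd_two[OF p(1,2)] by simp
  qed
  have p3: "3 dvd \<mu> - 1 \<and> 3 dvd w - 1 \<and> 3 dvd s - 1" if "d = 2" "3 dvd b"
    using mod3 s3 D3 that by blast
  have pm: "\<not> p dvd b * (\<beta> * X1)" if p: "prime p" "odd p" "p dvd \<mu>" for p
  proof -
    have "p \<noteq> 3" using \<mu>big[OF p] by auto
    then have "p dvd s" using s0[OF p(1,2) c\<mu>(2)[OF p]] edvd p by blast
    \<comment> \<open>As \<open>s = 0\<close> modulo \<open>p\<close>, \<open>2 D \<beta>\<close> is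
      \<open>c - a\<close>, which the choice of \<open>T p\<close> keeps prime to
      \<open>p\<close>.\<close>
    have "\<not> p dvd \<beta>"
    proof
      assume "p dvd \<beta>"
      then have "p dvd 2 * (D * \<beta>) + a * d * s\<^sup>2" using \<open>p dvd s\<close> by (intro dvd_add) (auto simp: power2_eq_square)
      moreover have "2 * (D * \<beta>) + a * d * s\<^sup>2 = c - a" using beta by (simp add: algebra_simps)
      ultimately show False using c\<mu>(1)[OF p] by simp
    qed
    moreover have "\<not> p dvd b" using \<mu>big[OF p] by (auto simp: D_def)
    ultimately show ?thesis using \<mu>big[OF p] p(1) prime_dvd_mult_iff by blast
  qed
  have y: "d = 2 \<Longrightarrow> even (y - r)" using s2 a(3) by (simp add: y_def)
  have \<mu>X: "d = 1 \<Longrightarrow> even \<mu> \<and> odd (\<beta> * X1)" using \<mu>2 bpar \<open>odd X1\<close> by simp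
  note fam = hermitian_family[OF d D_def sol beta[unfolded c_def] lodd[unfolded x_def y_def] pa[unfolded c_def]
      ps[unfolded c_def] pl[unfolded c_def x_def y_def E_def q1_def q2_def q3_def] p3 pm]
  show ?thesis
    by (rule that[OF fam(1) fam(2) lodd[unfolded x_def y_def] fam(3) fam(4)])
      (use \<mu>X y in \<open>simp_all add: y_def\<close>)
qed

subsection \<open>Sums of three squares\<close>

text \<open>Three quaternions with real parts \<open>p\<close> and vector parts \<open>u i + v j + t k\<close> have squares adding up to
  \<open>\<alpha>0 + 2 (\<alpha>1 i + \<alpha>2 j + \<alpha>3 k)\<close>.\<close>

definition sum_of_three_squares :: "int \<Rightarrow> int \<Rightarrow> int \<Rightarrow> int \<Rightarrow> int \<Rightarrow> int \<Rightarrow> bool" where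
  "sum_of_three_squares a b \<alpha>0 \<alpha>1 \<alpha>2 \<alpha>3 \<longleftrightarrow> (\<exists>p1 p2 p3 u1 u2 u3 v1 v2 v3 t1 t2 t3.
     p1 * u1 + p2 * u2 + p3 * u3 = \<alpha>1 \<and> p1 * v1 + p2 * v2 + p3 * v3 = \<alpha>2 \<and> p1 * t1 + p2 * t2 + p3 * t3 = \<alpha>3 \<and>
     p1\<^sup>2 + p2\<^sup>2 + p3\<^sup>2 - a * (u1\<^sup>2 + u2\<^sup>2 + u3\<^sup>2) - b * (v1\<^sup>2 + v2\<^sup>2 + v3\<^sup>2) - a * b * (t1\<^sup>2 + t2\<^sup>2 + t3\<^sup>2) = \<alpha>0)"

lemma sum_of_three_squaresI:
  assumes "p1 * u1 + p2 * u2 + p3 * u3 = \<alpha>1" "p1 * v1 + p2 * v2 + p3 * v3 = \<alpha>2" "p1 * t1 + p2 * t2 + p3 * t3 = \<alpha>3"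
    "p1\<^sup>2 + p2\<^sup>2 + p3\<^sup>2 - a * (u1\<^sup>2 + u2\<^sup>2 + u3\<^sup>2) - b * (v1\<^sup>2 + v2\<^sup>2 + v3\<^sup>2) - a * b * (t1\<^sup>2 + t2\<^sup>2 + t3\<^sup>2) = \<alpha>0"
  shows "sum_of_three_squares a b \<alpha>0 \<alpha>1 \<alpha>2 \<alpha>3"
  using assms unfolding sum_of_three_squares_def by blast

lemma bezout3:
  fixes A B C :: int
  assumes "\<And>p. prime p \<Longrightarrow> p dvd A \<Longrightarrow> p dvd B \<Longrightarrow> p dvd C \<Longrightarrow> False"
  obtains u v w where "u * A + v * B + w * C = 1"
proof -
  have "coprime A (gcd B C)" by (rule coprime_int_primeI) (use assms in auto)
  then obtain u z where uz: "u * A + z * gcd B C = 1" using bezout_int[of A "gcd B C"] by auto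
  obtain v w where "v * B + w * C = gcd B C" using bezout_int[of B C] by auto
  then have "u * A + z * (v * B + w * C) = 1" using uz by simp
  then have "u * A + (z * v) * B + (z * w) * C = 1" by (simp add: algebra_simps)
  then show ?thesis using that by blast
qed

text \<open>The isotropic direction is \<open>(l, 0, 0)\<close> on the real parts
  \<open>(u + n l, - y, x)\<close> and \<open>(0, \<mu> x - w y, w x + \<mu> y)\<close> on each
  coefficient vector. Along it the form takes the values
  \<open>V u g h + 2 n \<sigma> u g h\<close>; the free \<open>u\<close>, \<open>g\<close>,
  \<open>h\<close> set \<open>\<sigma>\<close> to 1 or 2 and correct \<open>V\<close>.\<close>

lemma three_squares_gaussian:
  fixes a b x y \<mu>1 \<mu>2 \<mu>3 w1 w2 w3 \<alpha>0 \<alpha>1 \<alpha>2 \<alpha>3 l :: int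
  assumes l: "l = x\<^sup>2 + y\<^sup>2" "l = a * (\<mu>1\<^sup>2 + w1\<^sup>2) + b * (\<mu>2\<^sup>2 + w2\<^sup>2) + a * b * (\<mu>3\<^sup>2 + w3\<^sup>2)" "odd l"
    and cop: "coprime x y"
    and pl: "\<And>p. prime p \<Longrightarrow> p dvd l \<Longrightarrow> \<not> p dvd x * (a * \<mu>1\<^sup>2 + b * \<mu>2\<^sup>2 + a * b * \<mu>3\<^sup>2)
        - y * (a * (\<mu>1 * w1) + b * (\<mu>2 * w2) + a * b * (\<mu>3 * w3))"
    and pm: "\<And>p. prime p \<Longrightarrow> odd p \<Longrightarrow> \<not> (p dvd a * \<mu>1 \<and> p dvd b * \<mu>2)"
    and par: "\<not> 4 dvd a" "odd b" "even \<mu>1" "odd \<mu>2"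
  shows "sum_of_three_squares a b \<alpha>0 \<alpha>1 \<alpha>2 \<alpha>3"
proof -
  obtain e2 f where "e2 * x + f * y = 1" using bezout_int[of x y] cop by auto
  then obtain e1 where e: "x * e2 - y * e1 = 1" by (metis add.commute diff_minus_eq_add mult.commute mult_minus_right)
  \<comment> \<open>\<open>x k = y\<close> modulo \<open>l\<close>, so modulo \<open>l\<close> the
    expression in \<open>pl\<close> is \<open>x Z\<close>.\<close>
  define k where "k = e1 * x + e2 * y"
  define Q1 where "Q1 = a * \<mu>1\<^sup>2 + b * \<mu>2\<^sup>2 + a * b * \<mu>3\<^sup>2"
  define Q2 where "Q2 = a * (\<mu>1 * w1) + b * (\<mu>2 * w2) + a * b * (\<mu>3 * w3)"
  define Z where "Z = Q1 - k * Q2"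
  define C where "C = a * \<alpha>1 * (w1 + k * \<mu>1) + b * \<alpha>2 * (w2 + k * \<mu>2) + a * b * \<alpha>3 * (w3 + k * \<mu>3)"
  define \<sigma> where "\<sigma> u g h = u * Z - C - l * (a * \<mu>1 * g + b * \<mu>2 * h)" for u g h
  \<comment> \<open>Particular solution of a linear equation: \<open>(e1, e2)\<close> has product 1
    with \<open>(- y, x)\<close>, and \<open>(x, y)\<close> is orthogonal to it, which leaves
    \<open>g\<close> free.\<close>
  define M1 where "M1 \<alpha> w u g = (\<alpha> + u * w) * e1 + g * x" for \<alpha> w u g
  define M2 where "M2 \<alpha> w u g = (\<alpha> + u * w) * e2 + g * y" for \<alpha> w u g
  define V where "V u g h = u\<^sup>2 + l - a * (w1\<^sup>2 + (M1 \<alpha>1 w1 u g)\<^sup>2 + (M2 \<alpha>1 w1 u g)\<^sup>2)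
      - b * (w2\<^sup>2 + (M1 \<alpha>2 w2 u h)\<^sup>2 + (M2 \<alpha>2 w2 u h)\<^sup>2) - a * b * (w3\<^sup>2 + (M1 \<alpha>3 w3 u 0)\<^sup>2 + (M2 \<alpha>3 w3 u 0)\<^sup>2)" for u g h
  have inner: "M1 \<alpha> w u g * (\<mu> * x - w * y) + M2 \<alpha> w u g * (w * x + \<mu> * y) = (\<alpha> + u * w) * (w + k * \<mu>) + g * (l * \<mu>)" for \<alpha> w u g \<mu>
    unfolding M1_def M2_def k_def l(1) using e by Groebner_Basis.algebra
  have dot: "(u + n * l) * (- w) + (- y) * (M1 \<alpha> w u g + n * (\<mu> * x - w * y)) + x * (M2 \<alpha> w u g + n * (w * x + \<mu> * y)) = \<alpha>" for \<alpha> w u g \<mu> n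
    unfolding M1_def M2_def l(1) using e by Groebner_Basis.algebra
  have sq: "(\<mu> * x - w * y)\<^sup>2 + (w * x + \<mu> * y)\<^sup>2 = l * (\<mu>\<^sup>2 + w\<^sup>2)" for \<mu> w
    unfolding l(1) by Groebner_Basis.algebra
  have step: "sum_of_three_squares a b (V u g h + 2 * n * \<sigma> u g h) \<alpha>1 \<alpha>2 \<alpha>3" for u g h n
  proof (rule sum_of_three_squaresI[OF dot[of u n w1 \<alpha>1 g \<mu>1] dot[of u n w2 \<alpha>2 h \<mu>2] dot[of u n w3 \<alpha>3 0 \<mu>3]])
    have s: "\<sigma> u g h = u * l - a * ((\<alpha>1 + u * w1) * (w1 + k * \<mu>1) + g * (l * \<mu>1))
        - b * ((\<alpha>2 + u * w2) * (w2 + k * \<mu>2) + h * (l * \<mu>2)) - a * b * ((\<alpha>3 + u * w3) * (w3 + k * \<mu>3) + 0 * (l * \<mu>3))"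
    proof -
      have "u * Q1 = u * (l - a * w1\<^sup>2 - b * w2\<^sup>2 - a * b * w3\<^sup>2)" unfolding Q1_def l(2) by Groebner_Basis.algebra
      then show ?thesis unfolding \<sigma>_def Z_def C_def Q2_def by Groebner_Basis.algebra
    qed
    have exp: "w\<^sup>2 + (m1 + n * r1)\<^sup>2 + (m2 + n * r2)\<^sup>2 = (w\<^sup>2 + m1\<^sup>2 + m2\<^sup>2) + 2 * n * (m1 * r1 + m2 * r2) + n\<^sup>2 * (r1\<^sup>2 + r2\<^sup>2)"
      for w m1 m2 r1 r2 by Groebner_Basis.algebra
    have n2: "n\<^sup>2 * l\<^sup>2 = n\<^sup>2 * (l * (a * (\<mu>1\<^sup>2 + w1\<^sup>2) + b * (\<mu>2\<^sup>2 + w2\<^sup>2) + a * b * (\<mu>3\<^sup>2 + w3\<^sup>2)))"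
      unfolding l(2)[symmetric] by Groebner_Basis.algebra
    show "(u + n * l)\<^sup>2 + (- y)\<^sup>2 + x\<^sup>2
      - a * ((- w1)\<^sup>2 + (M1 \<alpha>1 w1 u g + n * (\<mu>1 * x - w1 * y))\<^sup>2 + (M2 \<alpha>1 w1 u g + n * (w1 * x + \<mu>1 * y))\<^sup>2)
      - b * ((- w2)\<^sup>2 + (M1 \<alpha>2 w2 u h + n * (\<mu>2 * x - w2 * y))\<^sup>2 + (M2 \<alpha>2 w2 u h + n * (w2 * x + \<mu>2 * y))\<^sup>2)
      - a * b * ((- w3)\<^sup>2 + (M1 \<alpha>3 w3 u 0 + n * (\<mu>3 * x - w3 * y))\<^sup>2 + (M2 \<alpha>3 w3 u 0 + n * (w3 * x + \<mu>3 * y))\<^sup>2)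
      = V u g h + 2 * n * \<sigma> u g h"
      unfolding V_def s exp inner sq power2_minus using n2 l(1) by Groebner_Basis.algebra
  qed
  \<comment> \<open>Bezout for the coefficients of \<open>u\<close>, \<open>g\<close>,
    \<open>h\<close> in \<open>\<sigma>\<close>: a common prime would contradict \<open>pl\<close>
    if it divides \<open>l\<close>, and \<open>pm\<close> otherwise.\<close>
  have "\<exists>U K1 K2. U * Z - l * (a * \<mu>1 * K1 + b * \<mu>2 * K2) = 1"
  proof -
    have "False" if p: "prime p" "p dvd Z" "p dvd l * (a * \<mu>1)" "p dvd l * (b * \<mu>2)" for p
    proof (cases "p dvd l")
      case True
      have "x * Q1 - y * Q2 = x * Z + e1 * Q2 * l"
        unfolding Z_def k_def l(1) using e by Groebner_Basis.algebra
      then have "p dvd x * Q1 - y * Q2" using p(2) True by simp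
      then show False using pl[OF p(1) True] by (simp add: Q1_def Q2_def)
    next
      case False
      then have "p dvd a * \<mu>1" "p dvd b * \<mu>2" using p prime_dvd_mult_iff by blast+
      moreover have "odd p" using \<open>p dvd b * \<mu>2\<close> par(2,4) by (metis dvd_trans even_mult_iff)
      ultimately show False using pm[OF p(1)] by blast
    qed
    then obtain u v w where "u * Z + v * (l * (a * \<mu>1)) + w * (l * (b * \<mu>2)) = 1" by (rule bezout3) blast
    then show ?thesis by (intro exI[of _ u] exI[of _ "- v"] exI[of _ "- w"]) (simp add: algebra_simps)
  qed
  then obtain U K1 K2 where UK: "U * Z - l * (a * \<mu>1 * K1 + b * \<mu>2 * K2) = 1" by blast
  have exact: "\<sigma> ((n + C) * U) ((n + C) * K1) ((n + C) * K2) = n" for n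
  proof -
    have "\<sigma> ((n + C) * U) ((n + C) * K1) ((n + C) * K2) = (n + C) * (U * Z - l * (a * \<mu>1 * K1 + b * \<mu>2 * K2)) - C"
      unfolding \<sigma>_def by Groebner_Basis.algebra
    then show ?thesis using UK by simp
  qed
  \<comment> \<open>Raising \<open>g\<close> by 1 and compensating with \<open>t\<close> times the
    Bezout vector fixes \<open>\<sigma>\<close> and changes \<open>V\<close>, modulo
    \<open>t\<close>, by \<open>- a l\<close> up to a multiple of \<open>2 a\<close>.\<close>
  define t where "t = l * (a * \<mu>1)"
  have toggle_\<sigma>: "\<sigma> (u + t * U) (g + 1 + t * K1) (h + t * K2) = \<sigma> u g h" for u g h
  proof -
    have "\<sigma> (u + t * U) (g + 1 + t * K1) (h + t * K2) = \<sigma> u g h + t * (U * Z - l * (a * \<mu>1 * K1 + b * \<mu>2 * K2)) - l * (a * \<mu>1)"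
      unfolding \<sigma>_def by Groebner_Basis.algebra
    then show ?thesis using UK by (simp add: t_def)
  qed
  have toggle_V: "t dvd V (u + t * U) (g + 1 + t * K1) (h + t * K2) - V u g h + a * l
      + 2 * a * (M1 \<alpha>1 w1 u g * x + M2 \<alpha>1 w1 u g * y)" for u g h
  proof -
    have *: "[z + t * z' = z] (mod t)" for z z' by (simp add: cong_iff_dvd_diff)
    have "[V (u + t * U) (g + 1 + t * K1) (h + t * K2) = V u (g + 1) h] (mod t)"
      unfolding V_def M1_def M2_def by (intro cong_add cong_diff cong_mult cong_pow cong_refl *)
    then have "t dvd V (u + t * U) (g + 1 + t * K1) (h + t * K2) - V u (g + 1) h" by (simp add: cong_iff_dvd_diff)
    moreover have "V u (g + 1) h = V u g h - a * l - 2 * a * (M1 \<alpha>1 w1 u g * x + M2 \<alpha>1 w1 u g * y)"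
      unfolding V_def M1_def M2_def l(1) by Groebner_Basis.algebra
    then have "V (u + t * U) (g + 1 + t * K1) (h + t * K2) - V u g h + a * l
        + 2 * a * (M1 \<alpha>1 w1 u g * x + M2 \<alpha>1 w1 u g * y)
        = V (u + t * U) (g + 1 + t * K1) (h + t * K2) - V u (g + 1) h" by simp
    ultimately show ?thesis by (simp only:)
  qed
  have finish: ?thesis if "\<sigma> u g h = j" "2 * j dvd \<alpha>0 - V u g h" for u g h j
  proof -
    from that(2) obtain n where "\<alpha>0 - V u g h = 2 * j * n" by blast
    then have "V u g h + 2 * n * \<sigma> u g h = \<alpha>0" using that(1) by (simp add: algebra_simps)
    then show ?thesis using step[of u g h n] by simp
  qed
  show ?thesis
  proof (cases "odd a")
    case True
    \<comment> \<open>For odd \<open>a\<close>, \<open>\<sigma> = 1\<close> is used;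
      \<open>t\<close> is even and \<open>a l\<close> odd, so the toggle corrects the parity of
      \<open>V\<close>.\<close>
    define u where "u = (1 + C) * U"
    define g where "g = (1 + C) * K1"
    define h where "h = (1 + C) * K2"
    have s1: "\<sigma> u g h = 1" unfolding u_def g_def h_def by (rule exact)
    show ?thesis
    proof (cases "even (\<alpha>0 - V u g h)")
      case True
      then show ?thesis using finish[OF s1] by simp
    next
      case False
      have "even t" using par(3) by (simp add: t_def)
      then have "even (V (u + t * U) (g + 1 + t * K1) (h + t * K2) - V u g h + a * l
          + 2 * a * (M1 \<alpha>1 w1 u g * x + M2 \<alpha>1 w1 u g * y))" using toggle_V dvd_trans by blast
      then have "odd (V (u + t * U) (g + 1 + t * K1) (h + t * K2) - V u g h)" using True l(3) by simp
      then have "even (\<alpha>0 - V (u + t * U) (g + 1 + t * K1) (h + t * K2))" using False by simp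
      then show ?thesis using finish[of "u + t * U" "g + 1 + t * K1" "h + t * K2" 1] toggle_\<sigma> s1 by simp
    qed
  next
    case False
    have w2: "even w2"
    proof -
      have "odd (b * (\<mu>2\<^sup>2 + w2\<^sup>2))" using l(2,3) False by simp
      then show ?thesis using par by simp
    qed
    \<comment> \<open>For even \<open>a\<close> the parity of \<open>V + \<sigma>\<close> is
      constant. If \<open>\<sigma> = 1\<close> gives the wrong parity of \<open>V\<close>, then
      \<open>\<sigma> = 2\<close> gives the right one, and the toggle shifts \<open>V\<close> by 2
      modulo 4.\<close>
    have const: "even (V u g h + \<sigma> u g h - (V 0 0 0 + \<sigma> 0 0 0))" for u g h
    proof -
      have xy: "odd (x + y)" using l(1,3) by simp
      have N: "even ((M1 \<alpha>2 w2 u h)\<^sup>2 + (M2 \<alpha>2 w2 u h)\<^sup>2) \<longleftrightarrow> even (\<alpha>2 * e1 + \<alpha>2 * e2 + h)" for u h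
        using w2 xy unfolding M1_def M2_def by simp argo
      have V: "even (V u g h) \<longleftrightarrow> even (u + 1 + (\<alpha>2 * e1 + \<alpha>2 * e2 + h))" for u g h
      proof -
        define N2 where "N2 = (M1 \<alpha>2 w2 u h)\<^sup>2 + (M2 \<alpha>2 w2 u h)\<^sup>2"
        have "even (V u g h) \<longleftrightarrow> even (u + 1 + N2)"
          using False par(2) l(3) w2 unfolding V_def add.assoc N2_def[symmetric] by simp argo
        also have "\<dots> \<longleftrightarrow> even (u + 1 + (\<alpha>2 * e1 + \<alpha>2 * e2 + h))" using N[of u h] unfolding N2_def by simp
        finally show ?thesis .
      qed
      have Z: "odd Z" using False par w2 unfolding Z_def Q1_def Q2_def by simp
      have S: "even (\<sigma> u g h) \<longleftrightarrow> even (u - C - h)" for u g h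
        using False par l(3) Z unfolding \<sigma>_def by simp
      show ?thesis using V[of u g h] S[of u g h] V[of 0 0 0] S[of 0 0 0] by simp argo
    qed
    define u where "u n = (n + C) * U" for n
    define g where "g n = (n + C) * K1" for n
    define h where "h n = (n + C) * K2" for n
    have sn: "\<sigma> (u n) (g n) (h n) = n" for n unfolding u_def g_def h_def by (rule exact)
    show ?thesis
    proof (cases "even (\<alpha>0 - V (u 1) (g 1) (h 1))")
      case True
      then show ?thesis using finish[OF sn[of 1]] by simp
    next
      case odd1: False
      have "even (V (u 1) (g 1) (h 1) + 1 - (V (u 2) (g 2) (h 2) + 2))"
        using dvd_diff[OF const[of "u 1" "g 1" "h 1"] const[of "u 2" "g 2" "h 2"]] by (simp add: sn)
      then have ev2: "even (\<alpha>0 - V (u 2) (g 2) (h 2))" using odd1 by simp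
      show ?thesis
      proof (cases "4 dvd \<alpha>0 - V (u 2) (g 2) (h 2)")
        case True
        then show ?thesis using finish[OF sn[of 2]] by simp
      next
        case not4: False
        define W where "W = V (u 2 + t * U) (g 2 + 1 + t * K1) (h 2 + t * K2)"
        obtain a' \<mu>' where a': "a = 2 * a'" "\<mu>1 = 2 * \<mu>'" using False par(3) by (meson evenE)
        have "t = 4 * (l * (a' * \<mu>'))" by (simp add: t_def a')
        then have "4 dvd t" by simp
        then have "4 dvd W - V (u 2) (g 2) (h 2) + a * l + 2 * a * (M1 \<alpha>1 w1 (u 2) (g 2) * x + M2 \<alpha>1 w1 (u 2) (g 2) * y)"
          unfolding W_def using toggle_V dvd_trans by blast
        then have "4 dvd W - V (u 2) (g 2) (h 2) + 2 * (a' * l) + 4 * (a' * (M1 \<alpha>1 w1 (u 2) (g 2) * x + M2 \<alpha>1 w1 (u 2) (g 2) * y))"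
          by (simp add: a' algebra_simps)
        then have "4 dvd W - V (u 2) (g 2) (h 2) + 2 * (a' * l)"
          by (metis dvd_add_left_iff dvd_triv_left)
        moreover have "odd (a' * l)" using par(1) l(3) a' by simp presburger
        moreover have "4 dvd A - W'" if "4 dvd W' - v + 2 * z" "odd z" "even (A - v)" "\<not> 4 dvd A - v" for A W' v z :: int
          using that by presburger
        ultimately have "4 dvd \<alpha>0 - W" using ev2 not4 by blast
        then show ?thesis using finish[of "u 2 + t * U" "g 2 + 1 + t * K1" "h 2 + t * K2" 2] toggle_\<sigma> sn[of 2]
          unfolding W_def by simp
      qed
    qed
  qed
qed

text \<open>The norm form of Z[sqrt(-2)] comes from sums and differences of two coordinates: the
  first two real parts have sum \<open>u + 2 n l\<close> and difference \<open>x\<close>. The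
  isotropic direction is \<open>(l, l, 0)\<close> on real parts and \<open>(r, - r, r')\<close> on
  coefficient vectors. Here \<open>\<sigma> = 1\<close>, and the parity of \<open>V\<close> is
  opposite to that of \<open>y\<close>.\<close>

lemma three_squares_sqrt_minus_two:
  fixes a b x y \<tau>1 \<tau>2 \<tau>3 w1 w2 w3 \<alpha>0 \<alpha>1 \<alpha>2 \<alpha>3 l :: int
  assumes l: "l = x\<^sup>2 + 2 * y\<^sup>2" "l = a * (\<tau>1\<^sup>2 + 2 * w1\<^sup>2) + b * (\<tau>2\<^sup>2 + 2 * w2\<^sup>2) + b * (2 * a) * (\<tau>3\<^sup>2 + 2 * w3\<^sup>2)" "odd l"
    and cop: "coprime x (2 * y)"
    and pl: "\<And>p. prime p \<Longrightarrow> p dvd l \<Longrightarrow> \<not> p dvd x * (a * \<tau>1\<^sup>2 + b * \<tau>2\<^sup>2 + b * (2 * a) * \<tau>3\<^sup>2)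
        - 2 * y * (a * (\<tau>1 * w1) + b * (\<tau>2 * w2) + b * (2 * a) * (\<tau>3 * w3))"
    and pm: "\<And>p. prime p \<Longrightarrow> odd p \<Longrightarrow> \<not> (p dvd a * \<tau>1 \<and> p dvd b * \<tau>2)"
    and par: "odd (y - \<alpha>0)"
  shows "sum_of_three_squares (2 * a) (2 * b) \<alpha>0 \<alpha>1 \<alpha>2 \<alpha>3"
proof -
  obtain e1 f0 where "e1 * x + f0 * (2 * y) = 1" using bezout_int[of x "2 * y"] cop by auto
  then have "x * e1 - 2 * y * (- f0) = 1" by (simp add: algebra_simps)
  then obtain e2 where e: "x * e1 - 2 * y * e2 = 1" by blast
  have "odd (x * e1 - 2 * y * e2)" unfolding e by simp
  then have "odd x" "odd e1" by auto
  then obtain x' f where xf: "x = 2 * x' + 1" "e1 = 2 * f + 1" by (meson oddE)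
  define k where "k = y * e1 + x * e2"
  define Q1 where "Q1 = a * \<tau>1\<^sup>2 + b * \<tau>2\<^sup>2 + b * (2 * a) * \<tau>3\<^sup>2"
  define Q2 where "Q2 = a * (\<tau>1 * w1) + b * (\<tau>2 * w2) + b * (2 * a) * (\<tau>3 * w3)"
  define Z where "Z = Q1 - 2 * k * Q2"
  define C where "C = a * \<alpha>1 * (w1 + k * \<tau>1) + b * \<alpha>2 * (w2 + k * \<tau>2) + b * (2 * a) * \<alpha>3 * (w3 + k * \<tau>3)"
  have "l = Q1 + 2 * (a * w1\<^sup>2 + b * w2\<^sup>2 + b * (2 * a) * w3\<^sup>2)" unfolding l(2) Q1_def by Groebner_Basis.algebra
  then have Q1l: "Q1 = l - 2 * (a * w1\<^sup>2 + b * w2\<^sup>2 + b * (2 * a) * w3\<^sup>2)" by simp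
  have Zodd: "odd Z" using l(3) unfolding Z_def Q1l by simp
  have "\<exists>U K1 K2. U * Z - l * (a * \<tau>1 * K1 + b * \<tau>2 * K2) = 1"
  proof -
    have "False" if p: "prime p" "p dvd Z" "p dvd l * (a * \<tau>1)" "p dvd l * (b * \<tau>2)" for p
    proof (cases "p dvd l")
      case True
      have "x * Q1 - 2 * y * Q2 = x * Z + 2 * e2 * Q2 * l"
        unfolding Z_def k_def l(1) using e by Groebner_Basis.algebra
      then have "p dvd x * Q1 - 2 * y * Q2" using p(2) True by simp
      then show False using pl[OF p(1) True] by (simp add: Q1_def Q2_def)
    next
      case False
      then have "p dvd a * \<tau>1" "p dvd b * \<tau>2" using p prime_dvd_mult_iff by blast+
      moreover have "odd p" using p(2) Zodd dvd_trans by blast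
      ultimately show False using pm[OF p(1)] by blast
    qed
    then obtain u v w where "u * Z + v * (l * (a * \<tau>1)) + w * (l * (b * \<tau>2)) = 1" by (rule bezout3) blast
    then show ?thesis by (intro exI[of _ u] exI[of _ "- v"] exI[of _ "- w"]) (simp add: algebra_simps)
  qed
  then obtain U K1 K2 where UK: "U * Z - l * (a * \<tau>1 * K1 + b * \<tau>2 * K2) = 1" by blast
  have "even (1 - Z)" using Zodd by simp
  then obtain z where z: "1 - Z = 2 * z" by (rule evenE)
  \<comment> \<open>\<open>u = 2 h + 1\<close> must be odd. As \<open>Z\<close> is odd too, the
    target 1 exceeds \<open>Z\<close> by \<open>2 z\<close>; \<open>j\<close> times the Bezout
    vector supplies this and cancels \<open>4 C\<close>.\<close>
  define j where "j = z + 2 * C"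
  define h where "h = j * U"
  define g1 where "g1 = j * K1"
  define g2 where "g2 = j * K2"
  define u where "u = 2 * h + 1"
  have \<sigma>: "u * Z - 4 * C - 2 * l * (a * \<tau>1 * g1 + b * \<tau>2 * g2) = 1"
  proof -
    have "u * Z - 4 * C - 2 * l * (a * \<tau>1 * g1 + b * \<tau>2 * g2)
      = 2 * j * (U * Z - l * (a * \<tau>1 * K1 + b * \<tau>2 * K2)) + Z - 4 * C"
      unfolding u_def h_def g1_def g2_def by Groebner_Basis.algebra
    also have "\<dots> = 2 * z + Z" using UK by (simp add: j_def)
    finally show ?thesis using z by simp
  qed
  \<comment> \<open>\<open>u e1 = 2 q + 1\<close>, so that the half taken in \<open>G\<close> is an
    integer.\<close>
  define q where "q = 2 * h * f + h + f"
  define G where "G \<alpha> w g = \<alpha> * e1 + w * q + y * g" for \<alpha> w g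
  define T where "T \<alpha> w g = (2 * \<alpha> + u * w) * e2 + x * g" for \<alpha> w g
  have dbl: "2 * G \<alpha> w g + w = (2 * \<alpha> + u * w) * e1 + 2 * y * g" for \<alpha> w g
    unfolding G_def q_def u_def xf(2) by Groebner_Basis.algebra
  define n0 where "n0 = (h + x' + 1)\<^sup>2 + (h - x')\<^sup>2 + y\<^sup>2"
  have n0: "2 * n0 = u\<^sup>2 + l" unfolding n0_def u_def l(1) xf(1) by Groebner_Basis.algebra
  define N where "N \<alpha> w g = (G \<alpha> w g)\<^sup>2 + (- w - G \<alpha> w g)\<^sup>2 + (T \<alpha> w g)\<^sup>2" for \<alpha> w g
  define V where "V = n0 - 2 * a * N \<alpha>1 w1 g1 - 2 * b * N \<alpha>2 w2 g2 - 2 * a * (2 * b) * N \<alpha>3 w3 0"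
  have "even (\<alpha>0 - V)"
  proof -
    have "even n0 \<longleftrightarrow> odd y" unfolding n0_def by simp argo
    then show ?thesis using par unfolding V_def by simp
  qed
  then obtain n where n: "\<alpha>0 = V + 2 * n" by (metis evenE add.commute diff_eq_eq)
  define r where "r \<tau> w = w * x + \<tau> * y" for \<tau> w
  define r' where "r' \<tau> w = \<tau> * x - 2 * w * y" for \<tau> w
  have dot: "(h + x' + 1 + n * l) * (G \<alpha> w g + n * r \<tau> w) + (h - x' + n * l) * (- w - G \<alpha> w g - n * r \<tau> w)
      + (- y) * (T \<alpha> w g + n * r' \<tau> w) = \<alpha>" for \<alpha> w g \<tau>
  proof -
    have "2 * ((h + x' + 1 + n * l) * (G \<alpha> w g + n * r \<tau> w) + (h - x' + n * l) * (- w - G \<alpha> w g - n * r \<tau> w)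
        + (- y) * (T \<alpha> w g + n * r' \<tau> w)) = x * (2 * G \<alpha> w g + w) - u * w - 2 * y * T \<alpha> w g
        + 2 * n * (x * r \<tau> w - y * r' \<tau> w - l * w)"
      unfolding u_def xf(1) by Groebner_Basis.algebra
    also have "\<dots> = 2 * \<alpha>"
      unfolding dbl T_def r_def r'_def l(1) using e by Groebner_Basis.algebra
    finally show ?thesis by simp
  qed
  have inner: "(2 * G \<alpha> w g + w) * r \<tau> w + T \<alpha> w g * r' \<tau> w = (2 * \<alpha> + u * w) * (w + k * \<tau>) + g * (l * \<tau>)" for \<alpha> w g \<tau>
    unfolding dbl T_def r_def r'_def k_def l(1) using e by Groebner_Basis.algebra
  have sq: "2 * (r \<tau> w)\<^sup>2 + (r' \<tau> w)\<^sup>2 = l * (\<tau>\<^sup>2 + 2 * w\<^sup>2)" for \<tau> w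
    unfolding r_def r'_def l(1) by Groebner_Basis.algebra
  have exp: "(G \<alpha> w g + n * r \<tau> w)\<^sup>2 + (- w - G \<alpha> w g - n * r \<tau> w)\<^sup>2 + (T \<alpha> w g + n * r' \<tau> w)\<^sup>2
      = N \<alpha> w g + 2 * n * ((2 * \<alpha> + u * w) * (w + k * \<tau>) + g * (l * \<tau>)) + n\<^sup>2 * (l * (\<tau>\<^sup>2 + 2 * w\<^sup>2))" for \<alpha> w g \<tau>
    unfolding inner[symmetric] sq[symmetric] N_def by Groebner_Basis.algebra
  show ?thesis
  proof (rule sum_of_three_squaresI[OF dot[of \<alpha>1 w1 g1 \<tau>1] dot[of \<alpha>2 w2 g2 \<tau>2] dot[of \<alpha>3 w3 0 \<tau>3]])
    have n2: "n\<^sup>2 * l\<^sup>2 = n\<^sup>2 * (l * (a * (\<tau>1\<^sup>2 + 2 * w1\<^sup>2) + b * (\<tau>2\<^sup>2 + 2 * w2\<^sup>2) + b * (2 * a) * (\<tau>3\<^sup>2 + 2 * w3\<^sup>2)))"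
      unfolding l(2)[symmetric] by Groebner_Basis.algebra
    have s: "u * l - 2 * (a * ((2 * \<alpha>1 + u * w1) * (w1 + k * \<tau>1) + g1 * (l * \<tau>1))
        + b * ((2 * \<alpha>2 + u * w2) * (w2 + k * \<tau>2) + g2 * (l * \<tau>2))
        + b * (2 * a) * ((2 * \<alpha>3 + u * w3) * (w3 + k * \<tau>3) + 0 * (l * \<tau>3))) = 1"
    proof -
      have "u * Q1 = u * (l - 2 * (a * w1\<^sup>2 + b * w2\<^sup>2 + b * (2 * a) * w3\<^sup>2))" unfolding Q1l ..
      then show ?thesis using \<sigma> unfolding Z_def C_def Q2_def by Groebner_Basis.algebra
    qed
    have p: "(h + x' + 1 + n * l)\<^sup>2 + (h - x' + n * l)\<^sup>2 + (- y)\<^sup>2 = n0 + 2 * n * (u * l) + 2 * (n\<^sup>2 * l\<^sup>2)"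
      unfolding n0_def u_def by Groebner_Basis.algebra
    show "(h + x' + 1 + n * l)\<^sup>2 + (h - x' + n * l)\<^sup>2 + (- y)\<^sup>2
      - 2 * a * ((G \<alpha>1 w1 g1 + n * r \<tau>1 w1)\<^sup>2 + (- w1 - G \<alpha>1 w1 g1 - n * r \<tau>1 w1)\<^sup>2 + (T \<alpha>1 w1 g1 + n * r' \<tau>1 w1)\<^sup>2)
      - 2 * b * ((G \<alpha>2 w2 g2 + n * r \<tau>2 w2)\<^sup>2 + (- w2 - G \<alpha>2 w2 g2 - n * r \<tau>2 w2)\<^sup>2 + (T \<alpha>2 w2 g2 + n * r' \<tau>2 w2)\<^sup>2)
      - 2 * a * (2 * b) * ((G \<alpha>3 w3 0 + n * r \<tau>3 w3)\<^sup>2 + (- w3 - G \<alpha>3 w3 0 - n * r \<tau>3 w3)\<^sup>2 + (T \<alpha>3 w3 0 + n * r' \<tau>3 w3)\<^sup>2) = \<alpha>0"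
      unfolding p exp n V_def using n2 s by Groebner_Basis.algebra
  qed
qed

section \<open>The cases of \<open>gcd a b\<close>\<close>

lemma sum_of_three_squares_swap:
  assumes "sum_of_three_squares b a \<alpha>0 \<alpha>2 \<alpha>1 \<alpha>3"
  shows "sum_of_three_squares a b \<alpha>0 \<alpha>1 \<alpha>2 \<alpha>3"
proof -
  obtain p1 p2 p3 u1 u2 u3 v1 v2 v3 t1 t2 t3 where
    *: "p1 * u1 + p2 * u2 + p3 * u3 = \<alpha>2" "p1 * v1 + p2 * v2 + p3 * v3 = \<alpha>1" "p1 * t1 + p2 * t2 + p3 * t3 = \<alpha>3"
    "p1\<^sup>2 + p2\<^sup>2 + p3\<^sup>2 - b * (u1\<^sup>2 + u2\<^sup>2 + u3\<^sup>2) - a * (v1\<^sup>2 + v2\<^sup>2 + v3\<^sup>2) - b * a * (t1\<^sup>2 + t2\<^sup>2 + t3\<^sup>2) = \<alpha>0"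
    using assms unfolding sum_of_three_squares_def by blast
  show ?thesis
    by (rule sum_of_three_squaresI[OF *(2) *(1) *(3)]) (use *(4) in \<open>simp add: mult.commute[of b a]\<close>)
qed

lemma sum_of_three_squares_coprime:
  fixes a b :: int
  assumes "a > 0" "b > 0" "squarefree a" "odd b" "coprime a b"
  shows "sum_of_three_squares a b \<alpha>0 \<alpha>1 \<alpha>2 \<alpha>3"
proof (rule base_solution_gaussian[OF assms(3,1,2,4,5)])
  fix m X1 X2 Y1 Y2
  assume sol: "b * m\<^sup>2 = X1\<^sup>2 + 1 * X2\<^sup>2 + a * (Y1\<^sup>2 + 1 * Y2\<^sup>2)"
    and Pm: "\<And>p. prime p \<Longrightarrow> p dvd 2 * a \<Longrightarrow> \<not> p dvd m"
    and PX: "\<And>p. prime p \<Longrightarrow> p dvd 2 * a \<Longrightarrow> \<not> p dvd X1"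
  have a4: "\<not> 4 dvd a" using squarefreeD[OF assms(3), of 2] by auto
  show ?thesis
  proof (rule hermitian_good_vector[OF disjI1[OF refl] assms(1) a4 _ assms(2,4,5,1) sol Pm PX])
    fix x y \<mu> w \<beta>
    assume *: "x\<^sup>2 + 1 * y\<^sup>2 = a * (\<mu>\<^sup>2 + 1 * w\<^sup>2) + b * ((\<beta> * X1)\<^sup>2 + 1 * (\<beta> * X2)\<^sup>2) + b * a * ((\<beta> * Y1)\<^sup>2 + 1 * (\<beta> * Y2)\<^sup>2)"
      "coprime x (1 * y)" "odd (x\<^sup>2 + 1 * y\<^sup>2)"
      "\<And>p. prime p \<Longrightarrow> p dvd x\<^sup>2 + 1 * y\<^sup>2 \<Longrightarrow>
        \<not> p dvd x * (a * \<mu>\<^sup>2 + b * (\<beta> * X1)\<^sup>2 + b * a * (\<beta> * Y1)\<^sup>2)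
          - 1 * y * (a * (\<mu> * w) + b * ((\<beta> * X1) * (\<beta> * X2)) + b * a * ((\<beta> * Y1) * (\<beta> * Y2)))"
      "\<And>p. prime p \<Longrightarrow> odd p \<Longrightarrow> \<not> (p dvd a * \<mu> \<and> p dvd b * (\<beta> * X1))"
      "(1::int) = 1 \<Longrightarrow> even \<mu> \<and> odd (\<beta> * X1)"
    have "even \<mu>" "odd (\<beta> * X1)" using *(6) by blast+
    then show ?thesis
      using three_squares_gaussian[OF refl *(1)[unfolded mult_1 mult.commute[of b a]] *(3)[unfolded mult_1] *(2)[unfolded mult_1]
        *(4)[unfolded mult_1 mult.commute[of b a]] *(5) a4 assms(4)] by blast
  qed simp_all
qed

lemma sum_of_three_squares_double:
  fixes a b :: int
  assumes "a > 0" "b > 0" "squarefree a" "squarefree b" "odd a" "odd b" "coprime a b" "\<not> 3 dvd a"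
  shows "sum_of_three_squares (2 * a) (2 * b) \<alpha>0 \<alpha>1 \<alpha>2 \<alpha>3"
proof (rule base_solution_sqrt_minus_two[OF assms(3,1,5,8,2,6,4,7)])
  fix m X1 X2 Y1 Y2
  assume sol: "b * m\<^sup>2 = X1\<^sup>2 + 2 * X2\<^sup>2 + 2 * a * (Y1\<^sup>2 + 2 * Y2\<^sup>2)"
    and Pm: "\<And>p. prime p \<Longrightarrow> p dvd 6 * a \<Longrightarrow> \<not> p dvd m"
    and PX: "\<And>p. prime p \<Longrightarrow> p dvd 6 * a \<Longrightarrow> \<not> p dvd X1"
  have a4: "\<not> 4 dvd a" using assms(5) by presburger
  have a2: "2 * a > 0" using assms(1) by simp
  have "p dvd 6 * a" if "p dvd 2 * a" for p using dvd_mult[OF that, of 3] by simp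
  then have Pm': "\<And>p. prime p \<Longrightarrow> p dvd 2 * a \<Longrightarrow> \<not> p dvd m" and PX': "\<And>p. prime p \<Longrightarrow> p dvd 2 * a \<Longrightarrow> \<not> p dvd X1"
    using Pm PX by blast+
  have m3: "\<not> 3 dvd m" using Pm[of 3] by simp
  \<comment> \<open>\<open>r = \<alpha>0 + 1\<close> gives \<open>y\<close> the parity opposite to
    \<open>\<alpha>0\<close>.\<close>
  show ?thesis
  proof (rule hermitian_good_vector[OF disjI2[OF refl] assms(1) a4 _ assms(2,6,7) a2 sol Pm' PX' m3, where r = "\<alpha>0 + 1"])
    fix x y \<mu> w \<beta>
    assume *: "x\<^sup>2 + 2 * y\<^sup>2 = a * (\<mu>\<^sup>2 + 2 * w\<^sup>2) + b * ((\<beta> * X1)\<^sup>2 + 2 * (\<beta> * X2)\<^sup>2) + b * (2 * a) * ((\<beta> * Y1)\<^sup>2 + 2 * (\<beta> * Y2)\<^sup>2)"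
      "coprime x (2 * y)" "odd (x\<^sup>2 + 2 * y\<^sup>2)"
      "\<And>p. prime p \<Longrightarrow> p dvd x\<^sup>2 + 2 * y\<^sup>2 \<Longrightarrow>
        \<not> p dvd x * (a * \<mu>\<^sup>2 + b * (\<beta> * X1)\<^sup>2 + b * (2 * a) * (\<beta> * Y1)\<^sup>2)
          - 2 * y * (a * (\<mu> * w) + b * ((\<beta> * X1) * (\<beta> * X2)) + b * (2 * a) * ((\<beta> * Y1) * (\<beta> * Y2)))"
      "\<And>p. prime p \<Longrightarrow> odd p \<Longrightarrow> \<not> (p dvd a * \<mu> \<and> p dvd b * (\<beta> * X1))"
      "(2::int) = 2 \<Longrightarrow> even (y - (\<alpha>0 + 1))"
    have "odd (y - \<alpha>0)" using *(6) by simp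
    then show ?thesis using three_squares_sqrt_minus_two[OF refl *(1,3,2,4,5)] by blast
  qed (use assms in simp_all)
qed

text \<open>Exchanging \<open>a\<close> and \<open>b\<close> if necessary makes \<open>b\<close> odd
  in the coprime case and, after halving, \<open>a\<close> prime to 3 in the other.\<close>

lemma sum_of_three_squares_universal:
  fixes a b :: int
  assumes "a > 0" "b > 0" "squarefree a" "squarefree b" "gcd a b \<le> 2"
  shows "sum_of_three_squares a b \<alpha>0 \<alpha>1 \<alpha>2 \<alpha>3"
proof -
  have "gcd a b > 0" using assms(1) by simp
  then consider "gcd a b = 1" | "gcd a b = 2" using assms(5) by linarith
  then show ?thesis
  proof cases
    case 1
    then have cop: "coprime a b" by (simp add: coprime_iff_gcd_eq_1)
    show ?thesis
    proof (cases "odd b")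
      case True
      then show ?thesis using sum_of_three_squares_coprime assms cop by blast
    next
      case False
      then have "odd a" using 1 by (metis gcd_greatest odd_one)
      moreover have "coprime b a" using cop by (simp add: coprime_commute)
      ultimately show ?thesis
        using sum_of_three_squares_swap sum_of_three_squares_coprime assms by blast
    qed
  next
    case 2
    obtain a' b' where ab: "a = 2 * a'" "b = 2 * b'" using 2 by (metis dvdE gcd_dvd1 gcd_dvd2)
    have pos: "a' > 0" "b' > 0" using ab assms by auto
    have "gcd (2 * a') (2 * b') = 2 * gcd a' b'" by (simp add: gcd_mult_distrib_int[symmetric])
    then have "gcd a' b' = 1" using 2 ab by simp
    then have cop: "coprime a' b'" "coprime b' a'" by (simp_all add: coprime_iff_gcd_eq_1 gcd.commute)
    have sf: "squarefree a'" "squarefree b'" using assms ab squarefree_multD by blast+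
    have odd: "odd a'" "odd b'"
    proof -
      have "\<not> 2\<^sup>2 dvd a" "\<not> 2\<^sup>2 dvd b" using squarefreeD[of a 2] squarefreeD[of b 2] assms by auto
      then show "odd a'" "odd b'" unfolding ab by (auto simp: power2_eq_square)
    qed
    show ?thesis
    proof (cases "3 dvd a'")
      case False
      then show ?thesis unfolding ab using sum_of_three_squares_double pos sf odd cop by blast
    next
      case True
      then have "\<not> 3 dvd b'" using gcd_greatest[of 3 a' b'] \<open>gcd a' b' = 1\<close> by auto
      then show ?thesis unfolding ab
        using sum_of_three_squares_swap sum_of_three_squares_double pos sf odd cop by blast
    qed
  qed
qed

subsection \<open>Two squares do not suffice\<close>

lemma square_mod_4: obtains k r where "(z::int)\<^sup>2 = 4 * k + r" "r = 0 \<or> r = 1"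
proof (cases "even z")
  case True
  then obtain j where "z = 2 * j" by (rule evenE)
  then have "z\<^sup>2 = 4 * j\<^sup>2 + 0" by (simp add: power_mult_distrib)
  then show ?thesis using that by blast
next
  case False
  then obtain j where "z = 2 * j + 1" by (rule oddE)
  then have "z\<^sup>2 = 4 * (j\<^sup>2 + j) + 1" by (simp add: power2_eq_square algebra_simps)
  then show ?thesis using that by blast
qed

text \<open>Multiplication by \<open>a\<close> completes the square. For odd \<open>a\<close>,
  squares modulo 4 decide. For even \<open>a\<close> the left side is an odd square, hence 1 modulo
  8, and 4 would divide \<open>1 + J^2\<close>.\<close>

lemma no_solution_mod_8:
  fixes a H J t :: int
  assumes "\<not> 4 dvd a" and t: "t = (if a mod 4 = 3 then 2 else 1)" and eq: "a * H\<^sup>2 + 2 * t * H = 1 + J\<^sup>2"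
  shows False
proof -
  have "(a * H + t)\<^sup>2 = t\<^sup>2 + a * (a * H\<^sup>2 + 2 * t * H)" by Groebner_Basis.algebra
  then have E: "(a * H + t)\<^sup>2 = t\<^sup>2 + a + a * J\<^sup>2"
    unfolding eq by (simp only: distrib_left mult_1_right add.assoc)
  obtain k r where k: "(a * H + t)\<^sup>2 = 4 * k + r" "r = 0 \<or> r = 1" by (rule square_mod_4[of "a * H + t"])
  obtain k' r' where k': "J\<^sup>2 = 4 * k' + r'" "r' = 0 \<or> r' = 1" by (rule square_mod_4[of J])
  have mod4: False if "4 * k + r = 2 + r' + 4 * z" for z
  proof -
    have "r - r' = 2 + 4 * (z - k)" using that by simp
    moreover have "- 1 \<le> r - r'" "r - r' \<le> 1" using k(2) k'(2) by auto
    ultimately have "- 1 \<le> 2 + 4 * (z - k)" "2 + 4 * (z - k) \<le> 1" by (simp_all only:)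
    then show False by presburger
  qed
  have mod4': False if "4 * k + r = 3 + 3 * r' + 4 * z" for z
  proof -
    have "r + r' = 3 + 4 * (z + r' - k)" using that by simp
    moreover have "0 \<le> r + r'" "r + r' \<le> 2" using k(2) k'(2) by auto
    ultimately have "0 \<le> 3 + 4 * (z + r' - k)" "3 + 4 * (z + r' - k) \<le> 2" by (simp_all only:)
    then show False by presburger
  qed
  have "a mod 4 = 1 \<or> a mod 4 = 2 \<or> a mod 4 = 3" using assms(1) by presburger
  then consider "a mod 4 = 1" | "a mod 4 = 2" | "a mod 4 = 3" by blast
  then show False
  proof cases
    case 1
    then have t1: "t = 1" using t by simp
    obtain i where a: "a = 4 * i + 1" using 1 by (metis mult_div_mod_eq)
    have "4 * k + r = 2 + r' + 4 * (i + (k' + i * J\<^sup>2))" using E k(1) k'(1) t1 a by Groebner_Basis.algebra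
    then show False by (rule mod4)
  next
    case 2
    then have t1: "t = 1" using t by simp
    obtain i where a: "a = 4 * i + 2" using 2 by (metis mult_div_mod_eq)
    define z where "z = (2 * i + 1) * H"
    have "even (z\<^sup>2 + z)" by simp
    then obtain q where q: "z\<^sup>2 + z = 2 * q" by (rule evenE)
    have E1: "(a * H + 1)\<^sup>2 = 1 + a + a * J\<^sup>2" using E unfolding t1 by simp
    have "2 * (4 * q) = 2 * (2 * (i + 2 * (2 * (i * k') + k') + i * r') + (1 + r'))"
      using E1 k'(1) a q z_def by Groebner_Basis.algebra
    then have q4: "4 * q = 2 * (i + 2 * (2 * (i * k') + k') + i * r') + (1 + r')" by simp
    have "even (1 + r')"
    proof -
      have "1 + r' = 2 * (2 * q - (i + 2 * (2 * (i * k') + k') + i * r'))" using q4 by Groebner_Basis.algebra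
      then show ?thesis by (rule dvdI)
    qed
    then have "r' = 1" using k'(2) by auto
    then have "2 * (2 * q) = 2 * (2 * (i + 2 * (i * k') + k') + 1)" using q4 by Groebner_Basis.algebra
    then have "2 * q = 2 * (i + 2 * (i * k') + k') + 1" by simp
    then have "even (2 * (i + 2 * (i * k') + k') + 1)" by (metis dvd_triv_left)
    then show False by simp
  next
    case 3
    then have t2: "t = 2" using t by simp
    obtain i where a: "a = 4 * i + 3" using 3 by (metis mult_div_mod_eq)
    have "4 * k + r = 3 + 3 * r' + 4 * (1 + i + (3 * k' + i * J\<^sup>2))" using E k(1) k'(1) t2 a by Groebner_Basis.algebra
    then show False by (rule mod4')
  qed
qed

text \<open>Orthogonality to the primitive \<open>(p1, p2)\<close> makes \<open>(v1, v2)\<close> and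
  \<open>(t1, t2)\<close> multiples of \<open>(- p2, p1)\<close>. Positivity of
  \<open>2 t + a H\<close> then forces \<open>n = 2 t + a H\<close>, which is combined with the
  two-square identity \<open>n H = 1 + J^2\<close>.\<close>

lemma not_sum_of_two_squares:
  fixes a b p1 p2 u1 u2 v1 v2 t1 t2 :: int
  assumes ab: "a > 0" "b > 0" "\<not> 4 dvd a"
    and eqs: "p1 * u1 + p2 * u2 = 1" "p1 * v1 + p2 * v2 = 0" "p1 * t1 + p2 * t2 = 0"
    and eq0: "p1\<^sup>2 + p2\<^sup>2 - a * (u1\<^sup>2 + u2\<^sup>2) - b * (v1\<^sup>2 + v2\<^sup>2) - a * b * (t1\<^sup>2 + t2\<^sup>2)
      = 2 * (if a mod 4 = 3 then 2 else 1)"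
  shows False
proof -
  define t :: int where "t = (if a mod 4 = 3 then 2 else 1)"
  define n where "n = p1\<^sup>2 + p2\<^sup>2"
  define H where "H = u1\<^sup>2 + u2\<^sup>2"
  define J where "J = p1 * u2 - p2 * u1"
  define j where "j = u1 * v2 - u2 * v1"
  define i where "i = u1 * t2 - u2 * t1"
  have "v1 = - p2 * j" "v2 = p1 * j" unfolding j_def using eqs(1,2) by Groebner_Basis.algebra+
  then have v: "v1\<^sup>2 + v2\<^sup>2 = n * j\<^sup>2" unfolding n_def by Groebner_Basis.algebra
  have "t1 = - p2 * i" "t2 = p1 * i" unfolding i_def using eqs(1,3) by Groebner_Basis.algebra+
  then have tt: "t1\<^sup>2 + t2\<^sup>2 = n * i\<^sup>2" unfolding n_def by Groebner_Basis.algebra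
  have nH: "n * H = 1 + J\<^sup>2" unfolding n_def H_def J_def using eqs(1) by Groebner_Basis.algebra
  have n0: "n \<ge> 0" and H0: "H \<ge> 0" by (simp_all add: n_def H_def)
  have main: "n * (1 - b * j\<^sup>2 - a * b * i\<^sup>2) = 2 * t + a * H"
    using eq0 unfolding v tt n_def[symmetric] H_def[symmetric] t_def[symmetric] by (simp add: algebra_simps)
  have "t > 0" by (simp add: t_def)
  moreover have "a * H \<ge> 0" using ab H0 by simp
  ultimately have "n * (1 - b * j\<^sup>2 - a * b * i\<^sup>2) > 0" unfolding main by simp
  then have "1 - b * j\<^sup>2 - a * b * i\<^sup>2 > 0" using n0 by (simp add: zero_less_mult_iff)
  moreover have "b * j\<^sup>2 \<ge> 0" "a * b * i\<^sup>2 \<ge> 0" using ab by simp_all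
  ultimately have one: "1 - b * j\<^sup>2 - a * b * i\<^sup>2 = 1" by linarith
  have "n = 2 * t + a * H" using main unfolding one mult_1_right .
  then have "a * H\<^sup>2 + 2 * t * H = 1 + J\<^sup>2" using nH by Groebner_Basis.algebra
  then show False by (rule no_solution_mod_8[OF ab(3) t_def])
qed

subsection \<open>Squares in the quaternion ring\<close>

lemma LQ_square:
  "LQuat x0 x1 x2 x3 [^]\<^bsub>LQ a b\<^esub> (2::nat)
     = LQuat (x0\<^sup>2 - a * x1\<^sup>2 - b * x2\<^sup>2 - a * b * x3\<^sup>2) (2 * (x0 * x1)) (2 * (x0 * x2)) (2 * (x0 * x3))"
proof -
  interpret ring "LQ a b" by (rule LQ_ring)
  have "LQuat x0 x1 x2 x3 [^]\<^bsub>LQ a b\<^esub> Suc (Suc 0) = lq_mult a b (LQuat x0 x1 x2 x3) (LQuat x0 x1 x2 x3)"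
    by (simp only: nat_pow_Suc nat_pow_0) simp
  then show ?thesis by (simp add: numeral_2_eq_2 power2_eq_square algebra_simps)
qed

lemma LQ_finsum_lessThan_Suc:
  "(\<Oplus>\<^bsub>LQ a b\<^esub> i \<in> {..<Suc n}. h i) = lq_add (h n) (\<Oplus>\<^bsub>LQ a b\<^esub> i \<in> {..<n}. h i)"
proof -
  interpret ring "LQ a b" by (rule LQ_ring)
  show ?thesis by (simp add: lessThan_Suc finsum_insert)
qed

lemma LQ_finsum_lessThan_0: "(\<Oplus>\<^bsub>LQ a b\<^esub> i \<in> {..<0::nat}. h i) = LQuat 0 0 0 0"
proof -
  interpret ring "LQ a b" by (rule LQ_ring)
  show ?thesis by simp
qed

lemma sum_of_at_most_3_squares:
  assumes "sum_of_three_squares a b \<alpha>0 \<alpha>1 \<alpha>2 \<alpha>3"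
  shows "sum_of_at_most_powers a b 2 3 (LQuat \<alpha>0 (2 * \<alpha>1) (2 * \<alpha>2) (2 * \<alpha>3))"
proof -
  obtain p1 p2 p3 u1 u2 u3 v1 v2 v3 t1 t2 t3 where
    *: "p1 * u1 + p2 * u2 + p3 * u3 = \<alpha>1" "p1 * v1 + p2 * v2 + p3 * v3 = \<alpha>2" "p1 * t1 + p2 * t2 + p3 * t3 = \<alpha>3"
    "p1\<^sup>2 + p2\<^sup>2 + p3\<^sup>2 - a * (u1\<^sup>2 + u2\<^sup>2 + u3\<^sup>2) - b * (v1\<^sup>2 + v2\<^sup>2 + v3\<^sup>2) - a * b * (t1\<^sup>2 + t2\<^sup>2 + t3\<^sup>2) = \<alpha>0"
    using assms unfolding sum_of_three_squares_def by blast
  define f :: "nat \<Rightarrow> lquat" where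
    "f i = (if i = 0 then LQuat p1 u1 v1 t1 else if i = 1 then LQuat p2 u2 v2 t2 else LQuat p3 u3 v3 t3)" for i
  have "(\<Oplus>\<^bsub>LQ a b\<^esub> i \<in> {..<3}. f i [^]\<^bsub>LQ a b\<^esub> (2::nat)) = LQuat \<alpha>0 (2 * \<alpha>1) (2 * \<alpha>2) (2 * \<alpha>3)"
    unfolding numeral_3_eq_3 LQ_finsum_lessThan_Suc LQ_finsum_lessThan_0
    by (simp add: f_def LQ_square *[symmetric] algebra_simps)
  then show ?thesis unfolding sum_of_at_most_powers_def
    by (intro exI[of _ 3] conjI bexI[of _ f]) auto
qed

text \<open>Missing summands are filled up with the square of 0.\<close>

lemma sum_of_at_most_2_squares:
  assumes "sum_of_at_most_powers a b 2 g z" "g \<le> 2"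
  obtains x y where "z = lq_add (x [^]\<^bsub>LQ a b\<^esub> (2::nat)) (y [^]\<^bsub>LQ a b\<^esub> (2::nat))"
proof -
  obtain m f where mf: "m \<le> g" "z = (\<Oplus>\<^bsub>LQ a b\<^esub> i \<in> {..<m}. f i [^]\<^bsub>LQ a b\<^esub> (2::nat))"
    using assms(1) unfolding sum_of_at_most_powers_def by blast
  have zero: "LQuat 0 0 0 0 [^]\<^bsub>LQ a b\<^esub> (2::nat) = LQuat 0 0 0 0" by (simp add: LQ_square)
  have add0: "lq_add x (LQuat 0 0 0 0) = x" for x by (cases x) simp
  have "m = 0 \<or> m = 1 \<or> m = 2" using mf(1) assms(2) by linarith
  then show ?thesis
  proof (elim disjE)
    assume "m = 0"
    then show ?thesis using mf(2) that[of "LQuat 0 0 0 0" "LQuat 0 0 0 0"] LQ_finsum_lessThan_0 by (simp add: zero)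
  next
    assume "m = 1"
    then have "z = lq_add (f 0 [^]\<^bsub>LQ a b\<^esub> (2::nat)) (LQuat 0 0 0 0)"
      using mf(2) unfolding One_nat_def by (simp only: LQ_finsum_lessThan_Suc LQ_finsum_lessThan_0)
    then show ?thesis using that[of "f 0" "LQuat 0 0 0 0"] zero by simp
  next
    assume "m = 2"
    then have "z = lq_add (f 1 [^]\<^bsub>LQ a b\<^esub> (2::nat)) (lq_add (f 0 [^]\<^bsub>LQ a b\<^esub> (2::nat)) (LQuat 0 0 0 0))"
      using mf(2) unfolding numeral_2_eq_2 One_nat_def by (simp only: LQ_finsum_lessThan_Suc LQ_finsum_lessThan_0)
    then show ?thesis using that[of "f 1" "f 0"] add0 by simp
  qed
qed

lemma LQ_power_group_2_subset:
  "LQ_power_group a b 2 \<subseteq> {LQuat \<alpha>0 (2 * \<alpha>1) (2 * \<alpha>2) (2 * \<alpha>3) | \<alpha>0 \<alpha>1 \<alpha>2 \<alpha>3. True}" (is "_ \<subseteq> ?S")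
proof -
  interpret ring "LQ a b" by (rule LQ_ring)
  have inv: "inv\<^bsub>add_monoid (LQ a b)\<^esub> (LQuat x0 x1 x2 x3) = LQuat (- x0) (- x1) (- x2) (- x3)" for x0 x1 x2 x3
    by (rule group.inv_equality[OF a_group]) simp_all
  have mem: "LQuat x0 (2 * x1) (2 * x2) (2 * x3) \<in> ?S" for x0 x1 x2 x3 by auto
  have "subgroup ?S (add_monoid (LQ a b))"
  proof (rule group.subgroupI[OF a_group])
    show "?S \<subseteq> carrier (add_monoid (LQ a b))" by simp
    show "?S \<noteq> {}" using mem by (metis empty_iff)
  next
    fix x assume "x \<in> ?S"
    then obtain x0 x1 x2 x3 where x: "x = LQuat x0 (2 * x1) (2 * x2) (2 * x3)" by auto
    show "inv\<^bsub>add_monoid (LQ a b)\<^esub> x \<in> ?S"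
      using mem[of "- x0" "- x1" "- x2" "- x3"] unfolding x inv mult_minus_right .
  next
    fix x y assume "x \<in> ?S" "y \<in> ?S"
    then obtain x0 x1 x2 x3 y0 y1 y2 y3 where
      xy: "x = LQuat x0 (2 * x1) (2 * x2) (2 * x3)" "y = LQuat y0 (2 * y1) (2 * y2) (2 * y3)" by auto
    have "x \<otimes>\<^bsub>add_monoid (LQ a b)\<^esub> y = LQuat (x0 + y0) (2 * (x1 + y1)) (2 * (x2 + y2)) (2 * (x3 + y3))"
      unfolding xy by (simp add: distrib_left)
    then show "x \<otimes>\<^bsub>add_monoid (LQ a b)\<^esub> y \<in> ?S" using mem by (simp only:)
  qed
  moreover have "{x [^]\<^bsub>LQ a b\<^esub> (2::nat) | x. x \<in> carrier (LQ a b)} \<subseteq> ?S"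
  proof
    fix z assume "z \<in> {x [^]\<^bsub>LQ a b\<^esub> (2::nat) | x. x \<in> carrier (LQ a b)}"
    then obtain x where z: "z = x [^]\<^bsub>LQ a b\<^esub> (2::nat)" by auto
    obtain x0 x1 x2 x3 where x: "x = LQuat x0 x1 x2 x3" by (cases x)
    show "z \<in> ?S" unfolding z x LQ_square by (rule mem)
  qed
  ultimately show ?thesis unfolding LQ_power_group_def by (intro group.generate_subgroup_incl[OF a_group])
qed

text \<open>\<open>(1 + i)^2 = 1 - a + 2 i\<close>, to which \<open>n\<close> copies of
  \<open>1^2\<close> are added.\<close>

lemma LQ_power_group_2_mem: "LQuat (1 - a + int n) 2 0 0 \<in> LQ_power_group a b 2"
proof -
  interpret ring "LQ a b" by (rule LQ_ring)
  have sq: "x [^]\<^bsub>LQ a b\<^esub> (2::nat) \<in> LQ_power_group a b 2" for x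
    unfolding LQ_power_group_def by (intro generate.incl) auto
  show ?thesis
  proof (induction n)
    case 0
    show ?case using sq[of "LQuat 1 1 0 0"] by (simp add: LQ_square)
  next
    case (Suc n)
    have "LQuat (1 - a + int n) 2 0 0 \<otimes>\<^bsub>add_monoid (LQ a b)\<^esub> (LQuat 1 0 0 0 [^]\<^bsub>LQ a b\<^esub> (2::nat)) \<in> LQ_power_group a b 2"
      using Suc sq[of "LQuat 1 0 0 0"] unfolding LQ_power_group_def by (rule generate.eng)
    then show ?case by (simp add: LQ_square algebra_simps)
  qed
qed

theorem theorem1p2:
  fixes a b :: int
  assumes "a > 0" and "b > 0"
    and "squarefree a" and "squarefree b"
    and "gcd a b \<le> 2"
  shows "waring_number a b 2 = 3"
proof -
  let ?P = "\<lambda>g. \<forall>x \<in> LQ_power_group a b 2. sum_of_at_most_powers a b 2 g x"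
  have upper: "?P 3"
    using LQ_power_group_2_subset sum_of_at_most_3_squares[OF sum_of_three_squares_universal[OF assms]] by blast
  have lower: "3 \<le> g" if "?P g" for g
  proof (rule ccontr)
    assume "\<not> 3 \<le> g"
    then have g: "g \<le> 2" by simp
    have a4: "\<not> 4 dvd a" using squarefreeD[OF assms(3), of 2] by auto
    \<comment> \<open>Here \<open>t\<close> is the whole scalar part; \<open>t - 1 + a\<close>
      copies of \<open>1^2\<close> added to \<open>(1 + i)^2\<close> reach it.\<close>
    define t :: int where "t = 2 * (if a mod 4 = 3 then 2 else 1)"
    have "t - 1 + a \<ge> 0" using assms(1) by (simp add: t_def)
    then have "LQuat t 2 0 0 \<in> LQ_power_group a b 2"
      using LQ_power_group_2_mem[of a "nat (t - 1 + a)" b] by simp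
    then have "sum_of_at_most_powers a b 2 g (LQuat t 2 0 0)" using that by blast
    then obtain x y where xy: "LQuat t 2 0 0 = lq_add (x [^]\<^bsub>LQ a b\<^esub> (2::nat)) (y [^]\<^bsub>LQ a b\<^esub> (2::nat))"
      using sum_of_at_most_2_squares[OF _ g] by blast
    obtain p1 u1 v1 t1 where x: "x = LQuat p1 u1 v1 t1" by (cases x)
    obtain p2 u2 v2 t2 where y: "y = LQuat p2 u2 v2 t2" by (cases y)
    show False
      using not_sum_of_two_squares[OF assms(1,2) a4, of p1 u1 p2 u2 v1 v2 t1 t2] xy
      unfolding x y by (simp add: LQ_square t_def algebra_simps)
  qed
  show ?thesis unfolding waring_number_def
  proof (rule antisym)
    have "enat 3 \<in> {enat g | g. 0 < g \<and> ?P g}" using upper by force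
    then show "Inf {enat g | g. 0 < g \<and> ?P g} \<le> 3" unfolding numeral_eq_enat by (rule Inf_lower)
    show "3 \<le> Inf {enat g | g. 0 < g \<and> ?P g}"
    proof (rule Inf_greatest)
      fix z assume "z \<in> {enat g | g. 0 < g \<and> ?P g}"
      then obtain g where g: "z = enat g" "?P g" by auto
      show "3 \<le> z" unfolding g(1) numeral_eq_enat enat_ord_simps(1) by (rule lower[OF g(2)])
    qed
  qed
qed

end
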